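(* Let $n\geq 3$, let $\Omega\subset\mathbb{R}^n$ be a compact connected set with nonempty interior and smooth boundary, let $p\in(1,2)\cup(2,\infty)$, and let $\zeta\in\mathbb{R}^n$ be a unit vector. If $\gamma,\tilde\gamma\in C^\infty(\overline\Omega)$ are strictly positive functions such that $\zeta\cdot\nabla\gamma=\zeta\cdot\nabla\tilde\gamma=0$ in $\Omega$ and $\Lambda_\gamma=\Lambda_{\tilde\gamma}$, then $\gamma=\tilde\gamma$.
   Context: Fix $\alpha\in(0,1]$. For a strictly positive $\gamma\in C^\infty(\overline\Omega)$ and a real-valued $f\in C^{1,\alpha}(\partial\Omega)$, the boundary value problem $\nabla\cdot(\gamma|\nabla u|^{p-2}\nabla u)=0$ in $\Omega$, $u|_{\partial\Omega}=f$, has a unique real-valued weak solution $u$, and $u\in C^{1,\beta}(\overline\Omega)$ for some $\beta\in(0,1)$. The Dirichlet-to-Neumann map is defined by $\Lambda_\gamma(f)=\left(\gamma|\nabla u|^{p-2}\partial_\nu u\right)|_{\partial\Omega}$ for all $f\in C^{1,\alpha}(\partial\Omega)$, where $u$ is this solution and $\nu$ is the exterior unit normal on $\partial\Omega$. *)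

theory Defs
  imports "HOL-Analysis.Analysis"
begin

section \<open>Gradients, smooth functions and Hoelder classes\<close>

(* The derivative within S determines the gradient uniquely at interior points of S and, when S is
   a closed domain with smooth boundary, also at its boundary points.  Thus grad S u is defined up
   to the boundary and does not depend on the values of u outside S. *)
definition grad :: "(real ^ 'n) set \<Rightarrow> (real ^ 'n \<Rightarrow> real) \<Rightarrow> real ^ 'n \<Rightarrow> real ^ 'n" where
  "grad S u x = (\<chi> i. frechet_derivative u (at x within S) (axis i 1))"

(* Intended for open S. *)
primrec Ck_on :: "nat \<Rightarrow> (real ^ 'n) set \<Rightarrow> (real ^ 'n \<Rightarrow> real) \<Rightarrow> bool" where
  "Ck_on 0 S f \<longleftrightarrow> continuous_on S f"
| "Ck_on (Suc k) S f \<longleftrightarrow> f differentiable_on S \<and> (\<forall>i. Ck_on k S (\<lambda>x. grad S f x $ i))"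

definition smooth_on :: "(real ^ 'n) set \<Rightarrow> (real ^ 'n \<Rightarrow> real) \<Rightarrow> bool" where
  "smooth_on S f \<longleftrightarrow> (\<forall>k. Ck_on k S f)"

definition smooth_on_closed :: "(real ^ 'n) set \<Rightarrow> (real ^ 'n \<Rightarrow> real) \<Rightarrow> bool" where
  "smooth_on_closed S f \<longleftrightarrow>
     (\<exists>U g. open U \<and> S \<subseteq> U \<and> smooth_on U g \<and> (\<forall>x\<in>S. g x = f x))"

(* The class of differentiable functions on S, up to the boundary, with gradient of Hoelder
   exponent b on S; S is open or a closed domain with smooth boundary. *)
definition C1_holder_on :: "real \<Rightarrow> (real ^ 'n) set \<Rightarrow> (real ^ 'n \<Rightarrow> real) \<Rightarrow> bool" where
  "C1_holder_on b S u \<longleftrightarrow>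
     u differentiable_on S \<and>
     (\<exists>C. \<forall>x\<in>S. \<forall>y\<in>S. norm (grad S u x - grad S u y) \<le> C * dist x y powr b)"

(* Functions on the boundary hypersurface are regarded as the restrictions of functions of the
   same regularity on an open neighbourhood; only the values of f on the frontier matter. *)
definition C1_holder_boundary :: "real \<Rightarrow> (real ^ 'n) set \<Rightarrow> (real ^ 'n \<Rightarrow> real) \<Rightarrow> bool" where
  "C1_holder_boundary a \<Omega> f \<longleftrightarrow>
     (\<exists>U F. open U \<and> frontier \<Omega> \<subseteq> U \<and> C1_holder_on a U F \<and> (\<forall>x\<in>frontier \<Omega>. F x = f x))"

section \<open>Domains with smooth boundary\<close>

definition local_defining_function ::
    "(real ^ 'n) set \<Rightarrow> real ^ 'n \<Rightarrow> (real ^ 'n) set \<Rightarrow> (real ^ 'n \<Rightarrow> real) \<Rightarrow> bool" where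
  "local_defining_function \<Omega> x U \<rho> \<longleftrightarrow>
     open U \<and> x \<in> U \<and> smooth_on U \<rho> \<and> (\<forall>y\<in>U. grad U \<rho> y \<noteq> 0) \<and>
     \<Omega> \<inter> U = {y \<in> U. \<rho> y \<le> 0}"

definition smooth_boundary :: "(real ^ 'n) set \<Rightarrow> bool" where
  "smooth_boundary \<Omega> \<longleftrightarrow> (\<forall>x\<in>frontier \<Omega>. \<exists>U \<rho>. local_defining_function \<Omega> x U \<rho>)"

(* The normalised gradients at x of any two local defining functions agree. *)
definition exterior_normal :: "(real ^ 'n) set \<Rightarrow> real ^ 'n \<Rightarrow> real ^ 'n" where
  "exterior_normal \<Omega> x =
     (THE \<nu>. \<exists>U \<rho>. local_defining_function \<Omega> x U \<rho> \<and> \<nu> = grad U \<rho> x /\<^sub>R norm (grad U \<rho> x))"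

section \<open>Sobolev spaces on an open set\<close>

definition Lp_on :: "real \<Rightarrow> (real ^ 'n) set \<Rightarrow> (real ^ 'n \<Rightarrow> 'b::euclidean_space) \<Rightarrow> bool" where
  "Lp_on p D u \<longleftrightarrow> u \<in> borel_measurable (lebesgue_on D) \<and>
     integrable (lebesgue_on D) (\<lambda>x. norm (u x) powr p)"

definition test_function :: "(real ^ 'n) set \<Rightarrow> (real ^ 'n \<Rightarrow> real) \<Rightarrow> bool" where
  "test_function D \<phi> \<longleftrightarrow> smooth_on UNIV \<phi> \<and>
     compact (closure {x. \<phi> x \<noteq> 0}) \<and> closure {x. \<phi> x \<noteq> 0} \<subseteq> D"

(* Intended for locally integrable u and G. *)
definition weak_gradient ::
    "(real ^ 'n) set \<Rightarrow> (real ^ 'n \<Rightarrow> real) \<Rightarrow> (real ^ 'n \<Rightarrow> real ^ 'n) \<Rightarrow> bool" where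
  "weak_gradient D u G \<longleftrightarrow> (\<forall>\<phi> i. test_function D \<phi> \<longrightarrow>
     integral\<^sup>L (lebesgue_on D) (\<lambda>x. u x * grad UNIV \<phi> x $ i) =
     - integral\<^sup>L (lebesgue_on D) (\<lambda>x. G x $ i * \<phi> x))"

definition W1p_with_gradient ::
    "real \<Rightarrow> (real ^ 'n) set \<Rightarrow> (real ^ 'n \<Rightarrow> real) \<Rightarrow> (real ^ 'n \<Rightarrow> real ^ 'n) \<Rightarrow> bool" where
  "W1p_with_gradient p D u G \<longleftrightarrow> Lp_on p D u \<and> Lp_on p D G \<and> weak_gradient D u G"

definition W1p :: "real \<Rightarrow> (real ^ 'n) set \<Rightarrow> (real ^ 'n \<Rightarrow> real) \<Rightarrow> bool" where
  "W1p p D u \<longleftrightarrow> (\<exists>G. W1p_with_gradient p D u G)"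

(* The closure of the test functions in the W1p norm. *)
definition W1p_zero :: "real \<Rightarrow> (real ^ 'n) set \<Rightarrow> (real ^ 'n \<Rightarrow> real) \<Rightarrow> bool" where
  "W1p_zero p D u \<longleftrightarrow> (\<exists>G \<phi>. W1p_with_gradient p D u G \<and> (\<forall>k::nat. test_function D (\<phi> k)) \<and>
     (\<lambda>k. integral\<^sup>L (lebesgue_on D) (\<lambda>x. \<bar>u x - \<phi> k x\<bar> powr p)) \<longlonglongrightarrow> 0 \<and>
     (\<lambda>k. integral\<^sup>L (lebesgue_on D) (\<lambda>x. norm (G x - grad UNIV (\<phi> k) x) powr p)) \<longlonglongrightarrow> 0)"

section \<open>The weighted p-Laplace equation and its Dirichlet-to-Neumann map\<close>

(* The boundary condition u = f says that u differs by an element of W1p_zero from a function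
   continuous up to the boundary that takes the values f there.
   Since 0 powr a = 0, the expression |G|^(p-2) G vanishes where G does, also for p < 2. *)
definition weak_solution ::
    "real \<Rightarrow> (real ^ 'n) set \<Rightarrow> (real ^ 'n \<Rightarrow> real) \<Rightarrow> (real ^ 'n \<Rightarrow> real) \<Rightarrow> (real ^ 'n \<Rightarrow> real) \<Rightarrow> bool"
  where
  "weak_solution p \<Omega> \<gamma> f u \<longleftrightarrow>
     (\<exists>G. W1p_with_gradient p (interior \<Omega>) u G \<and>
        (\<forall>\<phi>. test_function (interior \<Omega>) \<phi> \<longrightarrow>
           integral\<^sup>L (lebesgue_on (interior \<Omega>))
             (\<lambda>x. \<gamma> x * norm (G x) powr (p - 2) * (G x \<bullet> grad UNIV \<phi> x)) = 0)) \<and>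
     (\<exists>F. continuous_on \<Omega> F \<and> W1p p (interior \<Omega>) F \<and> (\<forall>x\<in>frontier \<Omega>. F x = f x) \<and>
        W1p_zero p (interior \<Omega>) (\<lambda>x. u x - F x))"

(* A weak solution is unique up to null sets and has a representative with Hoelder continuous
   gradient on \<Omega>, which is unique on \<Omega>; its values elsewhere are irrelevant. *)
definition dirichlet_solution ::
    "real \<Rightarrow> (real ^ 'n) set \<Rightarrow> (real ^ 'n \<Rightarrow> real) \<Rightarrow> (real ^ 'n \<Rightarrow> real) \<Rightarrow> real ^ 'n \<Rightarrow> real" where
  "dirichlet_solution p \<Omega> \<gamma> f =
     (SOME u. weak_solution p \<Omega> \<gamma> f u \<and> (\<exists>b. 0 < b \<and> b < 1 \<and> C1_holder_on b \<Omega> u))"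

(* To be evaluated at points of the frontier of \<Omega>. *)
definition DN_map ::
    "real \<Rightarrow> (real ^ 'n) set \<Rightarrow> (real ^ 'n \<Rightarrow> real) \<Rightarrow> (real ^ 'n \<Rightarrow> real) \<Rightarrow> real ^ 'n \<Rightarrow> real" where
  "DN_map p \<Omega> \<gamma> f x =
     (let g = grad \<Omega> (dirichlet_solution p \<Omega> \<gamma> f) x
      in \<gamma> x * norm g powr (p - 2) * (g \<bullet> exterior_normal \<Omega> x))"

end

theory Submission
  imports Defs
begin

text \<open>Since \<open>\<gamma>\<close> is constant in the direction \<open>\<zeta>\<close> and \<open>\<bar>\<zeta>\<bar> = 1\<close>, the function \<open>x \<mapsto> \<zeta> \<bullet> x\<close> solves the
  \<open>p\<close>-Laplace equation with weight \<open>\<gamma>\<close>. By uniqueness of the solution (strict monotonicity of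
  \<open>a \<mapsto> \<bar>a\<bar>\<^sup>p\<^sup>-\<^sup>2 a\<close>) its Neumann data are \<open>\<gamma> (\<zeta> \<bullet> \<nu>)\<close>, so \<open>\<gamma> = \<gamma>'\<close> at the boundary points where \<open>\<zeta>\<close> is not
  tangential. The lines parallel to \<open>\<zeta>\<close> carry the values of \<open>\<gamma>\<close> and \<open>\<gamma>'\<close> at those points into the interior,
  and the lines that leave \<open>\<Omega>\<close> at such a point are dense. No regularity theory is needed: existence of
  the solution is explicit, and uniqueness is needed only among functions that are \<open>C\<^sup>1\<close> up to the boundary.\<close>

section \<open>Differentiability classes\<close>

text \<open>The Dirichlet solution is a choice among weak solutions that are C^1 up to the boundary,
  while its equation and boundary values are given in Sobolev terms. Three bridges lead to classical
  calculus. The weak gradient equals the classical one almost everywhere, by the fundamental lemma.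
  A member of \<open>W1p_zero\<close> that is continuous up to the boundary vanishes there: in place
  of a trace operator, a small box is slid across the boundary and its volume estimated. Truncations
  of a C^1 function are not smooth, so mollification enlarges the class of test functions. For the
  linear function the factor |grad|^(p-2) is 1, and the equation reduces to the vanishing divergence
  of the field \<gamma> \<zeta>, which is the derivative of \<gamma> along \<zeta>. On the frontier,
  \<open>grad \<Omega>\<close> and \<open>exterior_normal\<close> are choice terms. Both are pinned
  down by one fact: the directions entering the interior contain an open half space. Density of the
  good lines comes from an ellipsoid touching the frontier from inside, instead of Sard's
  theorem.\<close>

lemma inner_axis_expansion:
  fixes h :: "real ^ 'n"
  assumes "linear f"
  shows "f h = h \<bullet> (\<chi> i. f (axis i 1))"
proof -
  have "f h = f (\<Sum>i\<in>UNIV. h $ i *\<^sub>R axis i 1)"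
    using basis_expansion[of h] by (simp add: scalar_mult_eq_scaleR)
  also have "\<dots> = (\<Sum>i\<in>UNIV. h $ i * f (axis i 1))"
    using assms by (simp add: linear_sum linear_cmul)
  finally show ?thesis by (simp add: inner_vec_def)
qed

text \<open>Frontier points are included: \<open>frechet_derivative\<close> is then some derivative
  within \<open>S\<close>, and linearity turns it into the inner product with its values on the
  axes.\<close>

lemma has_derivative_grad_within:
  assumes "u differentiable (at x within S)"
  shows "(u has_derivative (\<lambda>h. h \<bullet> grad S u x)) (at x within S)"
proof -
  have d: "(u has_derivative frechet_derivative u (at x within S)) (at x within S)"
    using assms frechet_derivative_works by blast
  then have "frechet_derivative u (at x within S) = (\<lambda>h. h \<bullet> grad S u x)"
    unfolding grad_def using inner_axis_expansion has_derivative_linear by blast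
  with d show ?thesis by simp
qed

lemma grad_eqI:
  assumes "GDERIV u x :> d" and "x \<in> interior S"
  shows "grad S u x = d"
proof -
  have "at x within S = at x" using assms(2) by (rule at_within_interior)
  moreover have "frechet_derivative u (at x) = (\<lambda>h. h \<bullet> d)"
    using assms(1) unfolding gderiv_def by (metis frechet_derivative_at)
  ultimately show ?thesis
    by (simp add: grad_def vec_eq_iff inner_axis')
qed

lemma GDERIV_grad:
  assumes "u differentiable (at x within S)" and "x \<in> interior S"
  shows "GDERIV u x :> grad S u x"
  using has_derivative_grad_within[OF assms(1)] at_within_interior[OF assms(2)]
  by (simp add: gderiv_def)

text \<open>Functions that agree on \<open>S\<close> have the same set of derivatives within
  \<open>S\<close>, so \<open>frechet_derivative\<close> makes the same choice for both, even where
  the derivative is not unique.\<close>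

lemma grad_cong:
  assumes "\<And>y. y \<in> S \<Longrightarrow> f y = g y" and "x \<in> S"
  shows "grad S f x = grad S g x"
proof -
  have "(f has_derivative F) (at x within S) \<longleftrightarrow> (g has_derivative F) (at x within S)" for F
    using assms has_derivative_transform[of x S f g F] has_derivative_transform[of x S g f F] by auto
  then show ?thesis by (simp add: grad_def frechet_derivative_def)
qed

lemma Ck_on_cong:
  assumes "\<And>y. y \<in> S \<Longrightarrow> f y = g y"
  shows "Ck_on k S f \<longleftrightarrow> Ck_on k S g"
  using assms
proof (induction k arbitrary: f g)
  case 0
  then show ?case by (simp cong: continuous_on_cong)
next
  case (Suc k)
  have "(f has_derivative F) (at x within S) \<longleftrightarrow> (g has_derivative F) (at x within S)" if "x \<in> S" for F x
    using Suc.prems that has_derivative_transform[of x S f g F] has_derivative_transform[of x S g f F] by auto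
  then have "f differentiable_on S \<longleftrightarrow> g differentiable_on S"
    by (auto simp: differentiable_on_def differentiable_def)
  moreover have "Ck_on k S (\<lambda>x. grad S f x $ i) \<longleftrightarrow> Ck_on k S (\<lambda>x. grad S g x $ i)" for i
    by (rule Suc.IH) (use grad_cong[of S f g] Suc.prems in simp)
  ultimately show ?case by simp
qed

text \<open>The entry to the inductions on the order: an explicit gradient formula \<open>g\<close>
  replaces \<open>grad S f\<close> and exposes its components to the induction hypothesis.\<close>

lemma Ck_on_SucI:
  assumes "open S" and "\<And>x. x \<in> S \<Longrightarrow> GDERIV f x :> g x" and "\<And>i. Ck_on k S (\<lambda>x. g x $ i)"
  shows "Ck_on (Suc k) S f"
proof -
  have "f differentiable_on S"
    using assms(2) unfolding differentiable_on_def gderiv_def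
    by (meson differentiableI differentiable_at_withinI)
  moreover have "grad S f x = g x" if "x \<in> S" for x
    using grad_eqI[OF assms(2)] that assms(1) by (simp add: interior_open)
  then have "Ck_on k S (\<lambda>x. grad S f x $ i)" for i
    using Ck_on_cong[of S "\<lambda>x. grad S f x $ i" "\<lambda>x. g x $ i" k] assms(3) by simp
  ultimately show ?thesis by simp
qed

lemma Ck_on_SucD:
  assumes "open S" and "Ck_on (Suc k) S f"
  shows "x \<in> S \<Longrightarrow> GDERIV f x :> grad S f x" and "Ck_on k S (\<lambda>x. grad S f x $ i)"
  using assms GDERIV_grad[of f x S] by (auto simp: differentiable_on_def interior_open)

lemma Ck_on_Suc_imp: "Ck_on (Suc k) S f \<Longrightarrow> Ck_on k S f"
  by (induction k arbitrary: f) (auto simp: differentiable_imp_continuous_on)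

lemma Ck_on_const: "open S \<Longrightarrow> Ck_on k S (\<lambda>x. c)"
proof (induction k arbitrary: c)
  case (Suc k)
  show ?case
    by (rule Ck_on_SucI[where g = "\<lambda>x. 0"]) (use Suc in \<open>auto intro!: GDERIV_const simp del: Ck_on.simps\<close>)
qed simp

lemma Ck_on_add:
  assumes "open S" "Ck_on k S f" "Ck_on k S g"
  shows "Ck_on k S (\<lambda>x. f x + g x)"
  using assms(2,3)
proof (induction k arbitrary: f g)
  case (Suc k)
  show ?case
    by (rule Ck_on_SucI[OF assms(1), where g = "\<lambda>x. grad S f x + grad S g x"])
      (use Suc assms(1) in \<open>auto intro!: GDERIV_add Ck_on_SucD(1) simp del: Ck_on.simps 
         dest: Ck_on_SucD(2)\<close>)
qed (simp add: continuous_on_add)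

lemma Ck_on_mult:
  assumes "open S" "Ck_on k S f" "Ck_on k S g"
  shows "Ck_on k S (\<lambda>x. f x * g x)"
  using assms(2,3)
proof (induction k arbitrary: f g)
  case (Suc k)
  have "Ck_on k S (\<lambda>x. f x * grad S g x $ i + g x * grad S f x $ i)" for i
    by (intro Ck_on_add Suc.IH assms(1) Ck_on_SucD(2) Suc.prems Ck_on_Suc_imp)
  then show ?case
    by (intro Ck_on_SucI[OF assms(1), where g = "\<lambda>x. f x *\<^sub>R grad S g x + g x *\<^sub>R grad S f x"])
      (use Suc.prems assms(1) in \<open>auto intro!: GDERIV_mult Ck_on_SucD(1) simp del: Ck_on.simps\<close>)
qed (simp add: continuous_on_mult)

lemma Ck_on_inner: "open S \<Longrightarrow> Ck_on k S (\<lambda>x. x \<bullet> a)"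
proof (cases k)
  case (Suc k)
  assume "open S"
  then show ?thesis unfolding Suc
    by (intro Ck_on_SucI[where g = "\<lambda>x. a"] Ck_on_const)
     (auto simp: gderiv_def intro!: derivative_eq_intros)
qed (auto intro!: continuous_intros)

lemma
  fixes f :: "real ^ 'n \<Rightarrow> real"
  assumes "open S" "smooth_on S f"
  shows smooth_on_GDERIV: "x \<in> S \<Longrightarrow> GDERIV f x :> grad S f x"
    and smooth_on_continuous_grad: "continuous_on S (grad S f)"
    and smooth_on_continuous: "continuous_on S f"
proof -
  have 1: "Ck_on (Suc 0) S f" and 0: "Ck_on 0 S f"
    using assms(2) unfolding smooth_on_def by blast+
  show "x \<in> S \<Longrightarrow> GDERIV f x :> grad S f x"
    using Ck_on_SucD(1)[OF assms(1) 1] .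
  have "continuous_on S (\<lambda>x. \<chi> i. grad S f x $ i)"
    by (intro continuous_on_vec_lambda) (use Ck_on_SucD(2)[OF assms(1) 1] in simp)
  then show "continuous_on S (grad S f)" by simp
  show "continuous_on S f" using 0 by simp
qed

section \<open>Bump functions\<close>

text \<open>\<open>flat 0\<close> is the classical exp(-1/t). The extra powers of 1/t close the
  family under differentiation up to linear combinations, so smoothness becomes an induction over
  all \<open>m\<close> at once.\<close>

definition flat :: "nat \<Rightarrow> real \<Rightarrow> real" where
  "flat m t = (if t > 0 then exp (- (1 / t)) / t ^ m else 0)"

text \<open>Substituting s = 1/t to the right of 0 leaves s^m / exp s, which tends to 0 at
  infinity.\<close>

lemma flat_tendsto_0: "(flat m \<longlongrightarrow> 0) (at 0)"
proof -
  have "((\<lambda>s::real. s ^ m / exp s) \<longlongrightarrow> 0) at_top"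
    by (rule tendsto_power_div_exp_0)
  then have "((\<lambda>t::real. (inverse t) ^ m / exp (inverse t)) \<longlongrightarrow> 0) (at_right 0)"
    by (rule filterlim_compose[OF _ filterlim_inverse_at_top_right])
  moreover have "eventually (\<lambda>t. (inverse t) ^ m / exp (inverse t) = flat m t) (at_right 0)"
    by (auto simp: flat_def exp_minus field_simps eventually_at_filter)
  ultimately have "(flat m \<longlongrightarrow> 0) (at_right 0)"
    by (rule Lim_transform_eventually)
  moreover have "(flat m \<longlongrightarrow> 0) (at_left 0)"
    by (rule Lim_transform_eventually[OF tendsto_const]) (auto simp: flat_def eventually_at_filter)
  ultimately show ?thesis by (simp add: filterlim_split_at)
qed

lemma DERIV_flat: "DERIV (flat m) t :> flat (m + 2) t - real m * flat (m + 1) t"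
proof -
  consider "t > 0" | "t < 0" | "t = 0" by linarith
  then show ?thesis
  proof cases
    case 1
    have "DERIV (\<lambda>t. exp (- (1 / t)) / t ^ m) t :> flat (m + 2) t - real m * flat (m + 1) t"
    \<comment> \<open>The power rule gives the exponent m - 1 in truncated subtraction; the split
      keeps it meaningful.\<close>
    proof (cases m)
      case 0
      with 1 show ?thesis
        by (auto intro!: derivative_eq_intros simp: flat_def power2_eq_square)
    next
      case (Suc k)
      let ?D = "(exp (- (1 / t)) * (1 / t\<^sup>2) * t ^ Suc k - exp (- (1 / t)) * (real (Suc k) * t ^ k))
        / (t ^ Suc k * t ^ Suc k)"
      have "DERIV (\<lambda>t. t ^ Suc k) t :> real (Suc k) * t ^ k"
        using DERIV_pow[of "Suc k" t] by (simp only: diff_Suc_Suc diff_zero One_nat_def)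
      then have D: "DERIV (\<lambda>t. exp (- (1 / t)) / t ^ Suc k) t :> ?D"
        by (intro DERIV_divide)
          (use 1 in \<open>auto intro!: derivative_eq_intros simp: power2_eq_square\<close>)
      have "?D = flat (Suc k + 2) t - real (Suc k) * flat (Suc k + 1) t"
        using 1 by (simp add: flat_def field_simps power2_eq_square)
      with D show ?thesis unfolding Suc by (rule DERIV_cong)
    qed
    then show ?thesis
      by (rule has_field_derivative_transform_within_open[of _ _ _ "{0<..}"])
        (use 1 in \<open>auto simp: flat_def\<close>)
  next
    case 2
    have "DERIV (\<lambda>t. 0::real) t :> flat (m + 2) t - real m * flat (m + 1) t"
      using 2 by (simp add: flat_def)
    then show ?thesis
      by (rule has_field_derivative_transform_within_open[of _ _ _ "{..<0}"])
        (use 2 in \<open>auto simp: flat_def\<close>)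
  next
    case 3
    \<comment> \<open>The difference quotient at 0 is \<open>flat (m + 1) h\<close>, whose limit is
      already known.\<close>
    have "((\<lambda>h. (flat m (0 + h) - flat m 0) / h) \<longlongrightarrow> 0) (at 0)"
      by (rule Lim_transform_eventually[OF flat_tendsto_0[of "Suc m"]])
        (auto simp: flat_def eventually_at_filter)
    then have "DERIV (flat m) 0 :> 0"
      unfolding DERIV_def .
    with 3 show ?thesis by (simp add: flat_def)
  qed
qed

text \<open>The squared norm keeps the inner function polynomial with linear gradient.
  Differentiation thus yields only later members of the \<open>flat\<close> family times
  coordinates, and the induction must run over all \<open>m\<close>.\<close>

lemma Ck_on_flat_quadratic: "Ck_on k UNIV (\<lambda>x :: real ^ 'n. flat m (c - x \<bullet> x))"
proof (induction k arbitrary: m)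
  case 0
  have "continuous_on UNIV (flat m)"
    using DERIV_flat DERIV_isCont by (metis continuous_at_imp_continuous_on)
  then show ?case
    by (auto intro!: continuous_on_compose2[of UNIV "flat m"] continuous_intros)
next
  case (Suc k)
  let ?F = "\<lambda>x. flat (m + 2) (c - x \<bullet> x) + (- real m) * flat (m + 1) (c - x \<bullet> x)"
  have q: "GDERIV (\<lambda>x. c - x \<bullet> x) x :> - 2 *\<^sub>R x" for x :: "real ^ 'n"
    unfolding gderiv_def by (auto intro!: derivative_eq_intros simp: inner_commute)
  have g: "GDERIV (\<lambda>x. flat m (c - x \<bullet> x)) x :> ?F x *\<^sub>R (- 2 *\<^sub>R x)" for x :: "real ^ 'n"
    by (rule GDERIV_subst[OF GDERIV_DERIV_compose[OF q DERIV_flat]]) simp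
  have c: "Ck_on k UNIV (\<lambda>x::real^'n. ?F x * (x \<bullet> (- 2 *\<^sub>R axis i 1)))" for i
    by (intro Ck_on_mult Ck_on_add Ck_on_const Ck_on_inner Suc.IH open_UNIV)
  have "(\<lambda>x::real^'n. (?F x *\<^sub>R (- 2 *\<^sub>R x)) $ i) = (\<lambda>x. ?F x * (x \<bullet> (- 2 *\<^sub>R axis i 1)))" for i
    by (simp add: fun_eq_iff inner_axis)
  with c have "Ck_on k UNIV (\<lambda>x::real^'n. (?F x *\<^sub>R (- 2 *\<^sub>R x)) $ i)" for i
    by (simp only:)
  then show ?case
    by (rule Ck_on_SucI[OF open_UNIV g])
qed

section \<open>Differentiation under the integral sign\<close>

text \<open>\<open>leibniz_rule\<close> works with derivatives as bounded linear maps;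
  \<open>blinfun_inner_left\<close> encodes the gradient as one and, being bounded linear itself,
  moves outside the integral.\<close>

lemma leibniz_GDERIV:
  fixes f :: "real ^ 'n \<Rightarrow> 'b::euclidean_space \<Rightarrow> real"
  assumes "\<And>x t. t \<in> cbox a b \<Longrightarrow> GDERIV (\<lambda>x. f x t) x :> g x t"
    and "\<And>x. continuous_on (cbox a b) (f x)"
    and "continuous_on (UNIV \<times> cbox a b) (\<lambda>(x, t). g x t)"
  shows "GDERIV (\<lambda>x. integral (cbox a b) (f x)) x :> integral (cbox a b) (g x)"
proof -
  have cg: "continuous_on (cbox a b) (g x)"
  proof -
    have "continuous_on (cbox a b) (\<lambda>t. case (x, t) of (x, t) \<Rightarrow> g x t)"
      by (rule continuous_on_compose2[OF assms(3)]) (auto intro!: continuous_intros)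
    then show ?thesis by simp
  qed
  have "((\<lambda>x. integral (cbox a b) (f x)) has_derivative
      integral (cbox a b) (\<lambda>t. blinfun_inner_left (g x t))) (at x within UNIV)"
  proof (rule leibniz_rule)
    show "continuous_on (UNIV \<times> cbox a b) (\<lambda>(x, t). blinfun_inner_left (g x t))"
      using bounded_linear.continuous_on[OF bounded_linear_blinfun_inner_left assms(3)]
      by (simp add: case_prod_unfold)
  qed (use assms(1,2) in \<open>auto simp: gderiv_def intro: integrable_continuous\<close>)
  moreover have "integral (cbox a b) (\<lambda>t. blinfun_inner_left (g x t)) = blinfun_inner_left (integral (cbox a b) (g x))"
    using integral_linear[OF integrable_continuous[OF cg] bounded_linear_blinfun_inner_left]
    by (simp add: o_def)
  ultimately show ?thesis by (simp add: gderiv_def)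
qed

section \<open>Translation and gradients of compactly supported functions\<close>

lemma has_integral_translate:
  fixes f :: "'a::euclidean_space \<Rightarrow> 'b::euclidean_space"
  assumes "(f has_integral i) UNIV" and "\<And>x. x \<notin> K \<Longrightarrow> f x = 0" and "bounded K"
  shows "((\<lambda>x. f (x + c)) has_integral i) UNIV"
proof -
  obtain a where K: "K \<subseteq> cbox (-a) a"
    using bounded_subset_cbox_symmetric[OF assms(3)] by blast
  have "(f has_integral i) (cbox (-a) a)"
    using assms(1) has_integral_on_superset[of f i "cbox (-a) a" UNIV] K assms(2)
    by (smt (verit) has_integral_integrable_integral has_integral_restrict_UNIV has_integral_cong subset_iff)
  \<comment> \<open>The change of variables is available on boxes, so the integral is confined to a
    box around the support, moved there, and extended by zero again.\<close>
  from has_integral_affinity[OF this, of 1 c]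
  have "((\<lambda>x. f (x + c)) has_integral i) ((\<lambda>x. x - c) ` cbox (-a) a)"
    by simp
  moreover have "f (x + c) = 0" if "x \<notin> (\<lambda>x. x - c) ` cbox (-a) a" for x
  proof -
    have "x + c \<notin> cbox (-a) a" using that by (metis add_diff_cancel image_eqI)
    then show ?thesis using K assms(2) by blast
  qed
  ultimately show ?thesis
    by (rule has_integral_on_superset[OF _ _ subset_UNIV])
qed

lemma GDERIV_imp_continuous_on:
  assumes "\<And>x. x \<in> S \<Longrightarrow> GDERIV f x :> D x"
  shows "continuous_on S f"
  using assms by (auto simp: gderiv_def intro!: continuous_at_imp_continuous_on has_derivative_continuous)

lemma GDERIV_unique:
  assumes "GDERIV f x :> d" "GDERIV f x :> d'"
  shows "d = d'"
proof -
  have "(\<lambda>h. h \<bullet> d) = (\<lambda>h. h \<bullet> d')"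
    using assms unfolding gderiv_def by (rule has_derivative_unique)
  then have "h \<bullet> d = h \<bullet> d'" for h by metis
  then show ?thesis by (metis inner_commute vector_eq_ldot)
qed

lemma GDERIV_transform_open:
  assumes "GDERIV f x :> d" "open S" "x \<in> S" "\<And>y. y \<in> S \<Longrightarrow> f y = g y"
  shows "GDERIV g x :> d"
  using assms unfolding gderiv_def by (rule has_derivative_transform_within_open)

lemma GDERIV_zero_outside:
  assumes "GDERIV f x :> d" "closed K" "\<And>x. x \<notin> K \<Longrightarrow> f x = 0" "x \<notin> K"
  shows "d = 0"
proof (rule GDERIV_unique[OF assms(1)])
  show "GDERIV f x :> 0"
    by (rule GDERIV_transform_open[OF GDERIV_const[of 0], of "- K"]) (use assms in auto)
qed

lemma GDERIV_shift:
  assumes "GDERIV f (x + t) :> d"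
  shows "GDERIV (\<lambda>c. f (x + c)) t :> d"
proof -
  have "((\<lambda>c. x + c) has_derivative (\<lambda>h. h)) (at t)"
    by (auto intro!: derivative_eq_intros)
  then have "((\<lambda>c. f (x + c)) has_derivative (\<lambda>h. h \<bullet> d)) (at t)"
    using has_derivative_compose[of "\<lambda>c. x + c" "\<lambda>h. h" t UNIV f "\<lambda>h. h \<bullet> d"] assms
    by (simp add: gderiv_def)
  then show ?thesis by (simp add: gderiv_def)
qed

lemma integrable_on_compact_support:
  fixes f :: "'a::euclidean_space \<Rightarrow> 'b::euclidean_space"
  assumes "continuous_on UNIV f" and "\<And>x. x \<notin> K \<Longrightarrow> f x = 0" and "bounded K"
  shows "f integrable_on UNIV"
proof -
  obtain a where K: "K \<subseteq> cbox (-a) a"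
    using bounded_subset_cbox_symmetric[OF assms(3)] by blast
  have "f integrable_on cbox (-a) a"
    using assms(1) continuous_on_subset by (blast intro: integrable_continuous)
  then show ?thesis
    by (rule integrable_on_superset) (use K assms(2) in auto)
qed

lemma integral_cbox_eq_UNIV:
  fixes f :: "'a::euclidean_space \<Rightarrow> 'b::euclidean_space"
  assumes "\<And>x. x \<notin> S \<Longrightarrow> f x = 0"
  shows "integral S f = integral UNIV f"
proof -
  have "f = (\<lambda>x. if x \<in> S then f x else 0)" using assms by auto
  then show ?thesis using integral_restrict_UNIV[of S f] by simp
qed

text \<open>The integral of \<open>\<psi>\<close> is invariant under translation; differentiate in the translation vector.\<close>

lemma has_integral_GDERIV_zero:
  fixes \<psi> :: "real ^ 'n \<Rightarrow> real"
  assumes "\<And>x. GDERIV \<psi> x :> D x" and "continuous_on UNIV D"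
    and "\<And>x. x \<notin> K \<Longrightarrow> \<psi> x = 0" and "compact K"
  shows "(D has_integral 0) UNIV"
proof -
  have K: "closed K" "bounded K" using assms(4) by (auto simp: compact_eq_bounded_closed)
  have D0: "D x = 0" if "x \<notin> K" for x
    using GDERIV_zero_outside[OF assms(1) K(1) assms(3) that] .
  have c\<psi>: "continuous_on UNIV \<psi>"
    by (rule GDERIV_imp_continuous_on[OF assms(1)])
  obtain R where R: "K \<subseteq> ball 0 R" using bounded_subset_ballD[OF K(2)] by blast
  \<comment> \<open>The margin 1 keeps the support of every translate by a vector of norm below 1
    inside one fixed box, as differentiation under the integral requires.\<close>
  obtain a where a: "ball 0 (R + 1) \<subseteq> cbox (-a) (a :: real ^ 'n)"
    using bounded_subset_cbox_symmetric[OF bounded_ball] by blast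
  define I where "I c = integral (cbox (-a) a) (\<lambda>x. \<psi> (x + c))" for c
  have "I c = integral UNIV \<psi>" if "c \<in> ball 0 1" for c
  proof -
    have "\<psi> (x + c) = 0" if "x \<notin> cbox (-a) a" for x
    proof -
      have "norm x \<ge> R + 1" using that a by (auto simp: subset_eq not_less[symmetric])
      then have "norm (x + c) \<ge> R" using \<open>c \<in> ball 0 1\<close> norm_diff_ineq[of x c] by simp
      then show ?thesis using R assms(3) by (auto simp: subset_eq not_less[symmetric])
    qed
    then have "I c = integral UNIV (\<lambda>x. \<psi> (x + c))"
      unfolding I_def by (rule integral_cbox_eq_UNIV)
    also have "\<dots> = integral UNIV \<psi>"
      using has_integral_translate[OF integrable_integral[OF integrable_on_compact_support[OF c\<psi> assms(3) K(2)]] assms(3) K(2)]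
      by (rule integral_unique)
    finally show ?thesis .
  qed
  then have "GDERIV I 0 :> 0"
    by (intro GDERIV_transform_open[OF GDERIV_const[of "integral UNIV \<psi>"], of "ball 0 1"]) auto
  moreover have "GDERIV I 0 :> integral (cbox (-a) a) (\<lambda>x. D (x + 0))"
    unfolding I_def
  proof (rule leibniz_GDERIV)
    show "continuous_on (cbox (- a) a) (\<lambda>xa. \<psi> (xa + x))" for x
      by (rule continuous_on_compose2[OF c\<psi>]) (auto intro!: continuous_intros)
    show "continuous_on (UNIV \<times> cbox (- a) a) (\<lambda>(x, t). D (t + x))"
      unfolding case_prod_unfold
      by (rule continuous_on_compose2[OF assms(2)]) (auto intro!: continuous_intros)
  qed (use assms(1) GDERIV_shift in blast)
  ultimately have "integral (cbox (-a) a) D = 0"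
    using GDERIV_unique by fastforce
  moreover have "integral (cbox (-a) a) D = integral UNIV D"
    by (rule integral_cbox_eq_UNIV) (use D0 R a in \<open>force simp: subset_eq\<close>)
  moreover have "D integrable_on UNIV"
    by (rule integrable_on_compact_support[OF assms(2) D0 K(2)])
  ultimately show ?thesis by (simp add: has_integral_integrable_integral)
qed

section \<open>Mollification\<close>

text \<open>The kernel is the normalised bump
  \<open>flat 0 (\<delta>\<^sup>2 - x \<bullet> x)\<close>. Evenness is recorded because convolution
  reflects the kernel.\<close>

lemma exists_mollifier:
  assumes "\<delta> > 0"
  obtains \<kappa> :: "real ^ 'n \<Rightarrow> real" where "smooth_on UNIV \<kappa>" "\<And>x. \<kappa> x \<ge> 0" "\<And>x. norm x \<ge> \<delta> \<Longrightarrow> \<kappa> x = 0"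
    "\<And>x. \<kappa> (- x) = \<kappa> x" "(\<kappa> has_integral 1) UNIV"
proof -
  define g :: "real ^ 'n \<Rightarrow> real" where "g x = flat 0 (\<delta>\<^sup>2 - x \<bullet> x)" for x
  have sg: "Ck_on k UNIV g" for k
    unfolding g_def by (rule Ck_on_flat_quadratic)
  have cg: "continuous_on UNIV g" using sg[of 0] by simp
  have g0: "g x = 0" if "norm x \<ge> \<delta>" for x
  proof -
    have "\<delta>\<^sup>2 \<le> x \<bullet> x" using that assms by (simp add: dot_square_norm power_mono)
    then show ?thesis by (simp add: g_def flat_def)
  qed
  have gn: "g x \<ge> 0" for x by (simp add: g_def flat_def)
  have gi: "g integrable_on UNIV"
    by (rule integrable_on_compact_support[OF cg, of "ball 0 \<delta>"]) (use g0 in auto)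
  obtain a where a: "ball 0 \<delta> \<subseteq> cbox (-a) (a :: real ^ 'n)"
    using bounded_subset_cbox_symmetric[OF bounded_ball] by blast
  have i: "integral UNIV g = integral (cbox (-a) a) g"
    by (rule integral_cbox_eq_UNIV[symmetric]) (use g0 a in \<open>force simp: subset_eq\<close>)
  \<comment> \<open>A continuous nonnegative function with zero integral over a box with interior
    vanishes on it, whereas \<open>g 0\<close> is exp(-1/\<delta>^2).\<close>
  have "integral UNIV g \<noteq> 0"
  proof
    assume "integral UNIV g = 0"
    then have "(g has_integral 0) (cbox (-a) a)"
      using i cg by (metis continuous_on_subset integrable_continuous integrable_integral subset_UNIV)
    moreover have "box (-a) a \<noteq> {}"
    proof -
      have "open (ball 0 \<delta> :: (real^'n) set)" by simp
      then have "ball 0 \<delta> \<subseteq> interior (cbox (-a) a)" using a by (rule interior_maximal[rotated])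
      then show ?thesis using assms by (auto simp: interior_cbox)
    qed
    ultimately have "g 0 = 0"
      using has_integral_0_cbox_imp_0[of "-a" a g 0] cg gn a assms
      by (auto simp: subset_eq intro: continuous_on_subset)
    then show False using assms by (simp add: g_def flat_def)
  qed
  moreover have "integral UNIV g \<ge> 0" using gn by (simp add: integral_nonneg gi)
  ultimately have pos: "integral UNIV g > 0" by simp
  show ?thesis
  proof
    let ?k = "\<lambda>x. 1 / integral UNIV g * g x"
    show "smooth_on UNIV ?k" unfolding smooth_on_def
      by (intro allI Ck_on_mult Ck_on_const sg open_UNIV)
    show "(?k has_integral 1) UNIV"
      using has_integral_mult_right[OF integrable_integral[OF gi], of "1 / integral UNIV g"] pos by simp
  qed (use pos gn g0 in \<open>auto simp: g_def\<close>)
qed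

text \<open>All derivatives fall on the kernel, whose gradient components are kernels of one order
  less; hence the induction over all \<kappa> with \<open>f\<close> fixed and merely
  continuous.\<close>

lemma Ck_on_convolution:
  assumes "continuous_on UNIV f" and "Ck_on k UNIV \<kappa>"
  shows "Ck_on k UNIV (\<lambda>x :: real ^ 'n. integral (cbox a b) (\<lambda>y. f y * \<kappa> (x - y)))"
  using assms(2)
proof (induction k arbitrary: \<kappa>)
  case 0
  then have c: "continuous_on UNIV \<kappa>" by simp
  have "continuous_on (UNIV \<times> cbox a b) (\<lambda>(x, y). f y * \<kappa> (x - y))"
    unfolding case_prod_unfold
    by (intro continuous_intros continuous_on_compose2[OF assms(1)] continuous_on_compose2[OF c]) auto
  then show ?case by (auto intro!: integral_continuous_on_param)
next
  case (Suc k)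
  have G: "GDERIV \<kappa> x :> grad UNIV \<kappa> x" for x
    using Ck_on_SucD(1)[OF open_UNIV Suc.prems] by auto
  have C: "Ck_on k UNIV (\<lambda>x. grad UNIV \<kappa> x $ i)" for i
    using Ck_on_SucD(2)[OF open_UNIV Suc.prems] .
  have "Ck_on 0 UNIV (\<lambda>x. grad UNIV \<kappa> x $ i)" for i
    using C[of i] by (cases k) (auto simp: differentiable_imp_continuous_on)
  then have cG: "continuous_on UNIV (grad UNIV \<kappa>)"
    using continuous_on_vec_lambda[of UNIV "\<lambda>i x. grad UNIV \<kappa> x $ i"] by simp
  have c: "continuous_on UNIV \<kappa>"
    by (rule GDERIV_imp_continuous_on[OF G])
  show ?case
  proof (rule Ck_on_SucI[OF open_UNIV])
    fix x :: "real ^ 'n"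
    show "GDERIV (\<lambda>x. integral (cbox a b) (\<lambda>y. f y * \<kappa> (x - y))) x :>
        integral (cbox a b) (\<lambda>y. f y *\<^sub>R grad UNIV \<kappa> (x - y))"
    proof (rule leibniz_GDERIV)
      fix x t
      have "GDERIV (\<lambda>x. \<kappa> (- t + x)) x :> grad UNIV \<kappa> (- t + x)"
        by (rule GDERIV_shift[OF G])
      then have "GDERIV (\<lambda>x. f t * \<kappa> (x - t)) x :> f t *\<^sub>R grad UNIV \<kappa> (x - t) + \<kappa> (x - t) *\<^sub>R 0"
        by (intro GDERIV_mult GDERIV_const) simp
      then show "GDERIV (\<lambda>x. f t * \<kappa> (x - t)) x :> f t *\<^sub>R grad UNIV \<kappa> (x - t)" by simp
    next
      show "continuous_on (cbox a b) (\<lambda>y. f y * \<kappa> (x - y))" for x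
        by (intro continuous_intros continuous_on_compose2[OF c] continuous_on_subset[OF assms(1)]) auto
      show "continuous_on (UNIV \<times> cbox a b) (\<lambda>(x, y). f y *\<^sub>R grad UNIV \<kappa> (x - y))"
        unfolding case_prod_unfold
        by (intro continuous_intros continuous_on_compose2[OF assms(1)] continuous_on_compose2[OF cG]) auto
    qed
  next
    fix i
    have "integral (cbox a b) (\<lambda>y. f y *\<^sub>R grad UNIV \<kappa> (x - y)) $ i =
       integral (cbox a b) (\<lambda>y. f y * grad UNIV \<kappa> (x - y) $ i)" for x
    proof -
      have "(\<lambda>y. f y *\<^sub>R grad UNIV \<kappa> (x - y)) integrable_on cbox a b"
        by (intro integrable_continuous continuous_intros continuous_on_compose2[OF cG]
            continuous_on_subset[OF assms(1)]) auto
      from integral_linear[OF this bounded_linear_vec_nth[of i]]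
      show ?thesis by (simp add: o_def)
    qed
    then show "Ck_on k UNIV (\<lambda>x. integral (cbox a b) (\<lambda>y. f y *\<^sub>R grad UNIV \<kappa> (x - y)) $ i)"
      using Suc.IH[OF C[of i]] by (simp only:)
  qed
qed

lemma test_functionI:
  assumes "smooth_on UNIV \<phi>" "compact C" "C \<subseteq> D" "\<And>x. x \<notin> C \<Longrightarrow> \<phi> x = 0"
  shows "test_function D \<phi>"
proof -
  have "{x. \<phi> x \<noteq> 0} \<subseteq> C" using assms(4) by auto
  then have "closure {x. \<phi> x \<noteq> 0} \<subseteq> C"
    using assms(2) by (simp add: closure_minimal compact_imp_closed)
  moreover from this have "compact (closure {x. \<phi> x \<noteq> 0})"
    using assms(2) by (metis closed_closure compact_Int_closed inf.absorb_iff2)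
  ultimately show ?thesis using assms(1,3) by (auto simp: test_function_def)
qed

lemma test_functionE:
  assumes "test_function D \<phi>"
  obtains K where "compact K" "K \<subseteq> D" "\<And>x. x \<notin> K \<Longrightarrow> \<phi> x = 0" "\<And>x. x \<notin> K \<Longrightarrow> grad UNIV \<phi> x = 0"
    "\<And>x. GDERIV \<phi> x :> grad UNIV \<phi> x" "continuous_on UNIV (grad UNIV \<phi>)" "continuous_on UNIV \<phi>"
proof -
  let ?K = "closure {x. \<phi> x \<noteq> 0}"
  have s: "smooth_on UNIV \<phi>" and K: "compact ?K" "?K \<subseteq> D"
    using assms by (auto simp: test_function_def)
  have G: "GDERIV \<phi> x :> grad UNIV \<phi> x" for x
    using smooth_on_GDERIV[OF open_UNIV s] by simp
  have z: "\<phi> x = 0" if "x \<notin> ?K" for x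
    using that closure_subset[of "{x. \<phi> x \<noteq> 0}"] by blast
  have "grad UNIV \<phi> x = 0" if "x \<notin> ?K" for x
    using GDERIV_zero_outside[OF G closed_closure z that] .
  then show ?thesis
    using that[OF K z] G smooth_on_continuous_grad[OF open_UNIV s] smooth_on_continuous[OF open_UNIV s]
    by blast
qed

text \<open>The closed neighbourhood is the Minkowski sum of \<open>K\<close> and a closed
  ball.\<close>

lemma compact_neighbourhood:
  fixes K :: "'a::euclidean_space set"
  assumes "compact K"
  shows "compact {x. \<exists>y\<in>K. dist x y \<le> r}"
proof -
  have "{x. \<exists>y\<in>K. dist x y \<le> r} = {x + y | x y. x \<in> K \<and> y \<in> cball 0 r}"
  proof safe
    fix x y assume "y \<in> K" "dist x y \<le> r"
    then show "\<exists>xa ya. x = xa + ya \<and> xa \<in> K \<and> ya \<in> cball 0 r"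
      by (rule_tac exI[of _ y], rule_tac exI[of _ "x - y"]) (auto simp: dist_norm norm_minus_commute)
  next
    fix x y assume "x \<in> K" "y \<in> cball (0::'a) r"
    then show "\<exists>ya\<in>K. dist (x + y) ya \<le> r"
      by (intro bexI[of _ x]) (auto simp: dist_norm)
  qed
  then show ?thesis using compact_sums[OF assms compact_cball[of 0 r]] by simp
qed

text \<open>Uniform continuity holds on the compact 1-neighbourhood of \<open>K\<close>. With the
  modulus capped at 1, two close points either both lie there or both lie off \<open>K\<close>,
  where \<open>f\<close> is zero.\<close>

lemma uniformly_continuous_compact_support:
  fixes f :: "'a::euclidean_space \<Rightarrow> 'b::real_normed_vector"
  assumes "continuous_on UNIV f" and "\<And>x. x \<notin> K \<Longrightarrow> f x = 0" and "compact K" and "e > 0"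
  obtains d where "d > 0" "\<And>x y :: 'a. dist x y < d \<Longrightarrow> dist (f x) (f y) < e"
proof -
  let ?C = "{x. \<exists>y\<in>K. dist x y \<le> 1}"
  have "uniformly_continuous_on ?C f"
    using compact_neighbourhood[OF assms(3)] assms(1) continuous_on_subset
    by (blast intro: compact_uniformly_continuous)
  then obtain d where d: "d > 0" "\<And>x y. x \<in> ?C \<Longrightarrow> y \<in> ?C \<Longrightarrow> dist y x < d \<Longrightarrow> dist (f y) (f x) < e"
    unfolding uniformly_continuous_on_def using assms(4) by meson
  show ?thesis
  proof (rule that[of "min d 1"])
    fix x y :: 'a assume xy: "dist x y < min d 1"
    show "dist (f x) (f y) < e"
    proof (cases "x \<in> K \<or> y \<in> K")
      case True
      then have "x \<in> ?C" "y \<in> ?C"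
        using xy by (force intro: bexI[of _ x] bexI[of _ y] simp: dist_commute)+
      then show ?thesis using d(2) xy by simp
    next
      case False then show ?thesis using assms(2,4) by simp
    qed
  qed (use d in auto)
qed

text \<open>Convolution with values in any Euclidean space, so that the same operator acts on a
  function and on its gradient.\<close>

definition mollify :: "(real ^ 'n \<Rightarrow> real) \<Rightarrow> (real ^ 'n \<Rightarrow> 'b::euclidean_space) \<Rightarrow> real ^ 'n \<Rightarrow> 'b" where
  "mollify \<kappa> f x = integral UNIV (\<lambda>y. \<kappa> (x - y) *\<^sub>R f y)"

lemma mollify_zero:
  assumes "\<And>y. y \<in> K \<Longrightarrow> dist x y \<ge> \<delta>" "\<And>y. y \<notin> K \<Longrightarrow> f y = 0" "\<And>z. norm z \<ge> \<delta> \<Longrightarrow> \<kappa> z = 0"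
  shows "mollify \<kappa> f x = 0"
proof -
  have "\<kappa> (x - y) *\<^sub>R f y = 0" for y
    using assms by (cases "y \<in> K") (auto simp: dist_norm)
  then show ?thesis by (simp only: mollify_def integral_0)
qed

text \<open>The kernel has mass one, so the error at \<open>x\<close> is a weighted mean of
  \<open>f y - f x\<close> over points \<open>y\<close> closer than \<delta>.\<close>

lemma mollify_close:
  assumes \<kappa>: "continuous_on UNIV \<kappa>" "\<And>x. \<kappa> x \<ge> 0" "\<And>x. norm x \<ge> \<delta> \<Longrightarrow> \<kappa> x = 0"
    "\<And>x. \<kappa> (- x) = \<kappa> x" "(\<kappa> has_integral 1) UNIV"
    and f: "continuous_on UNIV f" "\<And>x. x \<notin> K \<Longrightarrow> f x = 0" "bounded K"
    and e: "\<And>x y. dist x y < \<delta> \<Longrightarrow> dist (f x) (f y) \<le> e"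
  shows "norm (mollify \<kappa> f x - f x) \<le> e"
proof -
  have "((\<lambda>y. \<kappa> (y + - x)) has_integral 1) UNIV"
    by (rule has_integral_translate[OF \<kappa>(5), of "ball 0 \<delta>"]) (use \<kappa>(3) in auto)
  \<comment> \<open>Evenness turns the translated kernel into the reflected one used by
    \<open>mollify\<close>.\<close>
  moreover have "\<kappa> (y + - x) = \<kappa> (x - y)" for y using \<kappa>(4)[of "x - y"] by simp
  ultimately have k1: "((\<lambda>y. \<kappa> (x - y)) has_integral 1) UNIV" by simp
  have i1: "(\<lambda>y. \<kappa> (x - y) *\<^sub>R f y) integrable_on UNIV"
    by (rule integrable_on_compact_support[OF _ _ f(3)])
      (use f in \<open>auto intro!: continuous_intros continuous_on_compose2[OF \<kappa>(1)] continuous_on_compose2[OF f(1)]\<close>)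
  have i2: "((\<lambda>y. \<kappa> (x - y) *\<^sub>R f x) has_integral f x) UNIV"
    using has_integral_scaleR_left[OF k1, of "f x"] by simp
  have d: "((\<lambda>y. \<kappa> (x - y) *\<^sub>R f y - \<kappa> (x - y) *\<^sub>R f x) has_integral (mollify \<kappa> f x - f x)) UNIV"
    unfolding mollify_def by (intro has_integral_diff integrable_integral i1 i2)
  have b: "norm (\<kappa> (x - y) *\<^sub>R f y - \<kappa> (x - y) *\<^sub>R f x) \<le> \<kappa> (x - y) * e" for y
  proof (cases "norm (x - y) < \<delta>")
    case True
    then have "norm (f y - f x) \<le> e" using e[of y x] by (simp add: dist_norm norm_minus_commute)
    then have "\<kappa> (x - y) * norm (f y - f x) \<le> \<kappa> (x - y) * e" using \<kappa>(2) by (rule mult_left_mono)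
    then show ?thesis using \<kappa>(2)[of "x - y"] by (simp flip: scaleR_diff_right)
  qed (use \<kappa>(3) in auto)
  have k: "((\<lambda>y. \<kappa> (x - y) * e) has_integral e) UNIV"
    using has_integral_mult_left[OF k1, of e] by simp
  show ?thesis
    using integral_norm_bound_integral[OF has_integral_integrable[OF d] has_integral_integrable[OF k] b]
    unfolding integral_unique[OF d] integral_unique[OF k] .
qed

lemma mollify_smooth:
  fixes f :: "real ^ 'n \<Rightarrow> real"
  assumes "continuous_on UNIV f" "\<And>x. x \<notin> K \<Longrightarrow> f x = 0" "bounded K" "smooth_on UNIV \<kappa>"
  shows "smooth_on UNIV (mollify \<kappa> f)"
proof -
  obtain a where K: "K \<subseteq> cbox (-a) a"
    using bounded_subset_cbox_symmetric[OF assms(3)] by blast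
  have "integral (cbox (-a) a) (\<lambda>y. f y * \<kappa> (x - y)) = integral UNIV (\<lambda>y. f y * \<kappa> (x - y))" for x
    by (rule integral_cbox_eq_UNIV) (use K assms(2) in auto)
  then have "mollify \<kappa> f = (\<lambda>x. integral (cbox (-a) a) (\<lambda>y. f y * \<kappa> (x - y)))"
    by (simp add: fun_eq_iff mollify_def mult.commute)
  then show ?thesis
    using Ck_on_convolution[OF assms(1)] assms(4) by (simp add: smooth_on_def)
qed

text \<open>The derivative first falls on the kernel. The gradient in y of
  \<open>f y * \<kappa> (x - y)\<close> has zero integral, which transfers it from \<kappa> to
  \<open>f\<close>.\<close>

lemma GDERIV_mollify:
  fixes f :: "real ^ 'n \<Rightarrow> real"
  assumes f: "\<And>x. GDERIV f x :> Df x" "continuous_on UNIV Df" "\<And>x. x \<notin> K \<Longrightarrow> f x = 0" "compact K"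
    and \<kappa>: "smooth_on UNIV \<kappa>"
  shows "GDERIV (mollify \<kappa> f) x :> mollify \<kappa> Df x"
proof -
  have K: "closed K" "bounded K" using f(4) by (auto simp: compact_eq_bounded_closed)
  have cf: "continuous_on UNIV f"
    by (rule GDERIV_imp_continuous_on[OF f(1)])
  have D0: "Df x = 0" if "x \<notin> K" for x
    using GDERIV_zero_outside[OF f(1) K(1) f(3) that] .
  note G = smooth_on_GDERIV[OF open_UNIV \<kappa> UNIV_I]
  note cG = smooth_on_continuous_grad[OF open_UNIV \<kappa>]
  note c\<kappa> = smooth_on_continuous[OF open_UNIV \<kappa>]
  obtain a where a: "K \<subseteq> cbox (-a) a"
    using bounded_subset_cbox_symmetric[OF K(2)] by blast
  have "integral (cbox (-a) a) (\<lambda>y. f y * \<kappa> (x - y)) = integral UNIV (\<lambda>y. f y * \<kappa> (x - y))" for x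
    by (rule integral_cbox_eq_UNIV) (use a f(3) in auto)
  then have m: "mollify \<kappa> f = (\<lambda>x. integral (cbox (-a) a) (\<lambda>y. f y * \<kappa> (x - y)))"
    by (simp add: fun_eq_iff mollify_def mult.commute)
  have "GDERIV (mollify \<kappa> f) x :> integral (cbox (-a) a) (\<lambda>y. f y *\<^sub>R grad UNIV \<kappa> (x - y))"
    unfolding m
  proof (rule leibniz_GDERIV)
    fix x t
    have "GDERIV (\<lambda>x. \<kappa> (- t + x)) x :> grad UNIV \<kappa> (- t + x)"
      by (rule GDERIV_shift[OF G])
    then have "GDERIV (\<lambda>x. f t * \<kappa> (x - t)) x :> f t *\<^sub>R grad UNIV \<kappa> (x - t) + \<kappa> (x - t) *\<^sub>R 0"
      by (intro GDERIV_mult GDERIV_const) simp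
    then show "GDERIV (\<lambda>x. f t * \<kappa> (x - t)) x :> f t *\<^sub>R grad UNIV \<kappa> (x - t)" by simp
  next
    show "continuous_on (cbox (-a) a) (\<lambda>y. f y * \<kappa> (x - y))" for x
      by (intro continuous_intros continuous_on_compose2[OF c\<kappa>] continuous_on_subset[OF cf]) auto
    show "continuous_on (UNIV \<times> cbox (-a) a) (\<lambda>(x, y). f y *\<^sub>R grad UNIV \<kappa> (x - y))"
      unfolding case_prod_unfold
      by (intro continuous_intros continuous_on_compose2[OF cf] continuous_on_compose2[OF cG]) auto
  qed
  also have "integral (cbox (-a) a) (\<lambda>y. f y *\<^sub>R grad UNIV \<kappa> (x - y)) = integral UNIV (\<lambda>y. f y *\<^sub>R grad UNIV \<kappa> (x - y))"
    by (rule integral_cbox_eq_UNIV) (use a f(3) in auto)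
  also have "\<dots> = mollify \<kappa> Df x"
  proof -
    have G': "GDERIV (\<lambda>y. \<kappa> (x - y)) y :> - grad UNIV \<kappa> (x - y)" for y
    proof -
      have "((\<lambda>y. x - y) has_derivative (\<lambda>h. - h)) (at y)"
        by (auto intro!: derivative_eq_intros)
      from has_derivative_compose[OF this G[unfolded gderiv_def]]
      show ?thesis by (simp add: gderiv_def)
    qed
    have "((\<lambda>y. f y *\<^sub>R (- grad UNIV \<kappa> (x - y)) + \<kappa> (x - y) *\<^sub>R Df y) has_integral 0) UNIV"
    proof (rule has_integral_GDERIV_zero[OF _ _ _ f(4)])
      show "GDERIV (\<lambda>y. f y * \<kappa> (x - y)) y :> f y *\<^sub>R (- grad UNIV \<kappa> (x - y)) + \<kappa> (x - y) *\<^sub>R Df y" for y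
        by (intro GDERIV_mult f G')
      show "continuous_on UNIV (\<lambda>y. f y *\<^sub>R - grad UNIV \<kappa> (x - y) + \<kappa> (x - y) *\<^sub>R Df y)"
        by (intro continuous_intros cf f(2) continuous_on_compose2[OF cG] continuous_on_compose2[OF c\<kappa>]) auto
    qed (simp add: f(3))
    moreover have "(\<lambda>y. f y *\<^sub>R grad UNIV \<kappa> (x - y)) integrable_on UNIV"
      by (rule integrable_on_compact_support[OF _ _ K(2)])
        (use f(3) in \<open>auto intro!: continuous_intros cf continuous_on_compose2[OF cG]\<close>)
    ultimately have "((\<lambda>y. f y *\<^sub>R (- grad UNIV \<kappa> (x - y)) + \<kappa> (x - y) *\<^sub>R Df y + f y *\<^sub>R grad UNIV \<kappa> (x - y))
       has_integral 0 + integral UNIV (\<lambda>y. f y *\<^sub>R grad UNIV \<kappa> (x - y))) UNIV"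
      by (intro has_integral_add integrable_integral)
    then have "((\<lambda>y. \<kappa> (x - y) *\<^sub>R Df y) has_integral integral UNIV (\<lambda>y. f y *\<^sub>R grad UNIV \<kappa> (x - y))) UNIV"
      by simp
    then show ?thesis unfolding mollify_def by (simp add: integral_unique)
  qed
  finally show ?thesis .
qed

lemma mollify_test_function:
  fixes f :: "real ^ 'n \<Rightarrow> real"
  assumes "continuous_on UNIV f" "\<And>x. x \<notin> K \<Longrightarrow> f x = 0" "compact K" "smooth_on UNIV \<kappa>"
    and "\<And>x. norm x \<ge> \<delta> \<Longrightarrow> \<kappa> x = 0" "(\<Union>x\<in>K. ball x e) \<subseteq> D" "\<delta> < e"
  shows "test_function D (mollify \<kappa> f)"
proof (rule test_functionI)
  show "smooth_on UNIV (mollify \<kappa> f)"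
    using assms compact_imp_bounded by (blast intro: mollify_smooth)
  show "compact {x. \<exists>y\<in>K. dist x y \<le> \<delta>}"
    by (rule compact_neighbourhood[OF assms(3)])
  show "{x. \<exists>y\<in>K. dist x y \<le> \<delta>} \<subseteq> D"
    using assms(6,7) by (force simp: dist_commute)
  show "mollify \<kappa> f x = 0" if "x \<notin> {x. \<exists>y\<in>K. dist x y \<le> \<delta>}" for x
    by (rule mollify_zero[where K = K and \<delta> = \<delta>]) (use that assms(2,5) in force)+
qed

lemma test_function_approx:
  fixes f :: "real ^ 'n \<Rightarrow> real"
  assumes "continuous_on UNIV f" "\<And>x. x \<notin> K \<Longrightarrow> f x = 0" "compact K" "K \<subseteq> D" "open D" "e > 0"
  obtains \<phi> where "test_function D \<phi>" "\<And>x. \<bar>\<phi> x - f x\<bar> \<le> e"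
proof -
  obtain r where r: "r > 0" "(\<Union>x\<in>K. ball x r) \<subseteq> D"
    using compact_subset_open_imp_ball_epsilon_subset[OF assms(3,5,4)] by blast
  obtain d where d: "d > 0" "\<And>x y. dist x y < d \<Longrightarrow> dist (f x) (f y) < e"
    using uniformly_continuous_compact_support[OF assms(1,2,3,6)] by blast
  \<comment> \<open>Half of \<open>r\<close> keeps the support strictly within the room around
    \<open>K\<close>; \<open>d\<close> controls the uniform error.\<close>
  define \<delta> where "\<delta> = min (r / 2) d"
  have \<delta>: "\<delta> > 0" "\<delta> < r" "\<delta> \<le> d" using r d by (auto simp: \<delta>_def)
  obtain \<kappa> :: "real ^ 'n \<Rightarrow> real" where \<kappa>: "smooth_on UNIV \<kappa>" "\<And>x. \<kappa> x \<ge> 0" "\<And>x. norm x \<ge> \<delta> \<Longrightarrow> \<kappa> x = 0"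
    "\<And>x. \<kappa> (- x) = \<kappa> x" "(\<kappa> has_integral 1) UNIV"
    using exists_mollifier[OF \<delta>(1)] by blast
  show ?thesis
  proof
    show "test_function D (mollify \<kappa> f)"
      by (rule mollify_test_function[OF assms(1-3) \<kappa>(1,3) r(2) \<delta>(2)])
    show "\<bar>mollify \<kappa> f x - f x\<bar> \<le> e" for x
      using mollify_close[OF smooth_on_continuous[OF open_UNIV \<kappa>(1)] \<kappa>(2-5) assms(1,2) compact_imp_bounded[OF assms(3)], where e = e and x = x]
        d(2) \<delta>(3) by (simp add: less_imp_le)
  qed
qed

text \<open>This makes compactly supported C^1 functions admissible in the weak equation, where only
  the gradient of the test function enters.\<close>

lemma test_function_approx_C1:
  fixes f :: "real ^ 'n \<Rightarrow> real"
  assumes "\<And>x. GDERIV f x :> Df x" "continuous_on UNIV Df"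
    and "\<And>x. x \<notin> K \<Longrightarrow> f x = 0" "compact K" "K \<subseteq> D" "open D" "e > 0"
  obtains \<phi> where "test_function D \<phi>" "\<And>x. norm (grad UNIV \<phi> x - Df x) \<le> e"
proof -
  have cf: "continuous_on UNIV f"
    by (rule GDERIV_imp_continuous_on[OF assms(1)])
  have D0: "Df x = 0" if "x \<notin> K" for x
    using GDERIV_zero_outside[OF assms(1) compact_imp_closed[OF assms(4)] assms(3) that] .
  obtain r where r: "r > 0" "(\<Union>x\<in>K. ball x r) \<subseteq> D"
    using compact_subset_open_imp_ball_epsilon_subset[OF assms(4,6,5)] by blast
  obtain d where d: "d > 0" "\<And>x y. dist x y < d \<Longrightarrow> dist (Df x) (Df y) < e"
    using uniformly_continuous_compact_support[OF assms(2) D0 assms(4,7)] by blast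
  define \<delta> where "\<delta> = min (r / 2) d"
  have \<delta>: "\<delta> > 0" "\<delta> < r" "\<delta> \<le> d" using r d by (auto simp: \<delta>_def)
  obtain \<kappa> :: "real ^ 'n \<Rightarrow> real" where \<kappa>: "smooth_on UNIV \<kappa>" "\<And>x. \<kappa> x \<ge> 0" "\<And>x. norm x \<ge> \<delta> \<Longrightarrow> \<kappa> x = 0"
    "\<And>x. \<kappa> (- x) = \<kappa> x" "(\<kappa> has_integral 1) UNIV"
    using exists_mollifier[OF \<delta>(1)] by blast
  show ?thesis
  proof
    show "test_function D (mollify \<kappa> f)"
      by (rule mollify_test_function[OF cf assms(3,4) \<kappa>(1,3) r(2) \<delta>(2)])
    have "grad UNIV (mollify \<kappa> f) x = mollify \<kappa> Df x" for x
      using GDERIV_mollify[OF assms(1-4) \<kappa>(1)] by (intro grad_eqI) auto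
    then show "norm (grad UNIV (mollify \<kappa> f) x - Df x) \<le> e" for x
      using mollify_close[OF smooth_on_continuous[OF open_UNIV \<kappa>(1)] \<kappa>(2-5) assms(2) D0 compact_imp_bounded[OF assms(4)], where e = e and x = x]
        d(2) \<delta>(3) by (simp add: less_imp_le)
  qed
qed

section \<open>The fundamental lemma of the calculus of variations\<close>

text \<open>\<open>D\<close> and the complement of \<open>K\<close> are open and cover the space;
  the extension is \<open>f\<close> on the one and 0 on the other.\<close>

lemma continuous_on_extend_zero:
  fixes f :: "'a::t2_space \<Rightarrow> 'b::real_normed_vector"
  assumes "open D" "compact K" "K \<subseteq> D" "continuous_on D f" "\<And>x. x \<in> D - K \<Longrightarrow> f x = 0"
  shows "continuous_on UNIV (\<lambda>x. if x \<in> D then f x else 0)" (is "continuous_on _ ?f")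
proof -
  have "continuous_on D ?f"
    using continuous_on_cong[of D D ?f f] assms(4) by simp
  moreover have "continuous_on (- K) ?f"
    using continuous_on_cong[of "- K" "- K" ?f "\<lambda>_. 0"] assms(5) by simp
  moreover have "open (- K)" using assms(2) by (simp add: compact_imp_closed open_Compl)
  ultimately have "continuous_on (D \<union> - K) ?f" using assms(1) by (intro continuous_on_open_Un)
  moreover have "D \<union> - K = UNIV" using assms(3) by auto
  ultimately show ?thesis by simp
qed

lemma GDERIV_extend_zero:
  fixes f :: "real ^ 'n \<Rightarrow> real"
  assumes "open D" "compact K" "K \<subseteq> D" "\<And>x. x \<in> D \<Longrightarrow> GDERIV f x :> Df x"
    and "\<And>x. x \<in> D - K \<Longrightarrow> f x = 0"
  shows "GDERIV (\<lambda>x. if x \<in> D then f x else 0) x :> (if x \<in> D then Df x else 0)"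
proof (cases "x \<in> D")
  case True
  then show ?thesis
    using GDERIV_transform_open[OF assms(4)[OF True] assms(1) True] by simp
next
  case False
  then have "x \<in> - K" using assms(3) by auto
  moreover have "open (- K)" using assms(2) by (simp add: compact_imp_closed open_Compl)
  ultimately have "GDERIV (\<lambda>x. if x \<in> D then f x else 0) x :> 0"
    using GDERIV_transform_open[OF GDERIV_const[of 0], of "- K"] assms(5) by simp
  with False show ?thesis by simp
qed

lemma integrable_bounded_on:
  fixes f :: "'a::euclidean_space \<Rightarrow> 'b::{banach, second_countable_topology}"
  assumes "D \<in> lmeasurable" "f \<in> borel_measurable (lebesgue_on D)" "\<And>x. x \<in> D \<Longrightarrow> norm (f x) \<le> B"
  shows "integrable (lebesgue_on D) f"
proof -
  interpret finite_measure "lebesgue_on D" using assms(1) by (rule finite_measure_lebesgue_on)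
  show ?thesis
    by (rule integrable_const_bound[of _ B]) (use assms in \<open>auto intro!: AE_I2\<close>)
qed

lemma integrable_mult_bounded:
  fixes g f :: "'a \<Rightarrow> real"
  assumes "integrable M g" "f \<in> borel_measurable M" "\<And>x. x \<in> space M \<Longrightarrow> \<bar>f x\<bar> \<le> B"
  shows "integrable M (\<lambda>x. g x * f x)"
proof (rule Bochner_Integration.integrable_bound)
  show "integrable M (\<lambda>x. B * g x)" using assms(1) by simp
  show "AE x in M. norm (g x * f x) \<le> norm (B * g x)"
  proof (rule AE_I2)
    fix x assume "x \<in> space M"
    then have "\<bar>f x\<bar> \<le> \<bar>B\<bar>" using assms(3) by fastforce
    then show "norm (g x * f x) \<le> norm (B * g x)"
      by (simp add: abs_mult mult.commute mult_right_mono)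
  qed
qed (use assms in auto)

text \<open>The link between the Lebesgue integrals over \<open>D\<close> in the definitions and the
  gauge integrals over the whole space, for which translation invariance was exploited.\<close>

lemma compact_support_integral:
  fixes h :: "'a::euclidean_space \<Rightarrow> real"
  assumes "open D" "D \<in> lmeasurable" "compact K" "K \<subseteq> D" "continuous_on D h" "\<And>x. x \<in> D - K \<Longrightarrow> h x = 0"
  shows "integrable (lebesgue_on D) h"
    and "integral\<^sup>L (lebesgue_on D) h = integral UNIV (\<lambda>x. if x \<in> D then h x else 0)"
proof -
  have D: "D \<in> sets lebesgue" using assms(2) by (rule fmeasurableD)
  have "bounded (h ` K)"
    using assms(3,4,5) by (intro compact_imp_bounded compact_continuous_image) (auto intro: continuous_on_subset)
  then obtain B where B: "\<And>x. x \<in> K \<Longrightarrow> \<bar>h x\<bar> \<le> B" unfolding bounded_iff by auto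
  then have "\<bar>h x\<bar> \<le> max B 0" if "x \<in> D" for x
    using assms(6)[of x] that by (cases "x \<in> K") (auto simp: le_max_iff_disj)
  then show *: "integrable (lebesgue_on D) h"
    using continuous_imp_measurable_on_sets_lebesgue[OF assms(5) D]
    by (intro integrable_bounded_on[OF assms(2), of _ "max B 0"]) auto
  show "integral\<^sup>L (lebesgue_on D) h = integral UNIV (\<lambda>x. if x \<in> D then h x else 0)"
    using lebesgue_integral_eq_integral[OF * D] by (simp add: integral_restrict_UNIV)
qed

text \<open>The product of \<open>g\<close> and \<phi>, extended by zero, is C^1 with compact
  support on the whole space, so its gradient has zero integral; no boundary term can arise.\<close>

lemma integral_by_parts_test:
  fixes g :: "real ^ 'n \<Rightarrow> real"
  assumes D: "open D" "D \<in> lmeasurable" and g: "\<And>x. x \<in> D \<Longrightarrow> GDERIV g x :> Dg x" "continuous_on D Dg"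
    and "test_function D \<phi>"
  shows "integral\<^sup>L (lebesgue_on D) (\<lambda>x. g x * (grad UNIV \<phi> x \<bullet> e)) =
    - integral\<^sup>L (lebesgue_on D) (\<lambda>x. (Dg x \<bullet> e) * \<phi> x)"
proof -
  obtain K where K: "compact K" "K \<subseteq> D" "\<And>x. x \<notin> K \<Longrightarrow> \<phi> x = 0" "\<And>x. x \<notin> K \<Longrightarrow> grad UNIV \<phi> x = 0"
    and \<phi>: "\<And>x. GDERIV \<phi> x :> grad UNIV \<phi> x" "continuous_on UNIV (grad UNIV \<phi>)" "continuous_on UNIV \<phi>"
    using test_functionE[OF assms(5)] by metis
  have cg: "continuous_on D g"
    by (rule GDERIV_imp_continuous_on[OF g(1)])
  have c: "continuous_on D (grad UNIV \<phi>)" "continuous_on D \<phi>"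
    using \<phi> continuous_on_subset by blast+
  let ?P = "\<lambda>x. g x *\<^sub>R grad UNIV \<phi> x + \<phi> x *\<^sub>R Dg x"
  let ?Q = "\<lambda>x. if x \<in> D then ?P x else 0"
  have "(?Q has_integral 0) UNIV"
  proof (rule has_integral_GDERIV_zero)
    show "GDERIV (\<lambda>x. if x \<in> D then g x * \<phi> x else 0) x :> ?Q x" for x
      by (rule GDERIV_extend_zero[OF D(1) K(1,2)]) (use g K \<phi> in \<open>auto intro!: GDERIV_mult\<close>)
    show "continuous_on UNIV ?Q"
      by (rule continuous_on_extend_zero[OF D(1) K(1,2)]) (use K in \<open>auto intro!: continuous_intros cg c g\<close>)
  qed (use K in auto)
  then have "((\<lambda>x. ?Q x \<bullet> e) has_integral 0 \<bullet> e) UNIV"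
    by (rule has_integral_linear[OF _ bounded_linear_inner_left, unfolded o_def])
  then have "integral UNIV (\<lambda>x. if x \<in> D then ?P x \<bullet> e else 0) = 0"
    by (intro integral_unique) (simp add: if_distrib[of "\<lambda>v. v \<bullet> e"] cong: if_cong)
  moreover have "integral\<^sup>L (lebesgue_on D) (\<lambda>x. ?P x \<bullet> e) = integral UNIV (\<lambda>x. if x \<in> D then ?P x \<bullet> e else 0)"
    by (rule compact_support_integral[OF D K(1,2)]) (use K in \<open>auto intro!: continuous_intros cg c g\<close>)
  moreover have "integrable (lebesgue_on D) (\<lambda>x. g x * (grad UNIV \<phi> x \<bullet> e))"
    by (rule compact_support_integral[OF D K(1,2)]) (use K in \<open>auto intro!: continuous_intros cg c g\<close>)
  moreover have "integrable (lebesgue_on D) (\<lambda>x. (Dg x \<bullet> e) * \<phi> x)"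
    by (rule compact_support_integral[OF D K(1,2)]) (use K in \<open>auto intro!: continuous_intros cg c g\<close>)
  ultimately show ?thesis
    by (simp add: inner_add_left mult.commute)
qed

lemma eq_zero_if_le_all_mult:
  fixes I A :: real
  assumes "\<And>e. e > 0 \<Longrightarrow> \<bar>I\<bar> \<le> e * A" and "A \<ge> 0"
  shows "I = 0"
proof -
  have "\<bar>I\<bar> \<le> 0 + e" if "e > 0" for e
  proof -
    \<comment> \<open>The added 1 covers the case \<open>A = 0\<close>.\<close>
    have "\<bar>I\<bar> \<le> e / (A + 1) * A" using that assms by (intro assms(1)) simp
    also have "\<dots> \<le> e" using that assms(2) by (simp add: field_simps)
    finally show ?thesis by simp
  qed
  then have "\<bar>I\<bar> \<le> 0" by (rule field_le_epsilon)
  then show ?thesis by simp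
qed

text \<open>Uniform approximation by test functions within \<open>e\<close> changes the integral by
  at most \<open>e\<close> times the L^1 norm of \<open>g\<close>.\<close>

lemma integral_continuous_test_zero:
  fixes g :: "real ^ 'n \<Rightarrow> real"
  assumes D: "open D" "D \<in> lmeasurable" and g: "integrable (lebesgue_on D) g"
    and t: "\<And>\<phi>. test_function D \<phi> \<Longrightarrow> integral\<^sup>L (lebesgue_on D) (\<lambda>x. g x * \<phi> x) = 0"
    and f: "continuous_on UNIV f" "compact K" "K \<subseteq> D" "\<And>x. x \<notin> K \<Longrightarrow> f x = 0"
  shows "integral\<^sup>L (lebesgue_on D) (\<lambda>x. g x * f x) = 0"
proof -
  have m: "h \<in> borel_measurable (lebesgue_on D)" if "continuous_on UNIV h" for h :: "real ^ 'n \<Rightarrow> real"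
    using that D continuous_on_subset[OF that subset_UNIV, of D]
    by (intro continuous_imp_measurable_on_sets_lebesgue) (auto dest: fmeasurableD)
  have gi: "integrable (lebesgue_on D) (\<lambda>x. g x * h x)"
    if "continuous_on UNIV h" "\<And>x. x \<notin> K' \<Longrightarrow> h x = 0" "compact K'" for h K'
  proof -
    have "bounded (h ` K')"
      using that by (intro compact_imp_bounded compact_continuous_image) (auto intro: continuous_on_subset)
    then obtain B where B: "\<And>x. x \<in> K' \<Longrightarrow> \<bar>h x\<bar> \<le> B" unfolding bounded_iff by auto
    have "\<bar>h x\<bar> \<le> max B 0" for x
      using that(2)[of x] B by (cases "x \<in> K'") (auto simp: le_max_iff_disj)
    then show ?thesis by (intro integrable_mult_bounded[OF g m[OF that(1)]])
  qed
  let ?I = "integral\<^sup>L (lebesgue_on D) (\<lambda>x. g x * f x)"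
  let ?A = "integral\<^sup>L (lebesgue_on D) (\<lambda>x. \<bar>g x\<bar>)"
  have "\<bar>?I\<bar> \<le> e * ?A" if "e > 0" for e
  proof -
    obtain \<phi> where \<phi>: "test_function D \<phi>" "\<And>x. \<bar>\<phi> x - f x\<bar> \<le> e"
      using test_function_approx[OF f(1,4,2,3) D(1) \<open>e > 0\<close>] by blast
    obtain K' where K': "compact K'" "\<And>x. x \<notin> K' \<Longrightarrow> \<phi> x = 0" "continuous_on UNIV \<phi>"
      using test_functionE[OF \<phi>(1)] by metis
    have i: "integrable (lebesgue_on D) (\<lambda>x. g x * f x)" "integrable (lebesgue_on D) (\<lambda>x. g x * \<phi> x)"
      using gi[OF f(1,4,2)] gi[OF K'(3,2,1)] by auto
    then have "?I = integral\<^sup>L (lebesgue_on D) (\<lambda>x. g x * f x - g x * \<phi> x)"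
      using t[OF \<phi>(1)] by simp
    also have "\<bar>\<dots>\<bar> \<le> integral\<^sup>L (lebesgue_on D) (\<lambda>x. \<bar>g x * f x - g x * \<phi> x\<bar>)"
      using integral_norm_bound[of "lebesgue_on D" "\<lambda>x. g x * f x - g x * \<phi> x"] by simp
    also have "\<dots> \<le> integral\<^sup>L (lebesgue_on D) (\<lambda>x. e * \<bar>g x\<bar>)"
    proof (rule integral_mono)
      show "\<bar>g x * f x - g x * \<phi> x\<bar> \<le> e * \<bar>g x\<bar>" for x
      proof -
        have "g x * f x - g x * \<phi> x = - (g x * (\<phi> x - f x))" by (simp add: algebra_simps)
        then have "\<bar>g x * f x - g x * \<phi> x\<bar> = \<bar>g x\<bar> * \<bar>\<phi> x - f x\<bar>" by (simp add: abs_mult)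
        also have "\<dots> \<le> \<bar>g x\<bar> * e" using \<phi>(2) by (simp add: mult_left_mono)
        finally show ?thesis by (simp add: mult.commute)
      qed
    qed (use i g in auto)
    finally show ?thesis by simp
  qed
  then have *: "\<bar>?I\<bar> \<le> e * ?A" if "e > 0" for e using that by blast
  show ?thesis by (rule eq_zero_if_le_all_mult[OF *]) auto
qed

text \<open>The indicator of \<open>K\<close> is the pointwise limit of continuous functions with
  values in [0, 1] supported in one compact subset of \<open>D\<close>; dominated convergence with
  bound |g| applies.\<close>

lemma integral_compact_test_zero:
  fixes g :: "real ^ 'n \<Rightarrow> real"
  assumes D: "open D" "D \<in> lmeasurable" and g: "integrable (lebesgue_on D) g"
    and t: "\<And>\<phi>. test_function D \<phi> \<Longrightarrow> integral\<^sup>L (lebesgue_on D) (\<lambda>x. g x * \<phi> x) = 0"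
    and K: "compact K" "K \<subseteq> D"
  shows "integral\<^sup>L (lebesgue_on D) (\<lambda>x. g x * indicat_real K x) = 0"
proof (cases "K = {}")
  case False
  obtain r where r: "r > 0" "(\<Union>x\<in>K. cball x r) \<subseteq> D"
    using compact_subset_open_imp_cball_epsilon_subset[OF K(1) D(1) K(2)] by blast
  let ?C = "{x. \<exists>y\<in>K. dist x y \<le> r}"
  \<comment> \<open>The summand \<open>1 / r\<close> in the slope makes every \<open>f n\<close>,
    also \<open>f 0\<close>, vanish at distance \<open>r\<close> from \<open>K\<close>; the summand
    \<open>n\<close> drives the values off \<open>K\<close> to 0.\<close>
  define f where "f n x = max 0 (1 - (real n + 1 / r) * infdist x K)" for n x
  have cf: "continuous_on UNIV (f n)" for n
    unfolding f_def by (intro continuous_intros)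
  have f0: "f n x = 0" if "x \<notin> ?C" for n x
  proof -
    obtain y where "y \<in> K" "infdist x K = dist x y"
      using infdist_attains_inf[OF compact_imp_closed[OF K(1)] False] by blast
    then have "infdist x K > r" using that by force
    then have "(1 / r) * infdist x K \<ge> 1" using r(1) by (simp add: field_simps)
    moreover have "real n * infdist x K \<ge> 0" by (simp add: infdist_nonneg)
    ultimately show ?thesis unfolding f_def by (simp add: algebra_simps)
  qed
  have f1: "\<bar>f n x\<bar> \<le> 1" for n x
  proof -
    have "(real n + 1 / r) * infdist x K \<ge> 0" using r(1) by (simp add: infdist_nonneg)
    then show ?thesis unfolding f_def by auto
  qed
  have z: "integral\<^sup>L (lebesgue_on D) (\<lambda>x. g x * f n x) = 0" for n
  proof (rule integral_continuous_test_zero[OF D g t cf compact_neighbourhood[OF K(1)] _ f0])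
    show "?C \<subseteq> D" using r(2) by (force simp: dist_commute)
  qed
  have l: "(\<lambda>n. f n x) \<longlonglongrightarrow> indicat_real K x" for x
  proof (cases "x \<in> K")
    case True then show ?thesis by (simp add: f_def)
  next
    case F: False
    then have p: "infdist x K > 0"
      using in_closed_iff_infdist_zero[OF compact_imp_closed[OF K(1)] False, of x] infdist_nonneg[of x K] by simp
    have "eventually (\<lambda>n. f n x = 0) sequentially"
    proof -
      obtain N :: nat where N: "real N > 1 / infdist x K" using reals_Archimedean2 by blast
      have "f n x = 0" if "n \<ge> N" for n
      proof -
        have "real n * infdist x K \<ge> real N * infdist x K" using that p by simp
        also have "real N * infdist x K \<ge> 1" using N p by (simp add: field_simps)
        finally have "(real n + 1 / r) * infdist x K \<ge> 1" using r(1) p by (simp add: distrib_right add_increasing2)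
        then show ?thesis by (simp add: f_def)
      qed
      then show ?thesis by (auto simp: eventually_sequentially)
    qed
    then have "(\<lambda>n. f n x) \<longlonglongrightarrow> 0" by (rule tendsto_eventually)
    with F show ?thesis by simp
  qed
  have mf: "f n \<in> borel_measurable (lebesgue_on D)" for n
    using D continuous_on_subset[OF cf subset_UNIV, of D]
    by (intro continuous_imp_measurable_on_sets_lebesgue) (auto dest: fmeasurableD)
  have mK: "indicat_real K \<in> borel_measurable (lebesgue_on D)"
    using K(1) by (intro measurable_restrict_space1 borel_measurable_indicator) (simp add: borel_compact sets_completionI_sets)
  have "(\<lambda>n. integral\<^sup>L (lebesgue_on D) (\<lambda>x. g x * f n x)) \<longlonglongrightarrow> integral\<^sup>L (lebesgue_on D) (\<lambda>x. g x * indicat_real K x)"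
  proof (rule integral_dominated_convergence[where w = "\<lambda>x. \<bar>g x\<bar>"])
    show "AE x in lebesgue_on D. (\<lambda>n. g x * f n x) \<longlonglongrightarrow> g x * indicat_real K x"
      by (intro AE_I2 tendsto_mult tendsto_const l)
    show "AE x in lebesgue_on D. norm (g x * f n x) \<le> \<bar>g x\<bar>" for n
      using f1 by (intro AE_I2) (simp add: abs_mult mult_left_le)
  qed (use g mf mK in auto)
  then show ?thesis using z by (simp add: LIMSEQ_const_iff)
qed simp

text \<open>Inner regularity: if \<open>g > 0\<close> on a set of positive measure, that set
  contains a compact \<open>T\<close> of positive measure, yet \<open>g\<close> has zero integral
  over \<open>T\<close>.\<close>

lemma fundamental_lemma_le:
  fixes g :: "real ^ 'n \<Rightarrow> real"
  assumes D: "open D" "bounded D" and g: "integrable (lebesgue_on D) g"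
    and t: "\<And>\<phi>. test_function D \<phi> \<Longrightarrow> integral\<^sup>L (lebesgue_on D) (\<lambda>x. g x * \<phi> x) = 0"
  shows "AE x in lebesgue_on D. g x \<le> 0"
proof -
  have Dm: "D \<in> lmeasurable" using D lmeasurable_open by blast
  have Ds: "D \<in> sets lebesgue" using Dm by (rule fmeasurableD)
  let ?S = "{x \<in> D. g x > 0}"
  have "{x \<in> space (lebesgue_on D). g x > 0} \<in> sets (lebesgue_on D)"
    using g by (intro borel_measurable_less) auto
  then have S: "?S \<in> sets lebesgue" using Ds by (simp add: sets_restrict_space_iff)
  then have Sm: "?S \<in> lmeasurable" using Dm by (rule fmeasurableI2[rotated 2]) auto
  have "measure lebesgue ?S = 0"
  proof (rule ccontr)
    assume "measure lebesgue ?S \<noteq> 0"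
    then have pos: "measure lebesgue ?S > 0" by (simp add: zero_less_measure_iff)
    \<comment> \<open>The error allowed is the full measure of \<open>?S\<close>: strict inequality
      is just enough to forbid that \<open>T\<close> is a null set.\<close>
    obtain T where T: "closed T" "T \<subseteq> ?S" "?S - T \<in> lmeasurable" "emeasure lebesgue (?S - T) < ennreal (measure lebesgue ?S)"
      by (rule sets_lebesgue_inner_closed[OF S pos])
    have cT: "compact T" using T(1,2) D(2) bounded_subset[of D T] by (auto simp: compact_eq_bounded_closed)
    have TD: "T \<subseteq> D" using T(2) by auto
    have "integral\<^sup>L (lebesgue_on D) (\<lambda>x. g x * indicat_real T x) = 0"
      by (rule integral_compact_test_zero[OF D(1) Dm g t cT TD])
    moreover have "integrable (lebesgue_on D) (\<lambda>x. g x * indicat_real T x)"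
    proof (rule integrable_mult_bounded[OF g])
      show "indicat_real T \<in> borel_measurable (lebesgue_on D)"
        using cT by (intro measurable_restrict_space1 borel_measurable_indicator) (simp add: borel_compact sets_completionI_sets)
    qed (auto simp: indicator_def)
    moreover have "AE x in lebesgue_on D. 0 \<le> g x * indicat_real T x"
      by (intro AE_I2) (use T(2) in \<open>auto simp: indicator_def\<close>)
    ultimately have "AE x in lebesgue_on D. g x * indicat_real T x = 0"
      by (simp add: integral_nonneg_eq_0_iff_AE)
    then have "AE x in lebesgue_on D. x \<notin> T"
      by (rule AE_mp) (intro AE_I2, use T(2) in \<open>auto simp: indicator_def\<close>)
    then have "AE x in lebesgue. x \<in> D \<longrightarrow> x \<notin> T"
      using Ds by (simp add: AE_restrict_space_iff)
    then have "AE x in lebesgue. x \<notin> T" by (rule AE_mp) (use TD in auto)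
    moreover have "T \<in> sets lebesgue" using cT by (simp add: borel_compact sets_completionI_sets)
    ultimately have T0: "T \<in> null_sets lebesgue" by (simp add: AE_iff_null_sets)
    have "emeasure lebesgue (?S - T) = emeasure lebesgue ?S"
      using T0 S by (rule emeasure_Diff_null_set)
    also have "\<dots> = ennreal (measure lebesgue ?S)"
      using Sm by (simp add: emeasure_eq_measure2)
    finally show False using T(4) by simp
  qed
  then have "?S \<in> null_sets lebesgue"
    using Sm S by (simp add: emeasure_eq_measure2 null_setsI)
  from AE_not_in[OF this] have "AE x in lebesgue. x \<notin> ?S" .
  then show ?thesis using Ds by (auto simp: AE_restrict_space_iff not_less)
qed

lemma fundamental_lemma:
  fixes g :: "real ^ 'n \<Rightarrow> real"
  assumes D: "open D" "bounded D" and g: "integrable (lebesgue_on D) g"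
    and t: "\<And>\<phi>. test_function D \<phi> \<Longrightarrow> integral\<^sup>L (lebesgue_on D) (\<lambda>x. g x * \<phi> x) = 0"
  shows "AE x in lebesgue_on D. g x = 0"
proof -
  have "AE x in lebesgue_on D. g x \<le> 0"
    by (rule fundamental_lemma_le[OF D g t])
  moreover have "AE x in lebesgue_on D. - g x \<le> 0"
    by (rule fundamental_lemma_le[OF D]) (use g t in auto)
  ultimately show ?thesis by eventually_elim simp
qed

section \<open>Boundary values\<close>

lemma le_eps_plus_powr:
  fixes s \<epsilon> p :: real
  assumes "s \<ge> 0" "\<epsilon> > 0" "p > 1"
  shows "s \<le> \<epsilon> + \<epsilon> powr (1 - p) * s powr p"
proof (cases "s \<le> \<epsilon>")
  case True
  then show ?thesis by (simp add: add_increasing2)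
next
  case False
  \<comment> \<open>For s > \<epsilon> the negative exponent 1 - p gives the bound. The resulting
    inequality stands in for Hoelder's throughout and later splits a gradient at a height.\<close>
  then have "s = s powr (1 - p) * s powr p" using assms by (simp flip: powr_add)
  also have "\<dots> \<le> \<epsilon> powr (1 - p) * s powr p"
    using False assms by (intro mult_right_mono powr_mono2') auto
  finally show ?thesis using assms by simp
qed

lemma powr_add_le:
  fixes s t p :: real
  assumes "s \<ge> 0" "t \<ge> 0" "p \<ge> 0"
  shows "(s + t) powr p \<le> 2 powr p * (s powr p + t powr p)"
proof -
  have "(s + t) powr p \<le> (2 * max s t) powr p" using assms by (intro powr_mono2) auto
  also have "\<dots> = 2 powr p * max s t powr p" using assms by (simp add: powr_mult)
  also have "max s t powr p \<le> s powr p + t powr p" by (simp add: max_def)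
  finally show ?thesis by simp
qed

lemma integrable_of_Lp:
  fixes u :: "real ^ 'n \<Rightarrow> 'b::euclidean_space"
  assumes "D \<in> lmeasurable" "Lp_on p D u" "p > 1"
  shows "integrable (lebesgue_on D) u"
proof -
  interpret finite_measure "lebesgue_on D" using assms(1) by (rule finite_measure_lebesgue_on)
  show ?thesis
  proof (rule Bochner_Integration.integrable_bound)
    show "integrable (lebesgue_on D) (\<lambda>x. 1 + norm (u x) powr p)"
      using assms(2) by (auto simp: Lp_on_def)
    show "AE x in lebesgue_on D. norm (u x) \<le> norm (1 + norm (u x) powr p)"
      using le_eps_plus_powr[of "norm (u x)" 1 p for x] assms(3) by (intro AE_I2) simp
  qed (use assms(2) in \<open>simp add: Lp_on_def\<close>)
qed

lemma Lp_on_diff: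
  fixes u v :: "real ^ 'n \<Rightarrow> 'b::euclidean_space"
  assumes "Lp_on p D u" "Lp_on p D v" "p > 1"
  shows "Lp_on p D (\<lambda>x. u x - v x)"
  unfolding Lp_on_def
proof
  have m: "u \<in> borel_measurable (lebesgue_on D)" "v \<in> borel_measurable (lebesgue_on D)"
    using assms by (auto simp: Lp_on_def)
  then show m': "(\<lambda>x. u x - v x) \<in> borel_measurable (lebesgue_on D)" by simp
  show "integrable (lebesgue_on D) (\<lambda>x. norm (u x - v x) powr p)"
  proof (rule Bochner_Integration.integrable_bound)
    show "integrable (lebesgue_on D) (\<lambda>x. 2 powr p * (norm (u x) powr p + norm (v x) powr p))"
      using assms by (auto simp: Lp_on_def)
    show "AE x in lebesgue_on D. norm (norm (u x - v x) powr p)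
        \<le> norm (2 powr p * (norm (u x) powr p + norm (v x) powr p))"
    proof (rule AE_I2)
      fix x
      have "norm (u x - v x) powr p \<le> (norm (u x) + norm (v x)) powr p"
        using assms(3) by (intro powr_mono2) (auto simp: norm_triangle_ineq4)
      also have "\<dots> \<le> 2 powr p * (norm (u x) powr p + norm (v x) powr p)"
        using assms(3) by (intro powr_add_le) auto
      finally show "norm (norm (u x - v x) powr p) \<le> norm (2 powr p * (norm (u x) powr p + norm (v x) powr p))"
        by simp
    qed
  qed (use m' in measurable)
qed

lemma Lp_on_bounded:
  fixes u :: "real ^ 'n \<Rightarrow> 'b::euclidean_space"
  assumes "D \<in> lmeasurable" "u \<in> borel_measurable (lebesgue_on D)" "\<And>x. x \<in> D \<Longrightarrow> norm (u x) \<le> B" "p > 1"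
  shows "Lp_on p D u"
  unfolding Lp_on_def
proof
  show "integrable (lebesgue_on D) (\<lambda>x. norm (u x) powr p)"
  proof (rule integrable_bounded_on[OF assms(1)])
    show "norm (norm (u x) powr p) \<le> B powr p" if "x \<in> D" for x
      using assms(3)[OF that] assms(4) by (simp add: powr_mono2)
  qed (use assms(2) in measurable)
qed fact

lemma L1_tendsto_of_Lp_tendsto:
  fixes w :: "nat \<Rightarrow> real ^ 'n \<Rightarrow> 'b::euclidean_space"
  assumes D: "D \<in> lmeasurable" and w: "\<And>k. Lp_on p D (w k)" and p: "p > 1"
    and l: "(\<lambda>k. integral\<^sup>L (lebesgue_on D) (\<lambda>x. norm (w k x) powr p)) \<longlonglongrightarrow> 0"
  shows "(\<lambda>k. integral\<^sup>L (lebesgue_on D) (\<lambda>x. norm (w k x))) \<longlonglongrightarrow> 0"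
proof (rule LIMSEQ_I)
  interpret finite_measure "lebesgue_on D" using D by (rule finite_measure_lebesgue_on)
  define m where "m = measure (lebesgue_on D) D"
  let ?N = "\<lambda>k. integral\<^sup>L (lebesgue_on D) (\<lambda>x. norm (w k x) powr p)"
  fix r :: real assume r: "r > 0"
  \<comment> \<open>Half of \<open>r\<close> pays for \<epsilon> times the measure, where the added
    1 covers measure zero; the other half is left for the L^p term.\<close>
  define \<epsilon> where "\<epsilon> = r / (2 * (m + 1))"
  have m0: "m \<ge> 0" by (simp add: m_def)
  have \<epsilon>: "\<epsilon> > 0" unfolding \<epsilon>_def using r m0 by (intro divide_pos_pos) auto
  have "\<epsilon> * m = (r / 2) * (m / (m + 1))" unfolding \<epsilon>_def by simp
  also have "\<dots> \<le> (r / 2) * 1" using r m0 by (intro mult_left_mono) auto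
  finally have \<epsilon>m: "\<epsilon> * m \<le> r / 2" by simp
  have le: "integral\<^sup>L (lebesgue_on D) (\<lambda>x. norm (w k x)) \<le> \<epsilon> * m + \<epsilon> powr (1 - p) * ?N k" for k
  proof -
    have i: "integrable (lebesgue_on D) (\<lambda>x. norm (w k x) powr p)" using w by (simp add: Lp_on_def)
    have "integral\<^sup>L (lebesgue_on D) (\<lambda>x. norm (w k x)) \<le>
        integral\<^sup>L (lebesgue_on D) (\<lambda>x. \<epsilon> + \<epsilon> powr (1 - p) * norm (w k x) powr p)"
      using i integrable_of_Lp[OF D w p] le_eps_plus_powr[OF norm_ge_zero \<epsilon> p]
      by (intro integral_mono) auto
    also have "\<dots> = \<epsilon> * m + \<epsilon> powr (1 - p) * ?N k"
      using i by (simp add: mult.commute m_def)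
    finally show ?thesis .
  qed
  have "(\<lambda>k. \<epsilon> powr (1 - p) * ?N k) \<longlonglongrightarrow> \<epsilon> powr (1 - p) * 0"
    by (intro tendsto_mult tendsto_const l)
  then have "eventually (\<lambda>k. \<epsilon> powr (1 - p) * ?N k < r / 2) sequentially"
    using r by (intro order_tendstoD(2)) auto
  then obtain N where N: "\<And>k. k \<ge> N \<Longrightarrow> \<epsilon> powr (1 - p) * ?N k < r / 2"
    by (auto simp: eventually_sequentially)
  have "integral\<^sup>L (lebesgue_on D) (\<lambda>x. norm (w k x)) < r" if "k \<ge> N" for k
    using N[OF that] le[of k] \<epsilon>m by linarith
  then show "\<exists>no. \<forall>n\<ge>no. norm (integral\<^sup>L (lebesgue_on D) (\<lambda>x. norm (w n x)) - 0) < r"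
    by auto
qed

lemma test_function_Lp:
  assumes "D \<in> lmeasurable" "test_function D \<phi>" "p > 1"
  shows "Lp_on p D \<phi>" "Lp_on p D (grad UNIV \<phi>)"
proof -
  obtain K where K: "compact K" "\<And>x. x \<notin> K \<Longrightarrow> \<phi> x = 0" "\<And>x. x \<notin> K \<Longrightarrow> grad UNIV \<phi> x = 0"
    and c: "continuous_on UNIV (grad UNIV \<phi>)" "continuous_on UNIV \<phi>"
    using test_functionE[OF assms(2)] by metis
  have Ds: "D \<in> sets lebesgue" using assms(1) by (rule fmeasurableD)
  have "\<exists>B. \<forall>x. norm (f x) \<le> B" if "continuous_on UNIV f" "\<And>x. x \<notin> K \<Longrightarrow> f x = 0" for f :: "_ \<Rightarrow> 'c::real_normed_vector"
  proof -
    have "bounded (f ` K)"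
      using that K(1) by (intro compact_imp_bounded compact_continuous_image) (auto intro: continuous_on_subset)
    then obtain B where B: "\<And>x. x \<in> K \<Longrightarrow> norm (f x) \<le> B" unfolding bounded_iff by auto
    have "norm (f x) \<le> max B 0" for x
      using that(2)[of x] B by (cases "x \<in> K") (auto simp: le_max_iff_disj)
    then show ?thesis by blast
  qed
  note b = this
  obtain B where B: "\<And>x. norm (\<phi> x) \<le> B" using b[OF c(2) K(2)] by blast
  show "Lp_on p D \<phi>"
    by (rule Lp_on_bounded[OF assms(1) _ B assms(3)])
      (use c Ds continuous_on_subset in \<open>blast intro: continuous_imp_measurable_on_sets_lebesgue\<close>)
  obtain B' where B': "\<And>x. norm (grad UNIV \<phi> x) \<le> B'" using b[OF c(1) K(3)] by blast
  show "Lp_on p D (grad UNIV \<phi>)"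
    by (rule Lp_on_bounded[OF assms(1) _ B' assms(3)])
      (use c Ds continuous_on_subset in \<open>blast intro: continuous_imp_measurable_on_sets_lebesgue\<close>)
qed

section \<open>C^1 truncation at small values\<close>

lemma DERIV_max_square: "DERIV (\<lambda>t::real. (max 0 t)\<^sup>2) t :> 2 * max 0 t"
proof -
  consider "t > 0" | "t < 0" | "t = 0" by linarith
  then show ?thesis
  proof cases
    case 1
    have "DERIV (\<lambda>t::real. t\<^sup>2) t :> 2 * max 0 t"
      using 1 by (auto intro!: derivative_eq_intros)
    then show ?thesis
      by (rule has_field_derivative_transform_within_open[of _ _ _ "{0<..}"]) (use 1 in auto)
  next
    case 2
    have "DERIV (\<lambda>t. 0::real) t :> 2 * max 0 t" using 2 by simp
    then show ?thesis
      by (rule has_field_derivative_transform_within_open[of _ _ _ "{..<0}"]) (use 2 in auto)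
  next
    case 3
    have "((\<lambda>h::real. ((max 0 (0 + h))\<^sup>2 - (max 0 0)\<^sup>2) / h) \<longlongrightarrow> 0) (at 0)"
    proof (rule Lim_null_comparison)
      show "eventually (\<lambda>h. norm (((max 0 (0 + h))\<^sup>2 - (max 0 (0::real))\<^sup>2) / h) \<le> \<bar>h\<bar>) (at 0)"
        by (intro always_eventually allI) (auto simp: max_def power2_eq_square)
      show "((\<lambda>h::real. \<bar>h\<bar>) \<longlongrightarrow> 0) (at 0)" by (auto intro!: tendsto_eq_intros)
    qed
    then have "DERIV (\<lambda>t::real. (max 0 t)\<^sup>2) 0 :> 0" unfolding DERIV_def .
    with 3 show ?thesis by simp
  qed
qed

text \<open>An even C^1 function rising from 0 at 0 to 1 at |s| = c and constant beyond. Composed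
  with a test function it keeps compact support, and its gradient lives only where the test function
  is below c in modulus.\<close>

definition cutoff :: "real \<Rightarrow> real \<Rightarrow> real" where
  "cutoff c s = 1 - (max 0 (1 - (s / c)\<^sup>2))\<^sup>2"

definition cutoff_deriv :: "real \<Rightarrow> real \<Rightarrow> real" where
  "cutoff_deriv c s = 2 * max 0 (1 - (s / c)\<^sup>2) * (2 * s / c\<^sup>2)"

lemma cutoff_0 [simp]: "cutoff c 0 = 0"
  by (simp add: cutoff_def)

lemma cutoff_nonneg: "cutoff c s \<ge> 0"
proof -
  have "max 0 (1 - (s / c)\<^sup>2) \<le> 1" by simp
  then have "(max 0 (1 - (s / c)\<^sup>2))\<^sup>2 \<le> 1" by (intro power_le_one) auto
  then show ?thesis by (simp add: cutoff_def)
qed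

lemma ratio_square_ge_one:
  fixes s c :: real
  assumes "c > 0" "\<bar>s\<bar> \<ge> c"
  shows "(s / c)\<^sup>2 \<ge> 1"
proof -
  have "1 \<le> \<bar>s / c\<bar>" using assms by (simp add: field_simps)
  then have "1 \<le> \<bar>s / c\<bar>\<^sup>2" by (rule one_le_power)
  then show ?thesis by (simp only: power2_abs)
qed

lemma cutoff_large:
  assumes "c > 0" "\<bar>s\<bar> \<ge> c"
  shows "cutoff c s = 1" "cutoff_deriv c s = 0"
  using ratio_square_ge_one[OF assms] by (simp_all add: cutoff_def cutoff_deriv_def)

lemma abs_cutoff_deriv_le:
  assumes "c > 0"
  shows "\<bar>cutoff_deriv c s\<bar> \<le> 4 / c"
proof (cases "\<bar>s\<bar> \<ge> c")
  case False
  have "\<bar>cutoff_deriv c s\<bar> = (max 0 (1 - (s / c)\<^sup>2)) * (4 * \<bar>s\<bar> / c\<^sup>2)"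
    by (simp add: cutoff_deriv_def abs_mult)
  also have "\<dots> \<le> 1 * (4 * c / c\<^sup>2)"
    using False assms by (intro mult_mono divide_right_mono) auto
  also have "\<dots> = 4 / c" using assms by (simp add: power2_eq_square)
  finally show ?thesis .
qed (use cutoff_large[OF assms] assms in simp)

lemma DERIV_cutoff:
  assumes "c > 0"
  shows "DERIV (cutoff c) s :> cutoff_deriv c s"
proof -
  have "DERIV (\<lambda>s. 1 - (s / c)\<^sup>2) s :> - (2 * s / c\<^sup>2)"
    using assms by (auto intro!: derivative_eq_intros simp: power2_eq_square)
  from DERIV_chain'[OF this DERIV_max_square]
  have "DERIV (\<lambda>s. 1 - (max 0 (1 - (s / c)\<^sup>2))\<^sup>2) s :> 0 - 2 * max 0 (1 - (s / c)\<^sup>2) * - (2 * s / c\<^sup>2)"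
    by (intro DERIV_diff DERIV_const)
  then show ?thesis by (simp add: cutoff_def[abs_def] cutoff_deriv_def)
qed

lemma continuous_on_cutoff_deriv: "c > 0 \<Longrightarrow> continuous_on S (cutoff_deriv c)"
  unfolding cutoff_deriv_def by (intro continuous_intros) auto

text \<open>\<open>\<psi>\<close> vanishes on the translate of the box by \<open>T\<close>; slide the box there and bound the rate of change of its integral.\<close>

lemma integral_le_sliding:
  fixes \<psi> :: "real ^ 'n \<Rightarrow> real"
  assumes \<psi>: "\<And>x. GDERIV \<psi> x :> D\<psi> x" "continuous_on UNIV D\<psi>"
    and z: "\<And>x. x \<in> cbox a b \<Longrightarrow> \<psi> (x + T) = 0"
    and S: "\<And>x s. x \<in> cbox a b \<Longrightarrow> 0 \<le> s \<Longrightarrow> s \<le> 1 \<Longrightarrow> x + s *\<^sub>R T \<in> S"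
    and i: "(\<lambda>x. norm (D\<psi> x)) integrable_on S"
  shows "integral (cbox a b) \<psi> \<le> norm T * integral S (\<lambda>x. norm (D\<psi> x))"
proof -
  have c\<psi>: "continuous_on UNIV \<psi>"
    by (rule GDERIV_imp_continuous_on[OF \<psi>(1)])
  define I where "I s = integral (cbox a b) (\<lambda>x. \<psi> (x + s *\<^sub>R T))" for s
  define J where "J s = integral (cbox a b) (\<lambda>x. D\<psi> (x + s *\<^sub>R T) \<bullet> T)" for s
  have "DERIV I s :> J s" for s
  proof -
    have "(I has_field_derivative J s) (at s within UNIV)"
      unfolding I_def J_def
    proof (rule leibniz_rule_field_derivative)
      fix s x assume "x \<in> cbox a b"
      have "((\<lambda>s. x + s *\<^sub>R T) has_derivative (\<lambda>h. h *\<^sub>R T)) (at s)"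
        by (auto intro!: derivative_eq_intros)
      from has_derivative_compose[OF this \<psi>(1)[unfolded gderiv_def]]
      have "((\<lambda>s. \<psi> (x + s *\<^sub>R T)) has_derivative (\<lambda>h. h * (D\<psi> (x + s *\<^sub>R T) \<bullet> T))) (at s)"
        by (simp add: inner_commute[of T])
      moreover have "(\<lambda>h. h * (D\<psi> (x + s *\<^sub>R T) \<bullet> T)) = (*) (D\<psi> (x + s *\<^sub>R T) \<bullet> T)"
        by (simp add: fun_eq_iff)
      ultimately show "((\<lambda>s. \<psi> (x + s *\<^sub>R T)) has_field_derivative D\<psi> (x + s *\<^sub>R T) \<bullet> T) (at s within UNIV)"
        by (simp only: has_field_derivative_def)
    next
      show "(\<lambda>x. \<psi> (x + s *\<^sub>R T)) integrable_on cbox a b" for s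
        by (intro integrable_continuous continuous_on_compose2[OF c\<psi>] continuous_intros) auto
      show "continuous_on (UNIV \<times> cbox a b) (\<lambda>(s, x). D\<psi> (x + s *\<^sub>R T) \<bullet> T)"
        unfolding case_prod_unfold
        by (intro continuous_intros continuous_on_compose2[OF \<psi>(2)]) auto
    qed auto
    then show ?thesis by simp
  qed
  \<comment> \<open>By the mean value theorem and \<open>I 1 = 0\<close>, the wanted integral
    \<open>I 0\<close> equals \<open>- J s\<close> for a single intermediate position.\<close>
  then obtain s where s: "0 < s" "s < 1" "I 1 - I 0 = (1 - 0) * J s"
    using MVT2[of 0 1 I J] by auto
  have "I 1 = integral (cbox a b) (\<lambda>x. 0)"
    unfolding I_def by (rule integral_cong) (use z in simp)
  then have "integral (cbox a b) \<psi> = - J s" using s(3) by (simp add: I_def)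
  also have "\<dots> \<le> \<bar>J s\<bar>" by simp
  also have "\<dots> \<le> integral (cbox a b) (\<lambda>x. norm (D\<psi> (x + s *\<^sub>R T)) * norm T)"
  proof -
    have "norm (J s) \<le> integral (cbox a b) (\<lambda>x. norm (D\<psi> (x + s *\<^sub>R T)) * norm T)"
      unfolding J_def
    proof (rule integral_norm_bound_integral)
      show "norm (D\<psi> (x + s *\<^sub>R T) \<bullet> T) \<le> norm (D\<psi> (x + s *\<^sub>R T)) * norm T" for x
        using Cauchy_Schwarz_ineq2 by simp
    qed (intro integrable_continuous continuous_intros continuous_on_compose2[OF \<psi>(2)]; auto)+
    then show ?thesis by simp
  qed
  also have "\<dots> = norm T * integral (cbox a b) (\<lambda>x. norm (D\<psi> (x + s *\<^sub>R T)))"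
    by (simp add: mult.commute)
  \<comment> \<open>The displaced box lies in \<open>S\<close>, so enlarging the domain to
    \<open>S\<close> removes the unknown \<open>s\<close>.\<close>
  also have "integral (cbox a b) (\<lambda>x. norm (D\<psi> (x + s *\<^sub>R T))) \<le> integral S (\<lambda>x. norm (D\<psi> x))"
  proof -
    let ?c = "s *\<^sub>R T" and ?n = "\<lambda>x. norm (D\<psi> x)"
    let ?B = "cbox (?c + a) (?c + b)"
    have io: "?n integrable_on ?B"
      by (intro integrable_continuous continuous_on_norm continuous_on_subset[OF \<psi>(2)]) auto
    have "((\<lambda>x. ?n (x + ?c)) has_integral integral ?B ?n) ((\<lambda>x. x - ?c) ` ?B)"
      using has_integral_affinity[OF integrable_integral[OF io], of 1 ?c] by simp
    moreover have "(\<lambda>x. x - ?c) ` ?B = cbox a b"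
      by (simp add: cbox_translation image_image)
    ultimately have "integral (cbox a b) (\<lambda>x. ?n (x + ?c)) = integral ?B ?n"
      by (simp add: integral_unique)
    also have "\<dots> \<le> integral S ?n"
    proof (rule integral_subset_le)
      have "?c + x \<in> S" if "x \<in> cbox a b" for x
        using S[OF that, of s] s(1,2) by (simp add: add.commute[of ?c])
      then show "?B \<subseteq> S" unfolding cbox_translation by blast
    qed (use io i in auto)
    finally show ?thesis .
  qed
  finally show ?thesis by (simp add: mult_left_mono)
qed

text \<open>Let \<psi> be the cutoff of \<phi>. Where \<psi> differs from 1 on the box, |\<phi>| < c
  while |h| \<ge> 2c, so |h - \<phi>| \<ge> c: Chebyshev gives the first term. The integral of
  \<psi> is bounded by sliding the box out of \<open>D\<close>, at the cost of the gradient of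
  \<psi>; this too lives only where |\<phi>| < c, so Chebyshev applies again. If \<phi> approximates
  \<open>h\<close> and then \<open>L\<close> grows, the right side becomes arbitrarily
  small.\<close>

lemma trace_estimate:
  fixes h \<phi> :: "real ^ 'n \<Rightarrow> real" and G :: "real ^ 'n \<Rightarrow> real ^ 'n"
  assumes D: "open D" "D \<in> lmeasurable" and p: "p > 1" and c: "c > 0"
    and h: "continuous_on D h" "integrable (lebesgue_on D) h"
    and G: "Lp_on p D G" and \<phi>: "test_function D \<phi>"
    and S: "open S" "\<And>x. x \<in> S \<inter> D \<Longrightarrow> \<bar>h x\<bar> \<ge> 2 * c"
    and Q: "cbox a b \<subseteq> D \<inter> S" "\<And>x. x \<in> cbox a b \<Longrightarrow> x + T \<notin> D"
      "\<And>x s. x \<in> cbox a b \<Longrightarrow> 0 \<le> s \<Longrightarrow> s \<le> 1 \<Longrightarrow> x + s *\<^sub>R T \<in> S"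
    and L: "L > 0"
  shows "measure lborel (cbox a b) \<le> (1 / c) * integral\<^sup>L (lebesgue_on D) (\<lambda>x. \<bar>h x - \<phi> x\<bar>) +
    norm T * (4 / c) * (integral\<^sup>L (lebesgue_on D) (\<lambda>x. norm (G x - grad UNIV \<phi> x)) +
      (L / c) * integral\<^sup>L (lebesgue_on D) (\<lambda>x. \<bar>h x - \<phi> x\<bar>) +
      L powr (1 - p) * integral\<^sup>L (lebesgue_on D) (\<lambda>x. norm (G x) powr p))"
proof -
  obtain K where K: "compact K" "K \<subseteq> D" "\<And>x. x \<notin> K \<Longrightarrow> \<phi> x = 0" "\<And>x. x \<notin> K \<Longrightarrow> grad UNIV \<phi> x = 0"
    and d\<phi>: "\<And>x. GDERIV \<phi> x :> grad UNIV \<phi> x" "continuous_on UNIV (grad UNIV \<phi>)" "continuous_on UNIV \<phi>"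
    using test_functionE[OF \<phi>] by metis
  have Ds: "D \<in> sets lebesgue" using D(2) by (rule fmeasurableD)
  let ?\<psi> = "\<lambda>x. cutoff c (\<phi> x)" and ?D\<psi> = "\<lambda>x. cutoff_deriv c (\<phi> x) *\<^sub>R grad UNIV \<phi> x"
  have \<psi>: "GDERIV ?\<psi> x :> ?D\<psi> x" for x
    by (rule GDERIV_DERIV_compose[OF d\<phi>(1) DERIV_cutoff[OF c]])
  have cD: "continuous_on UNIV ?D\<psi>"
    by (intro continuous_intros d\<phi> continuous_on_compose2[OF continuous_on_cutoff_deriv[OF c] d\<phi>(3)]) auto
  have c\<psi>: "continuous_on UNIV ?\<psi>"
    by (rule GDERIV_imp_continuous_on[OF \<psi>])
  have iD: "integrable (lebesgue_on D) (\<lambda>x. norm (?D\<psi> x))"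
    by (rule compact_support_integral[OF D K(1,2)])
      (use K in \<open>auto intro!: continuous_on_norm continuous_on_subset[OF cD] simp del: norm_scaleR\<close>)
  have iS: "(\<lambda>x. norm (?D\<psi> x)) integrable_on S"
  proof -
    have "(\<lambda>x. norm (?D\<psi> x)) absolutely_integrable_on UNIV"
      by (intro nonnegative_absolutely_integrable_1 integrable_on_compact_support[OF _ _ compact_imp_bounded[OF K(1)]])
        (use K in \<open>auto intro!: continuous_on_norm cD simp del: norm_scaleR\<close>)
    then have "(\<lambda>x. norm (?D\<psi> x)) absolutely_integrable_on S"
      by (rule set_integrable_subset) (use S(1) in auto)
    then show ?thesis by (rule set_lebesgue_integral_eq_integral(1))
  qed
  have ihp: "integrable (lebesgue_on D) (\<lambda>x. \<bar>h x - \<phi> x\<bar>)"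
    using h(2) integrable_of_Lp[OF D(2) test_function_Lp(1)[OF D(2) \<phi> p] p] by simp
  have iGp: "integrable (lebesgue_on D) (\<lambda>x. norm (G x - grad UNIV \<phi> x))"
    using integrable_of_Lp[OF D(2) Lp_on_diff[OF G test_function_Lp(2)[OF D(2) \<phi> p] p] p] by simp
  have iG: "integrable (lebesgue_on D) (\<lambda>x. norm (G x) powr p)"
    using G by (simp add: Lp_on_def)
  let ?hp = "\<lambda>x. \<bar>h x - \<phi> x\<bar>"
  let ?F = "\<lambda>x. (4 / c) * (norm (G x - grad UNIV \<phi> x) + (L / c) * ?hp x + L powr (1 - p) * norm (G x) powr p)"
  have iF: "integrable (lebesgue_on D) ?F"
    using ihp iGp iG by simp
  have F0: "?F x \<ge> 0" for x
    using c L by (intro mult_nonneg_nonneg add_nonneg_nonneg) auto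
  have small: "c \<le> ?hp x" if "x \<in> S \<inter> D" "\<bar>\<phi> x\<bar> < c" for x
    using S(2)[OF that(1)] that(2) by linarith

  have 1: "measure lborel (cbox a b) = integral (cbox a b) ?\<psi> + integral (cbox a b) (\<lambda>x. 1 - ?\<psi> x)"
  proof -
    have "?\<psi> integrable_on cbox a b"
      by (intro integrable_continuous continuous_on_subset[OF c\<psi>]) auto
    then show ?thesis by (subst integral_diff) auto
  qed
  have 2: "integral (cbox a b) (\<lambda>x. 1 - ?\<psi> x) \<le> (1 / c) * integral\<^sup>L (lebesgue_on D) ?hp"
  proof -
    have "integral (cbox a b) (\<lambda>x. 1 - ?\<psi> x) \<le> integral (cbox a b) (\<lambda>x. (1 / c) * ?hp x)"
    proof (rule integral_le)
      show "(\<lambda>x. 1 - ?\<psi> x) integrable_on cbox a b"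
        by (intro integrable_continuous continuous_intros continuous_on_subset[OF c\<psi>]) auto
      show "(\<lambda>x. (1 / c) * ?hp x) integrable_on cbox a b"
        by (intro integrable_continuous continuous_intros continuous_on_subset[OF h(1)] continuous_on_subset[OF d\<phi>(3)])
          (use Q(1) in auto)
      fix x assume x: "x \<in> cbox a b"
      show "1 - ?\<psi> x \<le> (1 / c) * ?hp x"
      proof (cases "\<bar>\<phi> x\<bar> \<ge> c")
        case True
        then show ?thesis using cutoff_large[OF c True] c by simp
      next
        case False
        moreover have "x \<in> S \<inter> D" using Q(1) x by blast
        ultimately have "c \<le> ?hp x" using small[of x] by simp
        then have "1 \<le> (1 / c) * ?hp x" using c by (simp add: field_simps)
        then show ?thesis using cutoff_nonneg[of c "\<phi> x"] by linarith
      qed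
    qed
    also have "\<dots> = (1 / c) * integral (cbox a b) ?hp" by simp
    also have "integral (cbox a b) ?hp \<le> integral D ?hp"
    proof (rule integral_subset_le)
      show "?hp integrable_on cbox a b"
        by (intro integrable_continuous continuous_intros continuous_on_subset[OF h(1)] continuous_on_subset[OF d\<phi>(3)])
          (use Q(1) in auto)
      show "?hp integrable_on D" by (rule integrable_on_lebesgue_on[OF ihp Ds])
    qed (use Q(1) in auto)
    also have "integral D ?hp = integral\<^sup>L (lebesgue_on D) ?hp"
      using lebesgue_integral_eq_integral[OF ihp Ds] by simp
    finally show ?thesis using c by (simp add: divide_right_mono)
  qed
  have 3: "integral (cbox a b) ?\<psi> \<le> norm T * integral S (\<lambda>x. norm (?D\<psi> x))"
  proof (rule integral_le_sliding[OF \<psi> cD _ Q(3) iS])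
    fix x assume "x \<in> cbox a b"
    then have "x + T \<notin> K" using Q(2) K(2) by blast
    then show "?\<psi> (x + T) = 0" using K(3) by simp
  qed
  have 4: "integral S (\<lambda>x. norm (?D\<psi> x)) \<le> integral\<^sup>L (lebesgue_on D) ?F"
  proof -
    have "integral S (\<lambda>x. norm (?D\<psi> x)) = integral UNIV (\<lambda>x. if x \<in> S then norm (?D\<psi> x) else 0)"
      by (rule integral_restrict_UNIV[symmetric])
    also have "\<dots> \<le> integral UNIV (\<lambda>x. if x \<in> D then ?F x else 0)"
    proof (rule integral_le)
      show "(\<lambda>x. if x \<in> S then norm (?D\<psi> x) else 0) integrable_on UNIV"
        using iS by (simp only: integrable_restrict_UNIV)
      show "(\<lambda>x. if x \<in> D then ?F x else 0) integrable_on UNIV"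
        using integrable_on_lebesgue_on[OF iF Ds] by (simp only: integrable_restrict_UNIV)
      fix x
      show "(if x \<in> S then norm (?D\<psi> x) else 0) \<le> (if x \<in> D then ?F x else 0)"
      proof (cases "x \<in> S \<inter> D \<and> \<bar>\<phi> x\<bar> < c")
        case True
        have "norm (grad UNIV \<phi> x) \<le> norm (G x - grad UNIV \<phi> x) + norm (G x)"
          using norm_triangle_ineq3[of "G x" "grad UNIV \<phi> x"] by linarith
        \<comment> \<open>\<open>G\<close> need not be small, so it is split at height
          \<open>L\<close>: the constant part is absorbed by |h - \<phi>| \<ge> c at this point, the
          rest decays as \<open>L\<close> grows.\<close>
        moreover have "norm (G x) \<le> L + L powr (1 - p) * norm (G x) powr p"
          by (rule le_eps_plus_powr[OF norm_ge_zero L p])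
        moreover have "L \<le> (L / c) * ?hp x"
          using small[of x] True c L by (simp add: field_simps)
        ultimately have "norm (grad UNIV \<phi> x) \<le>
          norm (G x - grad UNIV \<phi> x) + (L / c) * ?hp x + L powr (1 - p) * norm (G x) powr p" by linarith
        then have "\<bar>cutoff_deriv c (\<phi> x)\<bar> * norm (grad UNIV \<phi> x) \<le> ?F x"
          by (intro mult_mono abs_cutoff_deriv_le c) (use c in auto)
        then show ?thesis using True by simp
      next
        case False
        have "?D\<psi> x = 0" if "x \<in> S"
        proof (cases "x \<in> D")
          case True
          then have "\<bar>\<phi> x\<bar> \<ge> c" using False that by auto
          then show ?thesis using cutoff_large[OF c] by simp
        next
          case False
          then show ?thesis using K(2,4) by auto
        qed
        then have "(if x \<in> S then norm (?D\<psi> x) else 0) = 0" by (cases "x \<in> S") (auto simp del: scaleR_eq_0_iff norm_scaleR)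
        moreover have "0 \<le> (if x \<in> D then ?F x else 0)" using F0[of x] by (cases "x \<in> D") (simp_all only: if_True if_False order_refl)
        ultimately show ?thesis by (simp only:)
      qed
    qed
    also have "\<dots> = integral D ?F" by (rule integral_restrict_UNIV)
    also have "\<dots> = integral\<^sup>L (lebesgue_on D) ?F"
      by (rule lebesgue_integral_eq_integral[OF iF Ds, symmetric])
    finally show ?thesis .
  qed
  have "integral\<^sup>L (lebesgue_on D) ?F = (4 / c) * (integral\<^sup>L (lebesgue_on D) (\<lambda>x. norm (G x - grad UNIV \<phi> x)) +
      (L / c) * integral\<^sup>L (lebesgue_on D) ?hp + L powr (1 - p) * integral\<^sup>L (lebesgue_on D) (\<lambda>x. norm (G x) powr p))"
    using ihp iGp iG by simp
  then have "norm T * integral S (\<lambda>x. norm (?D\<psi> x)) \<le> norm T * (4 / c) *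
    (integral\<^sup>L (lebesgue_on D) (\<lambda>x. norm (G x - grad UNIV \<phi> x)) +
      (L / c) * integral\<^sup>L (lebesgue_on D) ?hp + L powr (1 - p) * integral\<^sup>L (lebesgue_on D) (\<lambda>x. norm (G x) powr p))"
    using mult_left_mono[OF 4 norm_ge_zero[of T]] by (simp only: mult.assoc)
  with 1 2 3 show ?thesis by linarith
qed

text \<open>If \<open>h x0\<close> were not 0, \<open>trace_estimate\<close> would bound the
  positive volume of one fixed box by quantities that vanish in the limit along the approximating
  test functions, followed by \<open>L\<close> to infinity.\<close>

lemma W1p_zero_trace:
  fixes h :: "real ^ 'n \<Rightarrow> real"
  assumes \<Omega>: "compact \<Omega>" and p: "p > 1" and W: "W1p_zero p (interior \<Omega>) h"
    and h: "continuous_on \<Omega> h" and x0: "x0 \<in> closure (interior \<Omega>)" "x0 \<in> frontier \<Omega>"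
  shows "h x0 = 0"
proof (rule ccontr)
  assume "h x0 \<noteq> 0"
  \<comment> \<open>By continuity |h| stays above half of |h x0|, that is above 2c, near
    \<open>x0\<close> inside the domain.\<close>
  define c where "c = \<bar>h x0\<bar> / 4"
  have c: "c > 0" using \<open>h x0 \<noteq> 0\<close> by (simp add: c_def)
  let ?D = "interior \<Omega>"
  have D: "open ?D" "?D \<in> lmeasurable"
    using \<Omega> bounded_subset[OF compact_imp_bounded[OF \<Omega>] interior_subset] by (auto intro: lmeasurable_open)
  obtain G \<phi> where G: "W1p_with_gradient p ?D h G" and \<phi>: "\<And>k::nat. test_function ?D (\<phi> k)"
    and l1: "(\<lambda>k. integral\<^sup>L (lebesgue_on ?D) (\<lambda>x. \<bar>h x - \<phi> k x\<bar> powr p)) \<longlonglongrightarrow> 0"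
    and l2: "(\<lambda>k. integral\<^sup>L (lebesgue_on ?D) (\<lambda>x. norm (G x - grad UNIV (\<phi> k) x) powr p)) \<longlonglongrightarrow> 0"
    using W unfolding W1p_zero_def by blast
  have Lh: "Lp_on p ?D h" and LG: "Lp_on p ?D G" using G by (auto simp: W1p_with_gradient_def)
  have m1: "(\<lambda>k. integral\<^sup>L (lebesgue_on ?D) (\<lambda>x. \<bar>h x - \<phi> k x\<bar>)) \<longlonglongrightarrow> 0"
    using L1_tendsto_of_Lp_tendsto[OF D(2) Lp_on_diff[OF Lh test_function_Lp(1)[OF D(2) \<phi> p] p] p] l1
    by simp
  have m2: "(\<lambda>k. integral\<^sup>L (lebesgue_on ?D) (\<lambda>x. norm (G x - grad UNIV (\<phi> k) x))) \<longlonglongrightarrow> 0"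
    by (rule L1_tendsto_of_Lp_tendsto[OF D(2) Lp_on_diff[OF LG test_function_Lp(2)[OF D(2) \<phi> p] p] p l2])
  have "x0 \<in> \<Omega>" using x0(1) \<Omega> by (meson closure_minimal compact_imp_closed interior_subset subsetD)
  then obtain r where r: "r > 0" "\<And>x. x \<in> \<Omega> \<Longrightarrow> dist x x0 < r \<Longrightarrow> dist (h x) (h x0) < \<bar>h x0\<bar> / 2"
    using h \<open>h x0 \<noteq> 0\<close> unfolding continuous_on_iff by (metis half_gt_zero zero_less_abs_iff)
  let ?S = "ball x0 r"
  have S: "\<bar>h x\<bar> \<ge> 2 * c" if "x \<in> ?S \<inter> ?D" for x
  proof -
    have "x \<in> \<Omega>" "dist x x0 < r" using that interior_subset[of \<Omega>] by (auto simp: dist_commute)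
    then have "\<bar>h x - h x0\<bar> < \<bar>h x0\<bar> / 2" using r(2)[of x] by (simp only: dist_real_def)
    then show ?thesis unfolding c_def by linarith
  qed
  have o2: "open (- \<Omega>)" using \<Omega> by (simp add: compact_imp_closed open_Compl)
  obtain z1 where z1: "z1 \<in> ?D" "dist z1 x0 < r"
    using x0(1) r(1) unfolding closure_approachable by blast
  have "x0 \<in> closure (- \<Omega>)" using x0(2) by (simp add: frontier_closures)
  then obtain z2 where z2: "z2 \<in> - \<Omega>" "dist z2 x0 < r"
    using r(1) unfolding closure_approachable by blast
  have z: "z1 \<in> ?D" "z1 \<in> ?S" "z2 \<in> - \<Omega>" "z2 \<in> ?S"
    using z1 z2 by (auto simp: dist_commute)
  \<comment> \<open>\<open>z1\<close> is interior and \<open>z2\<close> outside, both in one ball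
    around \<open>x0\<close>. The shift carries a whole box around \<open>z1\<close> off \<Omega>,
    and convexity of the ball keeps the path in it.\<close>
  define T where "T = z2 - z1"
  let ?U = "(?D \<inter> ?S) \<inter> (\<lambda>x. x + T) -` (- \<Omega> \<inter> ?S)"
  have "open ((\<lambda>x. x + T) -` (- \<Omega> \<inter> ?S))"
    using o2 by (intro open_vimage) (auto intro!: continuous_intros)
  then have "open ?U" using D by auto
  moreover have "z1 \<in> ?U" using z by (auto simp: T_def)
  ultimately obtain a b where Q: "cbox a b \<subseteq> ?U" "\<forall>i\<in>Basis. a \<bullet> i < b \<bullet> i"
    by (rule open_contains_cbox)
  have pos: "measure lborel (cbox a b) > 0" using Q(2) by (simp only: content_pos_lt_eq)
  have QS: "x + s *\<^sub>R T \<in> ?S" if "x \<in> cbox a b" "0 \<le> s" "s \<le> 1" for x s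
  proof -
    have "x \<in> ?S" "x + T \<in> ?S" using that(1) Q(1) by auto
    then have "(1 - s) *\<^sub>R x + s *\<^sub>R (x + T) \<in> ?S"
      using that(2,3) by (intro convexD[OF convex_ball]) auto
    then show ?thesis by (simp add: algebra_simps)
  qed
  let ?N = "integral\<^sup>L (lebesgue_on ?D) (\<lambda>x. norm (G x) powr p)"
  have "measure lborel (cbox a b) \<le> norm T * (4 / c) * (L powr (1 - p) * ?N)" if L: "L > 0" for L
  proof (rule tendsto_lowerbound)
    let ?R = "\<lambda>k. (1 / c) * integral\<^sup>L (lebesgue_on ?D) (\<lambda>x. \<bar>h x - \<phi> k x\<bar>) +
      norm T * (4 / c) * (integral\<^sup>L (lebesgue_on ?D) (\<lambda>x. norm (G x - grad UNIV (\<phi> k) x)) +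
        (L / c) * integral\<^sup>L (lebesgue_on ?D) (\<lambda>x. \<bar>h x - \<phi> k x\<bar>) + L powr (1 - p) * ?N)"
    have "?R \<longlonglongrightarrow> (1 / c) * 0 + norm T * (4 / c) * (0 + (L / c) * 0 + L powr (1 - p) * ?N)"
      by (intro tendsto_add tendsto_mult tendsto_const m1 m2)
    then show "?R \<longlonglongrightarrow> norm T * (4 / c) * (L powr (1 - p) * ?N)" by simp
    have "measure lborel (cbox a b) \<le> ?R k" for k
    proof (rule trace_estimate[OF D p c _ _ LG \<phi> open_ball S _ _ QS L])
      show "continuous_on ?D h" using h interior_subset continuous_on_subset by blast
      show "integrable (lebesgue_on ?D) h" by (rule integrable_of_Lp[OF D(2) Lh p])
      show "cbox a b \<subseteq> ?D \<inter> ?S" using Q(1) by blast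
      show "x + T \<notin> ?D" if "x \<in> cbox a b" for x using Q(1) that interior_subset by blast
    qed
    then show "eventually (\<lambda>k. measure lborel (cbox a b) \<le> ?R k) sequentially" by simp
  qed simp
  \<comment> \<open>Here \<open>p > 1\<close> is essential: the exponent 1 - p is negative.\<close>
  moreover have "((\<lambda>L. norm T * (4 / c) * (L powr (1 - p) * ?N)) \<longlongrightarrow> norm T * (4 / c) * (0 * ?N)) at_top"
    using p by (intro tendsto_mult tendsto_const tendsto_neg_powr filterlim_ident) auto
  then have "eventually (\<lambda>L. norm T * (4 / c) * (L powr (1 - p) * ?N) < measure lborel (cbox a b)) at_top"
    using pos by (intro order_tendstoD(2)) auto
  then have "eventually (\<lambda>L. norm T * (4 / c) * (L powr (1 - p) * ?N) < measure lborel (cbox a b) \<and> L > 0) at_top"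
    by (intro eventually_conj eventually_gt_at_top)
  then obtain L where "norm T * (4 / c) * (L powr (1 - p) * ?N) < measure lborel (cbox a b)" "L > 0"
    using eventually_happens'[OF trivial_limit_at_top_linorder] by blast
  ultimately show False by (meson not_less)
qed

section \<open>Uniqueness\<close>

text \<open>With t = |a|, s = a \<bullet> \<zeta> and q = t^(p-2), the product equals (q t - 1)(t -
  1) + (q + 1)(t - s). The first term is nonnegative because t^(p-1) increases, the second by
  Cauchy-Schwarz; both vanish only for t = s = 1. At a = 0 the convention 0 powr x = 0 gives q t =
  0, in line with this.\<close>

lemma p_laplace_strictly_monotone:
  fixes a \<zeta> :: "'a::real_inner" and p :: real
  assumes "norm \<zeta> = 1" "p > 1"
  shows "(norm a powr (p - 2) *\<^sub>R a - \<zeta>) \<bullet> (a - \<zeta>) \<ge> 0"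
    and "(norm a powr (p - 2) *\<^sub>R a - \<zeta>) \<bullet> (a - \<zeta>) = 0 \<Longrightarrow> a = \<zeta>"
proof -
  define t where "t = norm a"
  define q where "q = t powr (p - 2)"
  define s where "s = a \<bullet> \<zeta>"
  have zz: "\<zeta> \<bullet> \<zeta> = 1" using assms(1) by (simp add: dot_square_norm)
  have aa: "a \<bullet> a = t * t" by (simp add: t_def dot_square_norm power2_eq_square)
  have st: "s \<le> t" using norm_cauchy_schwarz[of a \<zeta>] assms(1) by (simp add: s_def t_def)
  have q0: "q \<ge> 0" by (simp add: q_def)
  have E: "(norm a powr (p - 2) *\<^sub>R a - \<zeta>) \<bullet> (a - \<zeta>) = (q * t - 1) * (t - 1) + (q + 1) * (t - s)"
    unfolding t_def[symmetric] q_def[symmetric]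
    by (simp add: inner_diff_left inner_diff_right zz aa inner_commute[of \<zeta> a] flip: s_def)
      (simp add: algebra_simps)
  have qt: "q * t = t powr (p - 1)" if "t > 0"
  proof -
    have "t powr (p - 2) * t powr 1 = t powr (p - 2 + 1)" by (simp only: powr_add)
    then show ?thesis using that by (simp add: q_def)
  qed
  have t0: "t \<ge> 0" by (simp add: t_def)
  have 1: "(q * t - 1) * (t - 1) \<ge> 0" and 2: "(q * t - 1) * (t - 1) = 0 \<Longrightarrow> t = 1"
  proof -
    consider "t = 0" | "0 < t" "t < 1" | "t = 1" | "t > 1" using t0 by linarith
    then have "(q * t - 1) * (t - 1) \<ge> 0 \<and> ((q * t - 1) * (t - 1) = 0 \<longrightarrow> t = 1)"
    proof cases
      case 2
      have "t powr (p - 1) < 1 powr (p - 1)" using 2 assms(2) by (intro powr_less_mono2) auto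
      then have "q * t < 1" using qt[OF 2(1)] by simp
      then have "(q * t - 1) * (t - 1) > 0" using 2 by (intro mult_neg_neg) auto
      then show ?thesis by linarith
    next
      case 4
      have "1 powr (p - 1) < t powr (p - 1)" using 4 assms(2) by (intro powr_less_mono2) auto
      then have "q * t > 1" using qt 4 by simp
      then have "(q * t - 1) * (t - 1) > 0" using 4 by (intro mult_pos_pos) auto
      then show ?thesis by linarith
    qed auto
    then show "(q * t - 1) * (t - 1) \<ge> 0" "(q * t - 1) * (t - 1) = 0 \<Longrightarrow> t = 1" by auto
  qed
  have 3: "(q + 1) * (t - s) \<ge> 0" using st q0 by simp
  show "(norm a powr (p - 2) *\<^sub>R a - \<zeta>) \<bullet> (a - \<zeta>) \<ge> 0" unfolding E using 1 3 by linarith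
  assume "(norm a powr (p - 2) *\<^sub>R a - \<zeta>) \<bullet> (a - \<zeta>) = 0"
  then have "(q * t - 1) * (t - 1) = 0" "(q + 1) * (t - s) = 0" unfolding E using 1 3 by linarith+
  then have "t = 1" "s = t" using 2 q0 by auto
  then have "(a - \<zeta>) \<bullet> (a - \<zeta>) = 0"
    using aa zz by (simp add: inner_diff_left inner_diff_right inner_commute[of \<zeta> a] flip: s_def)
  then show "a = \<zeta>" by simp
qed

text \<open>An odd nondecreasing C^1 function whose zero set is the interval from -\<epsilon> to
  \<epsilon>. Composed with a function vanishing on the frontier it acquires compact support in the
  interior.\<close>

definition ramp :: "real \<Rightarrow> real \<Rightarrow> real" where
  "ramp \<epsilon> s = (max 0 (s - \<epsilon>))\<^sup>2 - (max 0 (- s - \<epsilon>))\<^sup>2"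

definition ramp_deriv :: "real \<Rightarrow> real \<Rightarrow> real" where
  "ramp_deriv \<epsilon> s = 2 * max 0 (s - \<epsilon>) + 2 * max 0 (- s - \<epsilon>)"

lemma DERIV_ramp: "DERIV (ramp \<epsilon>) s :> ramp_deriv \<epsilon> s"
proof -
  have "DERIV (\<lambda>s. s - \<epsilon>) s :> 1" "DERIV (\<lambda>s. - s - \<epsilon>) s :> - 1"
    by (auto intro!: derivative_eq_intros)
  from DERIV_diff[OF DERIV_chain'[OF this(1) DERIV_max_square] DERIV_chain'[OF this(2) DERIV_max_square]]
  show ?thesis by (simp add: ramp_def[abs_def] ramp_deriv_def)
qed

lemma ramp_deriv_nonneg: "ramp_deriv \<epsilon> s \<ge> 0"
  by (simp add: ramp_deriv_def)

lemma ramp_small: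
  assumes "\<bar>s\<bar> \<le> \<epsilon>"
  shows "ramp \<epsilon> s = 0" "ramp_deriv \<epsilon> s = 0"
proof -
  have "max 0 (s - \<epsilon>) = 0" "max 0 (- s - \<epsilon>) = 0" using assms by auto
  then show "ramp \<epsilon> s = 0" "ramp_deriv \<epsilon> s = 0" by (simp_all add: ramp_def ramp_deriv_def)
qed

lemma ramp_eq_0D:
  assumes "ramp \<epsilon> s = 0" "\<epsilon> > 0"
  shows "\<bar>s\<bar> \<le> \<epsilon>"
proof (rule ccontr)
  assume "\<not> \<bar>s\<bar> \<le> \<epsilon>"
  then consider "s > \<epsilon>" | "- s > \<epsilon>" by linarith
  then show False
    by cases (use assms in \<open>auto simp: ramp_def max_def\<close>)
qed

lemma continuous_on_grad_holder:
  assumes "C1_holder_on b S u" "b > 0"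
  shows "continuous_on S (grad S u)"
proof -
  obtain C where C: "\<And>x y. x \<in> S \<Longrightarrow> y \<in> S \<Longrightarrow> norm (grad S u x - grad S u y) \<le> C * dist x y powr b"
    using assms(1) unfolding C1_holder_on_def by blast
  show ?thesis
    unfolding continuous_on_def
  proof
    fix x assume x: "x \<in> S"
    have "((\<lambda>y. grad S u y - grad S u x) \<longlongrightarrow> 0) (at x within S)"
    proof (rule Lim_null_comparison)
      show "eventually (\<lambda>y. norm (grad S u y - grad S u x) \<le> C * dist y x powr b) (at x within S)"
        using C x by (auto simp: eventually_at_filter)
      have "((\<lambda>y. dist y x) \<longlongrightarrow> 0) (at x within S)"
        by (auto intro!: tendsto_eq_intros)
      then have "((\<lambda>y. dist y x powr b) \<longlongrightarrow> 0 powr b) (at x within S)"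
        using assms(2) by (intro tendsto_powr2 tendsto_const) auto
      then have "((\<lambda>y. C * dist y x powr b) \<longlongrightarrow> C * 0) (at x within S)"
        using assms(2) by (intro tendsto_mult tendsto_const) simp
      then show "((\<lambda>y. C * dist y x powr b) \<longlongrightarrow> 0) (at x within S)" by simp
    qed
    then show "(grad S u \<longlongrightarrow> grad S u x) (at x within S)" by (simp add: LIM_zero_iff)
  qed
qed

text \<open>Both gradients satisfy the same integration by parts against test functions; the
  fundamental lemma applies to each component of the difference.\<close>

lemma weak_gradient_eq_grad:
  fixes u :: "real ^ 'n \<Rightarrow> real"
  assumes D: "open D" "bounded D" and p: "p > 1" and W: "W1p_with_gradient p D u G"
    and u: "\<And>x. x \<in> D \<Longrightarrow> GDERIV u x :> g x" "continuous_on D g" "\<And>x. x \<in> D \<Longrightarrow> norm (g x) \<le> B"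
  shows "AE x in lebesgue_on D. G x = g x"
proof -
  have Dm: "D \<in> lmeasurable" using D lmeasurable_open by blast
  have Ds: "D \<in> sets lebesgue" using Dm by (rule fmeasurableD)
  have mg: "g \<in> borel_measurable (lebesgue_on D)"
    by (rule continuous_imp_measurable_on_sets_lebesgue[OF u(2) Ds])
  have Gi: "integrable (lebesgue_on D) G"
    using W integrable_of_Lp[OF Dm _ p] by (auto simp: W1p_with_gradient_def)
  have gi: "integrable (lebesgue_on D) g"
    by (rule integrable_bounded_on[OF Dm mg u(3)])
  have "AE x in lebesgue_on D. (G x - g x) \<bullet> axis i 1 = 0" for i
  proof (rule fundamental_lemma[OF D])
    show "integrable (lebesgue_on D) (\<lambda>x. (G x - g x) \<bullet> axis i 1)"
      using Gi gi by simp
    fix \<phi> assume \<phi>: "test_function D \<phi>"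
    have L: "Lp_on p D \<phi>" using test_function_Lp[OF Dm \<phi> p] by simp
    obtain K where K: "compact K" "\<And>x. x \<notin> K \<Longrightarrow> \<phi> x = 0" "continuous_on UNIV \<phi>"
      using test_functionE[OF \<phi>] by metis
    have "bounded (\<phi> ` K)"
      using K by (intro compact_imp_bounded compact_continuous_image) (auto intro: continuous_on_subset)
    then obtain B where B: "\<And>x. x \<in> K \<Longrightarrow> \<bar>\<phi> x\<bar> \<le> B" unfolding bounded_iff by auto
    have B': "\<bar>\<phi> x\<bar> \<le> max B 0" for x
      using K(2)[of x] B by (cases "x \<in> K") (auto simp: le_max_iff_disj)
    have i: "integrable (lebesgue_on D) (\<lambda>x. (H x \<bullet> axis i 1) * \<phi> x)" if "integrable (lebesgue_on D) H" for H :: "real ^ 'n \<Rightarrow> real ^ 'n"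
      by (rule integrable_mult_bounded[OF _ _ B']) (use that L in \<open>auto simp: Lp_on_def\<close>)
    have "integral\<^sup>L (lebesgue_on D) (\<lambda>x. u x * grad UNIV \<phi> x $ i) = - integral\<^sup>L (lebesgue_on D) (\<lambda>x. G x $ i * \<phi> x)"
      using W \<phi> by (auto simp: W1p_with_gradient_def weak_gradient_def)
    moreover have "integral\<^sup>L (lebesgue_on D) (\<lambda>x. u x * (grad UNIV \<phi> x \<bullet> axis i 1)) =
        - integral\<^sup>L (lebesgue_on D) (\<lambda>x. (g x \<bullet> axis i 1) * \<phi> x)"
      by (rule integral_by_parts_test[OF D(1) Dm u(1,2) \<phi>])
    ultimately have "integral\<^sup>L (lebesgue_on D) (\<lambda>x. (G x \<bullet> axis i 1) * \<phi> x) =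
        integral\<^sup>L (lebesgue_on D) (\<lambda>x. (g x \<bullet> axis i 1) * \<phi> x)"
      by (simp add: inner_axis)
    then show "integral\<^sup>L (lebesgue_on D) (\<lambda>x. (G x - g x) \<bullet> axis i 1 * \<phi> x) = 0"
      using i[OF Gi] i[OF gi] by (simp add: inner_diff_left left_diff_distrib)
  qed
  then have "AE x in lebesgue_on D. \<forall>i\<in>UNIV. (G x - g x) \<bullet> axis i 1 = 0"
    by (intro AE_finite_allI) auto
  then show ?thesis
    by (rule AE_mp) (intro AE_I2, auto simp: inner_axis vec_eq_iff)
qed

text \<open>The set where \<open>f\<close> is nonzero is open and negligible, hence empty.\<close>

lemma continuous_AE_zero_imp_zero:
  fixes f :: "'a::euclidean_space \<Rightarrow> 'b::real_normed_vector"
  assumes "continuous_on UNIV f" "AE x in lebesgue. f x = 0"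
  shows "f x = 0"
proof -
  have o: "open (f -` (- {0}))"
    using assms(1) by (intro open_vimage) auto
  moreover have "negligible (f -` (- {0}))"
  proof -
    have "f -` (- {0}) \<in> sets lebesgue"
      using o by (intro sets_completionI_sets) simp
    moreover have "AE x in lebesgue. x \<notin> f -` (- {0})" using assms(2) by simp
    ultimately show ?thesis by (simp add: negligible_iff_null_sets AE_iff_null_sets)
  qed
  ultimately have "f -` (- {0}) = {}" using open_not_negligible by blast
  then show ?thesis by auto
qed

text \<open>Testing with truncations of \<open>u - \<zeta> \<bullet> x\<close>, which have compact support in the interior, avoids
  any discussion of the set where \<open>u = \<zeta> \<bullet> x\<close>.\<close>

lemma affine_solution_unique:
  fixes \<Omega> :: "(real ^ 'n) set" and u :: "real ^ 'n \<Rightarrow> real"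
  assumes \<Omega>: "compact \<Omega>" "\<Omega> \<subseteq> closure (interior \<Omega>)" and p: "p > 1" and \<zeta>: "norm \<zeta> = 1"
    and \<gamma>: "continuous_on \<Omega> \<gamma>" "\<And>x. x \<in> \<Omega> \<Longrightarrow> \<gamma> x > 0"
    and eq: "\<And>\<phi>. test_function (interior \<Omega>) \<phi> \<Longrightarrow>
      integral\<^sup>L (lebesgue_on (interior \<Omega>)) (\<lambda>x. \<gamma> x * (\<zeta> \<bullet> grad UNIV \<phi> x)) = 0"
    and ws: "weak_solution p \<Omega> \<gamma> f u" and f: "\<And>x. x \<in> frontier \<Omega> \<Longrightarrow> f x = \<zeta> \<bullet> x"
    and u: "C1_holder_on b \<Omega> u" "b > 0" and x: "x \<in> \<Omega>"
  shows "u x = \<zeta> \<bullet> x"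
proof -
  let ?D = "interior \<Omega>"
  have D: "open ?D" "bounded ?D"
    using bounded_subset[OF compact_imp_bounded[OF \<Omega>(1)] interior_subset] by auto
  have Dm: "?D \<in> lmeasurable" using D lmeasurable_open by blast
  have Ds: "?D \<in> sets lebesgue" using Dm by (rule fmeasurableD)
  have sub: "?D \<subseteq> \<Omega>" by (rule interior_subset)
  define g where "g = grad \<Omega> u"
  have du: "u differentiable_on \<Omega>" using u by (simp add: C1_holder_on_def)
  have cu: "continuous_on \<Omega> u" using du by (rule differentiable_imp_continuous_on)
  have cg: "continuous_on \<Omega> g" unfolding g_def by (rule continuous_on_grad_holder[OF u])
  have Gu: "GDERIV u x :> g x" if "x \<in> ?D" for x
    unfolding g_def using du that sub by (intro GDERIV_grad) (auto simp: differentiable_on_def)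
  have bdd: "\<exists>B. \<forall>x\<in>\<Omega>. norm (h x) \<le> B" if "continuous_on \<Omega> h" for h :: "real ^ 'n \<Rightarrow> 'c::real_normed_vector"
    using compact_imp_bounded[OF compact_continuous_image[OF that \<Omega>(1)]] unfolding bounded_iff by auto
  obtain B where B: "\<And>x. x \<in> \<Omega> \<Longrightarrow> norm (g x) \<le> B" using bdd[OF cg] by blast
  obtain B' where B': "\<And>x. x \<in> \<Omega> \<Longrightarrow> norm (\<gamma> x) \<le> B'" using bdd[OF \<gamma>(1)] by blast
  have mg: "g \<in> borel_measurable (lebesgue_on ?D)"
    by (rule continuous_imp_measurable_on_sets_lebesgue[OF continuous_on_subset[OF cg sub] Ds])
  have m\<gamma>: "\<gamma> \<in> borel_measurable (lebesgue_on ?D)"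
    by (rule continuous_imp_measurable_on_sets_lebesgue[OF continuous_on_subset[OF \<gamma>(1) sub] Ds])

  obtain F where F: "continuous_on \<Omega> F" "\<And>x. x \<in> frontier \<Omega> \<Longrightarrow> F x = f x"
      "W1p_zero p ?D (\<lambda>x. u x - F x)"
    using ws unfolding weak_solution_def by blast
  \<comment> \<open>The boundary condition holds modulo \<open>W1p_zero\<close>; since
    \<open>u\<close> and \<open>F\<close> are continuous on \<Omega>, the trace lemma makes it
    pointwise.\<close>
  have bd: "u x = \<zeta> \<bullet> x" if "x \<in> frontier \<Omega>" for x
  proof -
    have "x \<in> \<Omega>" using that \<Omega>(1) by (meson compact_imp_closed frontier_subset_closed subsetD)
    then have "u x - F x = 0"
      using W1p_zero_trace[OF \<Omega>(1) p F(3) _ _ that] cu F(1) \<Omega>(2) by (auto intro: continuous_on_diff)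
    then show ?thesis using F(2)[OF that] f[OF that] by simp
  qed

  \<comment> \<open>The difference of the fluxes of \<open>u\<close> and of the linear function;
    testing it subtracts the two weak equations.\<close>
  define A where "A x = \<gamma> x *\<^sub>R (norm (g x) powr (p - 2) *\<^sub>R g x - \<zeta>)" for x
  have mA: "A \<in> borel_measurable (lebesgue_on ?D)"
    unfolding A_def using mg m\<gamma> by measurable
  \<comment> \<open>For p < 2 the factor |g|^(p-2) alone may blow up near zeros of \<open>g\<close>;
    only its product with \<open>g\<close> is bounded.\<close>
  have pw: "norm (norm (g x) powr (p - 2) *\<^sub>R g x) \<le> B powr (p - 1)" if "x \<in> \<Omega>" for x
  proof -
    have "norm (norm (g x) powr (p - 2) *\<^sub>R g x) = norm (g x) powr (p - 2) * norm (g x)" by simp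
    also have "\<dots> = norm (g x) powr (p - 1)"
    proof (cases "g x = 0")
      case False
      have "norm (g x) powr (p - 2) * norm (g x) powr 1 = norm (g x) powr (p - 2 + 1)" by (simp only: powr_add)
      then show ?thesis by simp
    qed simp
    also have "\<dots> \<le> B powr (p - 1)" using B[OF that] p by (intro powr_mono2) auto
    finally show ?thesis .
  qed
  have bA: "norm (A x) \<le> B' * (B powr (p - 1) + 1)" if "x \<in> ?D" for x
  proof -
    have x: "x \<in> \<Omega>" using that sub by blast
    have "norm (norm (g x) powr (p - 2) *\<^sub>R g x - \<zeta>) \<le> B powr (p - 1) + 1"
      using norm_triangle_ineq4[of "norm (g x) powr (p - 2) *\<^sub>R g x" \<zeta>] pw[OF x] \<zeta> by linarith
    then have "\<bar>\<gamma> x\<bar> * norm (norm (g x) powr (p - 2) *\<^sub>R g x - \<zeta>) \<le> B' * (B powr (p - 1) + 1)"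
      using B'[OF x] by (intro mult_mono) auto
    then show ?thesis by (simp add: A_def)
  qed
  have iA: "integrable (lebesgue_on ?D) A" by (rule integrable_bounded_on[OF Dm mA bA])
  have iAV: "integrable (lebesgue_on ?D) (\<lambda>x. A x \<bullet> V x)"
    if V: "continuous_on UNIV V" "\<And>x. x \<notin> K \<Longrightarrow> V x = 0" "compact K" for V K
  proof -
    have "bounded (V ` K)"
      using that by (intro compact_imp_bounded compact_continuous_image) (auto intro: continuous_on_subset)
    then obtain C where C: "\<And>x. x \<in> K \<Longrightarrow> norm (V x) \<le> C" unfolding bounded_iff by auto
    have C': "norm (V x) \<le> max C 0" for x
      using V(2)[of x] C by (cases "x \<in> K") (auto simp: le_max_iff_disj)
    have mV: "V \<in> borel_measurable (lebesgue_on ?D)"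
      by (rule continuous_imp_measurable_on_sets_lebesgue[OF continuous_on_subset[OF V(1)] Ds]) simp
    show ?thesis
    proof (rule Bochner_Integration.integrable_bound)
      show "integrable (lebesgue_on ?D) (\<lambda>x. max C 0 * norm (A x))" using iA by simp
      show "AE x in lebesgue_on ?D. norm (A x \<bullet> V x) \<le> norm (max C 0 * norm (A x))"
      proof (rule AE_I2)
        fix x
        have "norm (A x \<bullet> V x) \<le> norm (A x) * norm (V x)" using Cauchy_Schwarz_ineq2 by simp
        also have "\<dots> \<le> norm (A x) * max C 0" using C' by (intro mult_left_mono) auto
        finally show "norm (A x \<bullet> V x) \<le> norm (max C 0 * norm (A x))" by (simp add: mult.commute)
      qed
    qed (use mA mV in measurable)
  qed

  have testA: "integral\<^sup>L (lebesgue_on ?D) (\<lambda>x. A x \<bullet> grad UNIV \<phi> x) = 0" if \<phi>: "test_function ?D \<phi>" for \<phi>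
  proof -
    obtain K where K: "compact K" "\<And>x. x \<notin> K \<Longrightarrow> grad UNIV \<phi> x = 0" "continuous_on UNIV (grad UNIV \<phi>)"
      using test_functionE[OF \<phi>] by metis
    have m\<phi>: "grad UNIV \<phi> \<in> borel_measurable (lebesgue_on ?D)"
      by (rule continuous_imp_measurable_on_sets_lebesgue[OF continuous_on_subset[OF K(3)] Ds]) simp
    obtain G where G: "W1p_with_gradient p ?D u G"
      "integral\<^sup>L (lebesgue_on ?D) (\<lambda>x. \<gamma> x * norm (G x) powr (p - 2) * (G x \<bullet> grad UNIV \<phi> x)) = 0"
      using ws \<phi> unfolding weak_solution_def by blast
    have mG: "G \<in> borel_measurable (lebesgue_on ?D)" using G(1) by (simp add: W1p_with_gradient_def Lp_on_def)
    have ae: "AE x in lebesgue_on ?D. G x = g x"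
      by (rule weak_gradient_eq_grad[OF D p G(1) Gu continuous_on_subset[OF cg sub] B]) (use sub in auto)
    have "integral\<^sup>L (lebesgue_on ?D) (\<lambda>x. \<gamma> x * norm (g x) powr (p - 2) * (g x \<bullet> grad UNIV \<phi> x)) =
        integral\<^sup>L (lebesgue_on ?D) (\<lambda>x. \<gamma> x * norm (G x) powr (p - 2) * (G x \<bullet> grad UNIV \<phi> x))"
    proof (rule integral_cong_AE)
      show "AE x in lebesgue_on ?D. \<gamma> x * norm (g x) powr (p - 2) * (g x \<bullet> grad UNIV \<phi> x) =
          \<gamma> x * norm (G x) powr (p - 2) * (G x \<bullet> grad UNIV \<phi> x)"
        using ae by eventually_elim simp
    qed (use mg mG m\<gamma> m\<phi> in measurable)
    then have z: "integral\<^sup>L (lebesgue_on ?D) (\<lambda>x. \<gamma> x * norm (g x) powr (p - 2) * (g x \<bullet> grad UNIV \<phi> x)) = 0"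
      using G(2) by simp
    obtain C where C: "\<And>x. norm (grad UNIV \<phi> x) \<le> C"
    proof -
      have "bounded (grad UNIV \<phi> ` K)"
        using K by (intro compact_imp_bounded compact_continuous_image) (auto intro: continuous_on_subset)
      then obtain C where "\<And>x. x \<in> K \<Longrightarrow> norm (grad UNIV \<phi> x) \<le> C" unfolding bounded_iff by auto
      then have "norm (grad UNIV \<phi> x) \<le> max C 0" for x
        using K(2)[of x] by (cases "x \<in> K") (auto simp: le_max_iff_disj)
      then show ?thesis using that by blast
    qed
    have i1: "integrable (lebesgue_on ?D) (\<lambda>x. A x \<bullet> grad UNIV \<phi> x)"
      by (rule iAV[OF K(3) _ K(1)]) (rule K(2))
    have i2: "integrable (lebesgue_on ?D) (\<lambda>x. \<gamma> x * (\<zeta> \<bullet> grad UNIV \<phi> x))"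
    proof (rule integrable_bounded_on[OF Dm])
      show "norm (\<gamma> x * (\<zeta> \<bullet> grad UNIV \<phi> x)) \<le> B' * C" if "x \<in> ?D" for x
      proof -
        have "\<bar>\<zeta> \<bullet> grad UNIV \<phi> x\<bar> \<le> C" using Cauchy_Schwarz_ineq2[of \<zeta> "grad UNIV \<phi> x"] C[of x] \<zeta> by simp
        moreover have "\<bar>\<gamma> x\<bar> \<le> B'" using B'[of x] that sub by auto
        ultimately show ?thesis unfolding real_norm_def abs_mult by (intro mult_mono) auto
      qed
    qed (use m\<gamma> m\<phi> in measurable)
    have sp: "A x \<bullet> grad UNIV \<phi> x + \<gamma> x * (\<zeta> \<bullet> grad UNIV \<phi> x) = \<gamma> x * norm (g x) powr (p - 2) * (g x \<bullet> grad UNIV \<phi> x)" for x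
      by (simp add: A_def inner_diff_left algebra_simps)
    have "integral\<^sup>L (lebesgue_on ?D) (\<lambda>x. A x \<bullet> grad UNIV \<phi> x) + integral\<^sup>L (lebesgue_on ?D) (\<lambda>x. \<gamma> x * (\<zeta> \<bullet> grad UNIV \<phi> x)) = 0"
      using z Bochner_Integration.integral_add[OF i1 i2] by (simp only: sp)
    then show ?thesis using eq[OF \<phi>] by simp
  qed

  \<comment> \<open>An error \<open>e\<close> in the gradient of the test function costs at most
    \<open>e\<close> times the L^1 norm of \<open>A\<close>.\<close>
  have testC1: "integral\<^sup>L (lebesgue_on ?D) (\<lambda>x. A x \<bullet> D\<psi> x) = 0"
    if \<psi>: "\<And>x. GDERIV \<psi> x :> D\<psi> x" "continuous_on UNIV D\<psi>" "\<And>x. x \<notin> K \<Longrightarrow> \<psi> x = 0" "compact K" "K \<subseteq> ?D"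
    for \<psi> D\<psi> K
  proof (rule eq_zero_if_le_all_mult)
    fix e :: real assume "e > 0"
    then obtain \<phi> where \<phi>: "test_function ?D \<phi>" "\<And>x. norm (grad UNIV \<phi> x - D\<psi> x) \<le> e"
      using test_function_approx_C1[OF \<psi> D(1)] by blast
    obtain K' where K': "compact K'" "\<And>x. x \<notin> K' \<Longrightarrow> grad UNIV \<phi> x = 0" "continuous_on UNIV (grad UNIV \<phi>)"
      using test_functionE[OF \<phi>(1)] by metis
    have D0: "D\<psi> x = 0" if "x \<notin> K" for x
      using GDERIV_zero_outside[OF \<psi>(1) compact_imp_closed[OF \<psi>(4)] \<psi>(3) that] .
    have i: "integrable (lebesgue_on ?D) (\<lambda>x. A x \<bullet> D\<psi> x)"
      by (rule iAV[OF \<psi>(2) _ \<psi>(4)]) (rule D0)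
    have i': "integrable (lebesgue_on ?D) (\<lambda>x. A x \<bullet> grad UNIV \<phi> x)"
      by (rule iAV[OF K'(3) _ K'(1)]) (rule K'(2))
    have "integral\<^sup>L (lebesgue_on ?D) (\<lambda>x. A x \<bullet> D\<psi> x) = integral\<^sup>L (lebesgue_on ?D) (\<lambda>x. A x \<bullet> D\<psi> x - A x \<bullet> grad UNIV \<phi> x)"
      using i i' testA[OF \<phi>(1)] by simp
    also have "\<bar>\<dots>\<bar> \<le> integral\<^sup>L (lebesgue_on ?D) (\<lambda>x. \<bar>A x \<bullet> D\<psi> x - A x \<bullet> grad UNIV \<phi> x\<bar>)"
      using integral_norm_bound[of "lebesgue_on ?D" "\<lambda>x. A x \<bullet> D\<psi> x - A x \<bullet> grad UNIV \<phi> x"] by simp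
    also have "\<dots> \<le> integral\<^sup>L (lebesgue_on ?D) (\<lambda>x. e * norm (A x))"
    proof (rule integral_mono)
      show "\<bar>A x \<bullet> D\<psi> x - A x \<bullet> grad UNIV \<phi> x\<bar> \<le> e * norm (A x)" for x
      proof -
        have "\<bar>A x \<bullet> (D\<psi> x - grad UNIV \<phi> x)\<bar> \<le> norm (A x) * norm (D\<psi> x - grad UNIV \<phi> x)"
          by (rule Cauchy_Schwarz_ineq2)
        also have "\<dots> \<le> norm (A x) * e" using \<phi>(2)[of x] by (intro mult_left_mono) (auto simp: norm_minus_commute)
        finally show ?thesis by (simp add: inner_diff_right mult.commute)
      qed
    qed (use i i' iA in auto)
    finally show "\<bar>integral\<^sup>L (lebesgue_on ?D) (\<lambda>x. A x \<bullet> D\<psi> x)\<bar> \<le> e * integral\<^sup>L (lebesgue_on ?D) (\<lambda>x. norm (A x))"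
      by simp
  qed auto

  define w where "w x = u x - \<zeta> \<bullet> x" for x
  have cw: "continuous_on \<Omega> w" unfolding w_def by (intro continuous_intros cu)
  have Gw: "GDERIV w x :> g x - \<zeta>" if "x \<in> ?D" for x
    unfolding w_def by (intro GDERIV_diff Gu that) (auto simp: gderiv_def inner_commute intro!: derivative_eq_intros)
  have small: "\<bar>w x\<bar> \<le> \<epsilon>" if "\<epsilon> > 0" "x \<in> ?D" for \<epsilon> x
  proof -
    \<comment> \<open>The set |w| \<ge> \<epsilon> is compact and avoids the frontier, where
      \<open>w = 0\<close>; outside it \<open>ramp \<epsilon> (w x)\<close> vanishes.\<close>
    define K where "K = \<Omega> \<inter> w -` ({..-\<epsilon>} \<union> {\<epsilon>..})"
    have "closed K" unfolding K_def
      by (intro continuous_closed_preimage cw compact_imp_closed[OF \<Omega>(1)] closed_Un closed_atLeast closed_atMost)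
    then have "compact (\<Omega> \<inter> K)" using \<Omega>(1) by (intro compact_Int_closed)
    then have K: "compact K" by (simp add: K_def)
    have KD: "K \<subseteq> ?D"
    proof
      fix y assume y: "y \<in> K"
      then have "y \<notin> frontier \<Omega>" using bd \<open>\<epsilon> > 0\<close> by (auto simp: K_def w_def)
      then show "y \<in> ?D" using y \<Omega>(1) by (auto simp: K_def frontier_def closure_closed compact_imp_closed)
    qed
    have off: "\<bar>w x\<bar> \<le> \<epsilon>" if "x \<in> ?D - K" for x using that sub by (auto simp: K_def)
    let ?\<psi> = "\<lambda>x. if x \<in> ?D then ramp \<epsilon> (w x) else 0"
    let ?E = "\<lambda>x. ramp_deriv \<epsilon> (w x) *\<^sub>R (g x - \<zeta>)"
    let ?D\<psi> = "\<lambda>x. if x \<in> ?D then ?E x else 0"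
    have G: "GDERIV ?\<psi> x :> ?D\<psi> x" for x
      by (rule GDERIV_extend_zero[OF D(1) K KD])
        (use off in \<open>auto intro!: GDERIV_DERIV_compose[OF Gw DERIV_ramp] ramp_small\<close>)
    have c: "continuous_on UNIV ?D\<psi>"
    proof (rule continuous_on_extend_zero[OF D(1) K KD])
      have "continuous_on ?D w" "continuous_on ?D g" using cw cg sub continuous_on_subset by blast+
      then show "continuous_on ?D ?E" unfolding ramp_deriv_def by (intro continuous_intros)
      show "?E x = 0" if "x \<in> ?D - K" for x
        using ramp_small(2)[OF off[OF that]] by simp
    qed
    have z: "?\<psi> x = 0" if "x \<notin> K" for x using off[of x] that by (auto intro: ramp_small)
    have "integral\<^sup>L (lebesgue_on ?D) (\<lambda>x. A x \<bullet> ?D\<psi> x) = 0"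
      by (rule testC1[OF G c z K KD])
    moreover have ii: "integrable (lebesgue_on ?D) (\<lambda>x. A x \<bullet> ?D\<psi> x)"
      by (rule iAV[OF c _ K]) (use GDERIV_zero_outside[OF G compact_imp_closed[OF K] z] in blast)
    have form: "A x \<bullet> ?D\<psi> x = (\<gamma> x * ramp_deriv \<epsilon> (w x)) * ((norm (g x) powr (p - 2) *\<^sub>R g x - \<zeta>) \<bullet> (g x - \<zeta>))"
      if "x \<in> ?D" for x
      using that by (simp add: A_def)
    have nn: "AE x in lebesgue_on ?D. 0 \<le> A x \<bullet> ?D\<psi> x"
    proof (rule AE_I2)
      fix x assume "x \<in> space (lebesgue_on ?D)"
      then have x: "x \<in> ?D" by simp
      then have "\<gamma> x > 0" using \<gamma>(2) sub by blast
      then show "0 \<le> A x \<bullet> ?D\<psi> x" unfolding form[OF x]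
        by (intro mult_nonneg_nonneg ramp_deriv_nonneg p_laplace_strictly_monotone(1)[OF \<zeta> p]) simp
    qed
    ultimately have "AE x in lebesgue_on ?D. A x \<bullet> ?D\<psi> x = 0"
      using integral_nonneg_eq_0_iff_AE[OF ii nn] by (simp only:)
    then have "AE x in lebesgue_on ?D. ?D\<psi> x = 0"
    proof (rule AE_mp, intro AE_I2 impI)
      fix x assume "x \<in> space (lebesgue_on ?D)" and A0: "A x \<bullet> ?D\<psi> x = 0"
      then have x: "x \<in> ?D" by simp
      then have "\<gamma> x > 0" using \<gamma>(2) sub by blast
      then have "ramp_deriv \<epsilon> (w x) = 0 \<or> (norm (g x) powr (p - 2) *\<^sub>R g x - \<zeta>) \<bullet> (g x - \<zeta>) = 0"
        using A0 unfolding form[OF x] mult_eq_0_iff by auto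
      then show "?D\<psi> x = 0"
        using p_laplace_strictly_monotone(2)[OF \<zeta> p, of "g x"] by auto
    qed
    then have "AE x in lebesgue. x \<in> ?D \<longrightarrow> ?D\<psi> x = 0"
      using Ds by (simp add: AE_restrict_space_iff)
    then have "AE x in lebesgue. ?D\<psi> x = 0" by eventually_elim auto
    then have D0: "?D\<psi> x = 0" for x by (rule continuous_AE_zero_imp_zero[OF c])
    \<comment> \<open>Extended by zero, \<psi> lives on the convex whole space: zero gradient makes
      it constant, and its value off \<open>K\<close> is 0.\<close>
    have "(?\<psi> has_derivative (\<lambda>h. 0)) (at x within UNIV)" for x
      using G[of x] unfolding D0 by (simp add: gderiv_def)
    then obtain k where k: "\<And>x. ?\<psi> x = k"
      using has_derivative_zero_constant[OF convex_UNIV, of ?\<psi>] by auto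
    have "K \<noteq> UNIV" using compact_imp_bounded[OF K] not_bounded_UNIV by blast
    then obtain y where "y \<notin> K" by blast
    then have "k = 0" using z[of y] k[of y] by simp
    then have "ramp \<epsilon> (w x) = 0" using k[of x] \<open>x \<in> ?D\<close> by simp
    then show ?thesis using \<open>\<epsilon> > 0\<close> by (rule ramp_eq_0D)
  qed
  show ?thesis
  proof (cases "x \<in> ?D")
    case True
    then have "\<bar>w x\<bar> \<le> 0 + e" if "e > 0" for e using small[OF that] by simp
    then have "\<bar>w x\<bar> \<le> 0" by (rule field_le_epsilon)
    then show ?thesis by (simp add: w_def)
  next
    case False
    then have "x \<in> frontier \<Omega>" using x \<Omega>(1) by (simp add: frontier_def closure_closed compact_imp_closed)
    then show ?thesis by (rule bd)
  qed
qed

section \<open>Domains with smooth boundary\<close>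

text \<open>Let c be the part of b orthogonal to a. The vectors c - s a with s > 0 lie in the open
  half space of a, and letting s tend to 0 forces |c|^2 \<le> 0.\<close>

lemma half_space_subset_imp_parallel:
  fixes a b :: "'a::real_inner"
  assumes "\<And>e. a \<bullet> e < 0 \<Longrightarrow> b \<bullet> e \<le> 0" and "a \<noteq> 0"
  obtains l where "l \<ge> 0" "b = l *\<^sub>R a"
proof -
  define l where "l = (a \<bullet> b) / (a \<bullet> a)"
  have aa: "a \<bullet> a > 0" using assms(2) by simp
  have "b \<bullet> (- a) \<le> 0" by (rule assms(1)) (use aa in simp)
  then have l: "l \<ge> 0" using aa by (simp add: l_def inner_commute)
  define c where "c = b - l *\<^sub>R a"
  have ac: "a \<bullet> c = 0" using aa by (simp add: c_def l_def inner_diff_right)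
  have bc: "b \<bullet> c = c \<bullet> c" using ac by (simp add: c_def inner_diff_left inner_diff_right inner_commute)
  have ba: "b \<bullet> a = l * (a \<bullet> a)" using aa by (simp add: l_def inner_commute)
  have "c \<bullet> c \<le> 0 + t" if "t > 0" for t
  proof -
    define s where "s = t / (l * (a \<bullet> a) + 1)"
    have pos: "l * (a \<bullet> a) + 1 > 0" using l aa by (simp add: add_nonneg_pos)
    have s: "s > 0" using that pos by (simp add: s_def)
    have "b \<bullet> (c - s *\<^sub>R a) \<le> 0"
      by (rule assms(1)) (use s aa ac in \<open>simp add: inner_diff_right\<close>)
    then have "c \<bullet> c \<le> s * (l * (a \<bullet> a))" by (simp add: inner_diff_right bc ba)
    also have "\<dots> \<le> s * (l * (a \<bullet> a) + 1)" using s by (intro mult_left_mono) auto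
    also have "\<dots> = t" using pos by (simp add: s_def)
    finally show ?thesis by simp
  qed
  then have "c \<bullet> c \<le> 0" by (rule field_le_epsilon)
  then have "c \<bullet> c = 0" using inner_ge_zero[of c] by linarith
  then have "c = 0" by simp
  then show ?thesis using that l by (simp add: c_def)
qed

lemma GDERIV_imp_DERIV_line:
  assumes "GDERIV f x :> d"
  shows "DERIV (\<lambda>t. f (x + t *\<^sub>R e)) 0 :> d \<bullet> e"
proof -
  have "((\<lambda>t. x + t *\<^sub>R e) has_derivative (\<lambda>h. h *\<^sub>R e)) (at (0::real))"
    by (auto intro!: derivative_eq_intros)
  moreover have "(f has_derivative (\<lambda>h. h \<bullet> d)) (at (x + 0 *\<^sub>R e))"
    using assms by (simp add: gderiv_def)
  ultimately have "((\<lambda>t. f (x + t *\<^sub>R e)) has_derivative (\<lambda>h. (h *\<^sub>R e) \<bullet> d)) (at 0)"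
    by (rule has_derivative_compose)
  moreover have "(\<lambda>h. (h *\<^sub>R e) \<bullet> d) = (*) (d \<bullet> e)"
    by (simp add: fun_eq_iff inner_commute[of e])
  ultimately show ?thesis by (simp only: has_field_derivative_def)
qed

lemma open_line_nhd:
  fixes x e :: "'a::real_normed_vector"
  assumes "open U" "x \<in> U"
  obtains \<tau> where "\<tau> > 0" "\<And>t. \<bar>t\<bar> < \<tau> \<Longrightarrow> x + t *\<^sub>R e \<in> U"
proof -
  have "open ((\<lambda>t. x + t *\<^sub>R e) -` U)"
    using assms(1) by (intro open_vimage) (auto intro!: continuous_intros)
  moreover have "0 \<in> (\<lambda>t. x + t *\<^sub>R e) -` U" using assms(2) by simp
  ultimately obtain \<tau> where "\<tau> > 0" "ball 0 \<tau> \<subseteq> (\<lambda>t. x + t *\<^sub>R e) -` U"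
    by (meson open_contains_ball)
  then show ?thesis using that[of \<tau>] by (auto simp: subset_eq dist_real_def)
qed

text \<open>The sign of the derivative of \<rho> along a line decides on which side of the boundary
  the line starts. The last two conclusions determine the direction of the gradient from \<Omega>
  alone, which allows different defining functions to be compared.\<close>

lemma local_defining_function_frontier:
  fixes \<Omega> :: "(real ^ 'n) set"
  assumes "closed \<Omega>" "x \<in> frontier \<Omega>" "local_defining_function \<Omega> x U \<rho>"
  shows "GDERIV \<rho> x :> grad U \<rho> x" "grad U \<rho> x \<noteq> 0" "\<rho> x = 0"
    and "\<And>e. grad U \<rho> x \<bullet> e < 0 \<Longrightarrow> \<exists>\<tau>>0. \<forall>t. 0 < t \<and> t < \<tau> \<longrightarrow> x + t *\<^sub>R e \<in> interior \<Omega>"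
    and "\<And>e \<tau>. \<tau> > 0 \<Longrightarrow> (\<And>t. 0 < t \<Longrightarrow> t < \<tau> \<Longrightarrow> x + t *\<^sub>R e \<in> \<Omega>) \<Longrightarrow> grad U \<rho> x \<bullet> e \<le> 0"
proof -
  have U: "open U" "x \<in> U" "smooth_on U \<rho>" "\<Omega> \<inter> U = {y \<in> U. \<rho> y \<le> 0}"
    and nz: "\<forall>y\<in>U. grad U \<rho> y \<noteq> 0"
    using assms(3) by (auto simp: local_defining_function_def)
  show g: "GDERIV \<rho> x :> grad U \<rho> x" by (rule smooth_on_GDERIV[OF U(1,3,2)])
  show "grad U \<rho> x \<noteq> 0" using nz U(2) by blast
  have c: "continuous_on U \<rho>" by (rule smooth_on_continuous[OF U(1,3)])
  have "open (U \<inter> \<rho> -` {..<0})"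
    by (rule continuous_open_preimage[OF c U(1)]) simp
  moreover have "U \<inter> \<rho> -` {..<0} \<subseteq> \<Omega>"
  proof
    fix y assume "y \<in> U \<inter> \<rho> -` {..<0}"
    then have "y \<in> {y \<in> U. \<rho> y \<le> 0}" by simp
    then show "y \<in> \<Omega>" unfolding U(4)[symmetric] by simp
  qed
  ultimately have "U \<inter> \<rho> -` {..<0} \<subseteq> interior \<Omega>" by (intro interior_maximal)
  then have neg: "y \<in> interior \<Omega>" if "y \<in> U" "\<rho> y < 0" for y
    using that by auto
  have "x \<in> \<Omega>" using assms(1,2) frontier_subset_closed by blast
  then have "\<rho> x \<le> 0" using U by auto
  moreover have "x \<notin> interior \<Omega>" using assms(2) by (simp add: frontier_def)
  ultimately show r0: "\<rho> x = 0" using neg[OF U(2)] by fastforce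
  show "\<exists>\<tau>>0. \<forall>t. 0 < t \<and> t < \<tau> \<longrightarrow> x + t *\<^sub>R e \<in> interior \<Omega>" if e: "grad U \<rho> x \<bullet> e < 0" for e
  proof -
    obtain a where a: "a > 0" "\<And>t. \<bar>t\<bar> < a \<Longrightarrow> x + t *\<^sub>R e \<in> U" using open_line_nhd[OF U(1,2)] by blast
    obtain b where b: "b > 0" "\<forall>h>0. h < b \<longrightarrow> \<rho> (x + (0 + h) *\<^sub>R e) < \<rho> (x + 0 *\<^sub>R e)"
      using DERIV_neg_dec_right[OF GDERIV_imp_DERIV_line[OF g] e] by blast
    show ?thesis
      by (rule exI[of _ "min a b"]) (use a b r0 in \<open>auto intro!: neg\<close>)
  qed
  show "grad U \<rho> x \<bullet> e \<le> 0" if e: "\<tau> > 0" "\<And>t. 0 < t \<Longrightarrow> t < \<tau> \<Longrightarrow> x + t *\<^sub>R e \<in> \<Omega>" for e \<tau>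
  proof (rule ccontr)
    assume "\<not> grad U \<rho> x \<bullet> e \<le> 0"
    then have p: "grad U \<rho> x \<bullet> e > 0" by simp
    obtain a where a: "a > 0" "\<And>t. \<bar>t\<bar> < a \<Longrightarrow> x + t *\<^sub>R e \<in> U" using open_line_nhd[OF U(1,2)] by blast
    obtain b where b: "b > 0" "\<forall>h>0. h < b \<longrightarrow> \<rho> (x + 0 *\<^sub>R e) < \<rho> (x + (0 + h) *\<^sub>R e)"
      using DERIV_pos_inc_right[OF GDERIV_imp_DERIV_line[OF g] p] by blast
    define t where "t = min \<tau> (min a b) / 2"
    have t: "0 < t" "t < \<tau>" "t < a" "t < b" using e(1) a(1) b(1) by (auto simp: t_def)
    have "x + t *\<^sub>R e \<in> \<Omega> \<inter> U" using e(2)[OF t(1,2)] a(2)[of t] t by simp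
    then have "\<rho> (x + t *\<^sub>R e) \<le> 0" using U(4) by blast
    moreover have "\<rho> (x + t *\<^sub>R e) > 0" using b(2) t(1,4) r0 by simp
    ultimately show False by simp
  qed
qed

text \<open>Directions that enter \<Omega> for one defining function have nonpositive derivative for
  any other, so the gradients are positively parallel and the \<open>THE\<close> is well
  defined.\<close>

lemma exterior_normal_eq:
  fixes \<Omega> :: "(real ^ 'n) set"
  assumes "closed \<Omega>" "x \<in> frontier \<Omega>" "local_defining_function \<Omega> x U \<rho>"
  shows "exterior_normal \<Omega> x = grad U \<rho> x /\<^sub>R norm (grad U \<rho> x)"
  unfolding exterior_normal_def
proof (rule the_equality)
  show "\<exists>U' \<rho>'. local_defining_function \<Omega> x U' \<rho>' \<and>
      grad U \<rho> x /\<^sub>R norm (grad U \<rho> x) = grad U' \<rho>' x /\<^sub>R norm (grad U' \<rho>' x)"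
    using assms(3) by blast
next
  fix \<nu> assume "\<exists>U' \<rho>'. local_defining_function \<Omega> x U' \<rho>' \<and> \<nu> = grad U' \<rho>' x /\<^sub>R norm (grad U' \<rho>' x)"
  then obtain U' \<rho>' where *: "local_defining_function \<Omega> x U' \<rho>'" "\<nu> = grad U' \<rho>' x /\<^sub>R norm (grad U' \<rho>' x)"
    by blast
  note A = local_defining_function_frontier[OF assms]
    and B = local_defining_function_frontier[OF assms(1,2) *(1)]
  have "grad U' \<rho>' x \<bullet> e \<le> 0" if e: "grad U \<rho> x \<bullet> e < 0" for e
  proof -
    obtain \<tau> where "\<tau> > 0" "\<forall>t. 0 < t \<and> t < \<tau> \<longrightarrow> x + t *\<^sub>R e \<in> interior \<Omega>"
      using A(4)[OF e] by blast
    then show ?thesis using interior_subset by (intro B(5)[of \<tau>]) auto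
  qed
  then obtain l where l: "l \<ge> 0" "grad U' \<rho>' x = l *\<^sub>R grad U \<rho> x"
    using half_space_subset_imp_parallel[OF _ A(2)] by blast
  then have "l > 0" using B(2) by (cases "l = 0") auto
  then show "\<nu> = grad U \<rho> x /\<^sub>R norm (grad U \<rho> x)" using l(2) *(2) by simp
qed

text \<open>From a frontier point, moving against the gradient of a defining function enters the
  interior at once.\<close>

lemma smooth_boundary_subset_closure_interior:
  fixes \<Omega> :: "(real ^ 'n) set"
  assumes "closed \<Omega>" "smooth_boundary \<Omega>"
  shows "\<Omega> \<subseteq> closure (interior \<Omega>)"
proof
  fix x assume "x \<in> \<Omega>"
  show "x \<in> closure (interior \<Omega>)"
  proof (cases "x \<in> interior \<Omega>")
    case True then show ?thesis using closure_subset by blast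
  next
    case False
    then have x: "x \<in> frontier \<Omega>" using \<open>x \<in> \<Omega>\<close> closure_subset by (auto simp: frontier_def)
    then obtain U \<rho> where "local_defining_function \<Omega> x U \<rho>"
      using assms(2) by (auto simp: smooth_boundary_def)
    note A = local_defining_function_frontier[OF assms(1) x this]
    let ?e = "- grad U \<rho> x"
    obtain \<tau> where \<tau>: "\<tau> > 0" "\<forall>t. 0 < t \<and> t < \<tau> \<longrightarrow> x + t *\<^sub>R ?e \<in> interior \<Omega>"
      using A(4)[of ?e] A(2) by auto
    have "((\<lambda>t. x + t *\<^sub>R ?e) \<longlongrightarrow> x + 0 *\<^sub>R ?e) (at_right (0::real))"
      by (intro tendsto_intros)
    moreover have "eventually (\<lambda>t. x + t *\<^sub>R ?e \<in> closure (interior \<Omega>)) (at_right 0)"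
      unfolding eventually_at_right_field using \<tau> closure_subset by blast
    ultimately show ?thesis
      using Lim_in_closed_set[OF closed_closure _ trivial_limit_at_right_real] by simp
  qed
qed

text \<open>At a frontier point \<zeta> is a derivative within \<Omega>, but \<open>grad\<close>
  could be another one. Their difference \<open>d\<close> annihilates every direction entering the
  interior; the half space lemma for \<open>d\<close> and \<open>- d\<close> makes it zero.\<close>

lemma grad_inner_smooth_boundary:
  fixes \<Omega> :: "(real ^ 'n) set"
  assumes "closed \<Omega>" "smooth_boundary \<Omega>" "x \<in> \<Omega>"
  shows "grad \<Omega> (\<lambda>y. \<zeta> \<bullet> y) x = \<zeta>"
proof (cases "x \<in> interior \<Omega>")
  case True
  then show ?thesis
    by (intro grad_eqI) (auto simp: gderiv_def inner_commute intro!: derivative_eq_intros)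
next
  case False
  then have x: "x \<in> frontier \<Omega>" using assms(3) closure_subset by (auto simp: frontier_def)
  then obtain U \<rho> where "local_defining_function \<Omega> x U \<rho>"
    using assms(2) by (auto simp: smooth_boundary_def)
  note A = local_defining_function_frontier[OF assms(1) x this]
  define d where "d = grad \<Omega> (\<lambda>y. \<zeta> \<bullet> y) x - \<zeta>"
  have v: "((\<lambda>y. \<zeta> \<bullet> y) has_derivative (\<lambda>h. h \<bullet> \<zeta>)) (at x within \<Omega>)"
    by (auto simp: inner_commute intro!: derivative_eq_intros)
  then have "(\<lambda>y. \<zeta> \<bullet> y) differentiable (at x within \<Omega>)" by (rule differentiableI)
  from has_derivative_diff[OF has_derivative_grad_within[OF this] v]
  have "((\<lambda>y. 0::real) has_derivative (\<lambda>h. h \<bullet> d)) (at x within \<Omega>)"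
    by (simp add: d_def inner_diff_right)
  then have lim: "((\<lambda>y. (1 / norm (y - x)) *\<^sub>R (0 - (0 + (y - x) \<bullet> d))) \<longlongrightarrow> 0) (at x within \<Omega>)"
    unfolding has_derivative_within by blast
  have de: "d \<bullet> e = 0" if e: "grad U \<rho> x \<bullet> e < 0" for e
  proof -
    have e0: "e \<noteq> 0" using e by auto
    obtain \<tau> where \<tau>: "\<tau> > 0" "\<forall>t. 0 < t \<and> t < \<tau> \<longrightarrow> x + t *\<^sub>R e \<in> interior \<Omega>"
      using A(4)[OF e] by blast
    have "filterlim (\<lambda>t. x + t *\<^sub>R e) (at x within \<Omega>) (at_right (0::real))"
      unfolding filterlim_at
    proof
      have "\<forall>t>0. t < \<tau> \<longrightarrow> x + t *\<^sub>R e \<in> \<Omega> \<and> x + t *\<^sub>R e \<noteq> x"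
        using \<tau>(2) interior_subset e0 by auto
      then show "eventually (\<lambda>t. x + t *\<^sub>R e \<in> \<Omega> \<and> x + t *\<^sub>R e \<noteq> x) (at_right 0)"
        unfolding eventually_at_right_field using \<tau>(1) by blast
      have "((\<lambda>t. x + t *\<^sub>R e) \<longlongrightarrow> x + 0 *\<^sub>R e) (at_right (0::real))"
        by (intro tendsto_intros)
      then show "((\<lambda>t. x + t *\<^sub>R e) \<longlongrightarrow> x) (at_right (0::real))" by simp
    qed
    from filterlim_compose[OF lim this]
    have "((\<lambda>t::real. - ((t * (e \<bullet> d)) / (\<bar>t\<bar> * norm e))) \<longlongrightarrow> 0) (at_right 0)" by simp
    moreover have "eventually (\<lambda>t::real. - ((t * (e \<bullet> d)) / (\<bar>t\<bar> * norm e)) = - ((e \<bullet> d) / norm e)) (at_right 0)"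
      using eventually_at_right_less[of 0] by eventually_elim simp
    ultimately have "((\<lambda>t::real. - ((e \<bullet> d) / norm e)) \<longlongrightarrow> 0) (at_right 0)"
      by (rule Lim_transform_eventually)
    then have "- ((e \<bullet> d) / norm e) = 0"
      by (simp add: tendsto_const_iff)
    then show ?thesis using e0 by (simp add: inner_commute)
  qed
  obtain l where l: "l \<ge> 0" "d = l *\<^sub>R grad U \<rho> x"
    by (rule half_space_subset_imp_parallel[OF _ A(2), of d]) (use de in auto)
  obtain k where k: "k \<ge> 0" "- d = k *\<^sub>R grad U \<rho> x"
    by (rule half_space_subset_imp_parallel[OF _ A(2), of "- d"]) (use de in auto)
  have "(l + k) *\<^sub>R grad U \<rho> x = 0"
    unfolding scaleR_add_left l(2)[symmetric] k(2)[symmetric] by simp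
  then have "l = 0" using A(2) l(1) k(1) by simp
  then show ?thesis using l(2) by (simp add: d_def)
qed

text \<open>Among the ellipsoids \<open>h\<^sup>2 + M q < c\<close> around \<open>x0\<close>, where \<open>h\<close> and \<open>q\<close> measure the parts of \<open>y - x0\<close>
  along and orthogonal to \<open>\<zeta>\<close>, take the largest one inside \<open>\<Omega>\<close>. For large \<open>M\<close> it is thin and touches
  the frontier off its equator, hence at a point where \<open>\<zeta>\<close> is not tangential.\<close>

lemma reach_frontier_transversally:
  fixes \<Omega> :: "'a::euclidean_space set"
  assumes \<Omega>: "compact \<Omega>" and x0: "x0 \<in> interior \<Omega>" and \<zeta>: "norm \<zeta> = 1" and \<delta>: "\<delta> > 0"
  obtains y h a where "y \<in> frontier \<Omega>" "\<And>s. 0 < s \<Longrightarrow> s \<le> 1 \<Longrightarrow> y - (s * h) *\<^sub>R \<zeta> \<in> interior \<Omega>"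
    "dist (y - h *\<^sub>R \<zeta>) x0 < \<delta>" "a \<bullet> \<zeta> \<noteq> 0"
    "\<And>e. a \<bullet> e < 0 \<Longrightarrow> \<exists>\<tau>>0. \<forall>t. 0 < t \<and> t < \<tau> \<longrightarrow> y + t *\<^sub>R e \<in> interior \<Omega>"
proof -
  have zz: "\<zeta> \<bullet> \<zeta> = 1" using \<zeta> by (simp add: dot_square_norm)
  obtain R where R: "R > 0" "\<Omega> \<subseteq> ball x0 R"
    using bounded_subset_ballD[OF compact_imp_bounded[OF \<Omega>]] by blast
  obtain r where r: "r > 0" "ball x0 r \<subseteq> interior \<Omega>"
    using x0 open_contains_ball[of "interior \<Omega>"] by auto
  \<comment> \<open>The first summand excludes contact on the equator, the second makes the
    ellipsoid thinner than \<delta> across the axis, and the 1 makes both inequalities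
    strict.\<close>
  define M where "M = R\<^sup>2 / r\<^sup>2 + R\<^sup>2 / \<delta>\<^sup>2 + 1"
  have M: "M > 0" "M * r\<^sup>2 > R\<^sup>2" "M * \<delta>\<^sup>2 > R\<^sup>2"
  proof -
    have p: "R\<^sup>2 / r\<^sup>2 > 0" "R\<^sup>2 / \<delta>\<^sup>2 > 0" using R(1) r(1) \<delta> by simp_all
    show "M > 0" unfolding M_def using p by linarith
    have 1: "R\<^sup>2 / r\<^sup>2 < M" and 2: "R\<^sup>2 / \<delta>\<^sup>2 < M" unfolding M_def using p by linarith+
    have "0 < r\<^sup>2" "0 < \<delta>\<^sup>2" using r(1) \<delta> by simp_all
    then show "M * r\<^sup>2 > R\<^sup>2" "M * \<delta>\<^sup>2 > R\<^sup>2"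
      using 1 2 by (simp_all only: pos_divide_less_eq)
  qed
  define q where "q v = v \<bullet> v - (\<zeta> \<bullet> v)\<^sup>2" for v
  have q: "q v = (norm (v - (\<zeta> \<bullet> v) *\<^sub>R \<zeta>))\<^sup>2" for v
  proof -
    have "(v - (\<zeta> \<bullet> v) *\<^sub>R \<zeta>) \<bullet> (v - (\<zeta> \<bullet> v) *\<^sub>R \<zeta>) = q v"
      by (simp add: q_def inner_diff_left inner_diff_right zz inner_commute[of v \<zeta>] power2_eq_square)
    then show ?thesis by (simp only: power2_norm_eq_inner)
  qed
  define m where "m v = (\<zeta> \<bullet> v)\<^sup>2 + M * q v" for v
  have cm: "continuous_on S (\<lambda>y. m (y - x0))" for S
    unfolding m_def q_def by (intro continuous_intros)
  have scale: "m (s *\<^sub>R v) = s\<^sup>2 * m v" for s v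
    by (simp add: m_def q_def algebra_simps power2_eq_square)
  have m0: "m v \<ge> 0" for v using M(1) by (simp add: m_def q)
  define F where "F = frontier \<Omega>"
  have cF: "compact F" unfolding F_def using \<Omega> by (rule compact_frontier)
  have meet: "closed_segment x0 y \<inter> F \<noteq> {}" if "y \<notin> \<Omega>" for y
    unfolding F_def
  proof (rule connected_Int_frontier)
    show "closed_segment x0 y \<inter> \<Omega> \<noteq> {}" using x0 interior_subset by auto
    show "closed_segment x0 y - \<Omega> \<noteq> {}" using that by auto
  qed simp
  \<comment> \<open>On the axis \<open>q\<close> vanishes, so a frontier point there bounds the
    minimum of \<open>m\<close> over the frontier by R^2, whatever \<open>M\<close> is.\<close>
  have "x0 + R *\<^sub>R \<zeta> \<notin> \<Omega>" using R \<zeta> by (auto simp: subset_eq dist_norm)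
  from meet[OF this] obtain s where s: "0 \<le> s" "s \<le> 1" "x0 + (s * R) *\<^sub>R \<zeta> \<in> F"
    by (auto simp: closed_segment_def algebra_simps)
  have "m ((s * R) *\<^sub>R \<zeta>) = (s * R)\<^sup>2" by (simp add: m_def q_def zz power2_eq_square)
  also have "\<dots> \<le> R\<^sup>2" using s R by (intro power_mono) (auto simp: mult_left_le_one_le)
  finally have mR: "m (x0 + (s * R) *\<^sub>R \<zeta> - x0) \<le> R\<^sup>2" by simp
  obtain y where y: "y \<in> F" "\<And>z. z \<in> F \<Longrightarrow> m (y - x0) \<le> m (z - x0)"
    using continuous_attains_inf[OF cF _ cm] s(3) by blast
  define v where "v = y - x0"
  have mv: "m v \<le> R\<^sup>2" using y(2)[OF s(3)] mR by (simp add: v_def)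
  \<comment> \<open>By quadratic scaling the segment from \<open>x0\<close> to \<open>z\<close>
    stays at levels below \<open>m v\<close>, the minimum over the frontier, and so never meets the
    frontier.\<close>
  have E: "z \<in> interior \<Omega>" if "m (z - x0) < m v" for z
  proof -
    have nF: "w \<notin> F" if "w \<in> closed_segment x0 z" for w
    proof
      assume "w \<in> F"
      obtain u where u: "0 \<le> u" "u \<le> 1" "w = x0 + u *\<^sub>R (z - x0)"
        using \<open>w \<in> closed_segment x0 z\<close> by (auto simp: closed_segment_def algebra_simps)
      have "m (w - x0) = u\<^sup>2 * m (z - x0)" using u(3) scale by simp
      also have "\<dots> \<le> m (z - x0)" using u m0 by (intro mult_left_le_one_le) (auto simp: power_le_one)
      finally show False using y(2)[OF \<open>w \<in> F\<close>] \<open>m (z - x0) < m v\<close> by (simp add: v_def)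
    qed
    then have "z \<in> \<Omega>" using meet by blast
    moreover have "z \<notin> F" using nF by auto
    ultimately show ?thesis using closure_subset by (auto simp: F_def frontier_def)
  qed
  define h where "h = \<zeta> \<bullet> v"
  \<comment> \<open>On the equator \<open>m v\<close> would be M |v|^2 \<ge> M r^2 > R^2, against
    the bound on the minimum.\<close>
  have "h \<noteq> 0"
  proof
    assume "h = 0"
    then have "m v = M * (norm v)\<^sup>2" by (simp add: m_def q h_def)
    moreover have "norm v \<ge> r"
    proof (rule ccontr)
      assume "\<not> norm v \<ge> r"
      then have "y \<in> ball x0 r" by (simp add: v_def dist_norm norm_minus_commute)
      then show False using r(2) y(1) by (auto simp: F_def frontier_def)
    qed
    then have "M * r\<^sup>2 \<le> M * (norm v)\<^sup>2" using M(1) r(1) by (intro mult_left_mono power_mono) auto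
    ultimately show False using mv M(2) by linarith
  qed
  \<comment> \<open>The gradient of \<open>m\<close> at \<open>v\<close>, that is, the outer normal
    of the ellipsoid at the contact point.\<close>
  define a where "a = (2 * M) *\<^sub>R v + (2 * (1 - M) * h) *\<^sub>R \<zeta>"
  show ?thesis
  proof (rule that[of y h a])
    show "y \<in> frontier \<Omega>" using y(1) by (simp add: F_def)
    show "y - (s * h) *\<^sub>R \<zeta> \<in> interior \<Omega>" if s: "0 < s" "s \<le> 1" for s
    proof (rule E)
      have "m (y - (s * h) *\<^sub>R \<zeta> - x0) = m (v - (s * h) *\<^sub>R \<zeta>)" by (simp add: v_def algebra_simps)
      also have "\<dots> = (1 - s)\<^sup>2 * h\<^sup>2 + M * q v"
        by (simp add: m_def q_def inner_diff_left inner_diff_right zz inner_commute[of v \<zeta>] flip: h_def)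
          (simp add: algebra_simps power2_eq_square)
      also have "\<dots> < h\<^sup>2 + M * q v"
      proof -
        have "(1 - s)\<^sup>2 < 1" using s by (simp add: power2_eq_square algebra_simps)
        then show ?thesis using \<open>h \<noteq> 0\<close> by simp
      qed
      finally show "m (y - (s * h) *\<^sub>R \<zeta> - x0) < m v" by (simp add: m_def h_def)
    qed
    show "dist (y - h *\<^sub>R \<zeta>) x0 < \<delta>"
    proof -
      have "M * q v \<le> m v" by (simp add: m_def)
      then have "M * q v < M * \<delta>\<^sup>2" using mv M(3) by linarith
      then have "q v < \<delta>\<^sup>2" using M(1) by simp
      then have "norm (v - h *\<^sub>R \<zeta>) < \<delta>" unfolding q h_def[symmetric]
        using \<delta> by (simp add: power_less_imp_less_base)
      then show ?thesis by (simp add: dist_norm v_def algebra_simps)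
    qed
    show "a \<bullet> \<zeta> \<noteq> 0"
    proof -
      have "a \<bullet> \<zeta> = 2 * h" by (simp add: a_def inner_add_left zz inner_commute[of v \<zeta>] flip: h_def) (simp add: left_diff_distrib)
      then show ?thesis using \<open>h \<noteq> 0\<close> by simp
    qed
    show "\<exists>\<tau>>0. \<forall>t. 0 < t \<and> t < \<tau> \<longrightarrow> y + t *\<^sub>R e \<in> interior \<Omega>" if e: "a \<bullet> e < 0" for e
    proof -
      \<comment> \<open>The Taylor expansion of a quadratic form is exact. Below \<tau> the negative
        linear term dominates; the 1 in its denominator covers \<open>m e = 0\<close>.\<close>
      have ex: "m (v + t *\<^sub>R e) = m v + t * (a \<bullet> e) + t\<^sup>2 * m e" for t
        by (simp add: m_def q_def a_def h_def inner_add_left inner_add_right inner_commute[of e v] algebra_simps power2_eq_square)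
      define \<tau> where "\<tau> = - (a \<bullet> e) / (m e + 1)"
      have \<tau>: "\<tau> > 0" unfolding \<tau>_def using e m0[of e] by (intro divide_pos_pos) auto
      have "y + t *\<^sub>R e \<in> interior \<Omega>" if t: "0 < t" "t < \<tau>" for t
      proof (rule E)
        have "0 < m e + 1" using m0[of e] by linarith
        then have "t * (m e + 1) < - (a \<bullet> e)"
          using t(2) unfolding \<tau>_def by (simp only: pos_less_divide_eq)
        then have "t * m e < - (a \<bullet> e)" using t(1) by (simp add: distrib_left)
        then have "t * (t * m e) < t * - (a \<bullet> e)" using t(1) by (simp only: mult_less_cancel_left_pos)
        then have "m (v + t *\<^sub>R e) < m v" unfolding ex by (simp add: power2_eq_square mult.assoc)
        then show "m (y + t *\<^sub>R e - x0) < m v" by (simp add: v_def algebra_simps)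
      qed
      then show ?thesis using \<tau> by blast
    qed
  qed
qed

section \<open>The Dirichlet-to-Neumann map at linear data\<close>

lemma test_function_zero: "test_function D (\<lambda>x. 0)"
  by (rule test_functionI[of _ "{}"]) (auto simp: smooth_on_def intro: Ck_on_const)

lemma GDERIV_inner: "GDERIV (\<lambda>y. \<zeta> \<bullet> y) x :> \<zeta>"
  unfolding gderiv_def by (auto simp: inner_commute intro!: derivative_eq_intros)

lemma W1p_with_gradient_inner:
  fixes D :: "(real ^ 'n) set"
  assumes "open D" "bounded D" "p > 1"
  shows "W1p_with_gradient p D (\<lambda>x. \<zeta> \<bullet> x) (\<lambda>x. \<zeta>)"
proof -
  have Dm: "D \<in> lmeasurable" using assms lmeasurable_open by blast
  have Ds: "D \<in> sets lebesgue" using Dm by (rule fmeasurableD)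
  obtain B where B: "\<And>x. x \<in> D \<Longrightarrow> norm x \<le> B" using assms(2) unfolding bounded_iff by blast
  have "Lp_on p D (\<lambda>x. \<zeta> \<bullet> x)"
  proof (rule Lp_on_bounded[OF Dm _ _ assms(3)])
    show "(\<lambda>x. \<zeta> \<bullet> x) \<in> borel_measurable (lebesgue_on D)"
      by (rule continuous_imp_measurable_on_sets_lebesgue[OF _ Ds]) (intro continuous_intros)
    show "norm (\<zeta> \<bullet> x) \<le> norm \<zeta> * B" if "x \<in> D" for x
      using Cauchy_Schwarz_ineq2[of \<zeta> x] mult_left_mono[OF B[OF that] norm_ge_zero[of \<zeta>]] by simp
  qed
  moreover have "Lp_on p D (\<lambda>x. \<zeta>)"
    by (rule Lp_on_bounded[OF Dm _ order_refl assms(3)]) simp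
  moreover have "weak_gradient D (\<lambda>x. \<zeta> \<bullet> x) (\<lambda>x. \<zeta>)"
    unfolding weak_gradient_def
  proof (intro allI impI)
    fix \<phi> :: "real ^ 'n \<Rightarrow> real" and i assume "test_function D \<phi>"
    from integral_by_parts_test[OF assms(1) Dm GDERIV_inner[of \<zeta>] continuous_on_const this, where e = "axis i 1"]
    show "integral\<^sup>L (lebesgue_on D) (\<lambda>x. (\<zeta> \<bullet> x) * grad UNIV \<phi> x $ i) = - integral\<^sup>L (lebesgue_on D) (\<lambda>x. \<zeta> $ i * \<phi> x)"
      by (simp add: inner_axis)
  qed
  ultimately show ?thesis by (simp add: W1p_with_gradient_def)
qed

text \<open>With constant unit gradient the power factor is 1 and the nonlinear equation is the
  assumed linear one. The function serves as its own boundary extension, and the difference 0 is a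
  limit of zero test functions.\<close>

lemma weak_solution_inner:
  fixes \<Omega> :: "(real ^ 'n) set"
  assumes "bounded \<Omega>" "p > 1" "norm \<zeta> = 1"
    and "\<And>\<phi>. test_function (interior \<Omega>) \<phi> \<Longrightarrow>
      integral\<^sup>L (lebesgue_on (interior \<Omega>)) (\<lambda>x. \<gamma> x * (\<zeta> \<bullet> grad UNIV \<phi> x)) = 0"
  shows "weak_solution p \<Omega> \<gamma> (\<lambda>x. \<zeta> \<bullet> x) (\<lambda>x. \<zeta> \<bullet> x)"
proof -
  let ?D = "interior \<Omega>"
  have D: "open ?D" "bounded ?D" using assms(1) interior_subset bounded_subset by auto
  note W = W1p_with_gradient_inner[OF D assms(2)]
  have "W1p_zero p ?D (\<lambda>x. 0)"
    unfolding W1p_zero_def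
  proof (intro exI conjI allI)
    show "W1p_with_gradient p ?D (\<lambda>x. 0) (\<lambda>x. 0)" using W[of 0] by simp
    show "test_function ?D ((\<lambda>k x. 0) (k :: nat))" for k by (simp add: test_function_zero)
    have g: "grad UNIV (\<lambda>x::real^'n. 0::real) x = 0" for x
      by (rule grad_eqI[OF GDERIV_const]) simp
    show "(\<lambda>k. integral\<^sup>L (lebesgue_on ?D) (\<lambda>x. norm (0 - grad UNIV ((\<lambda>k x. 0) (k :: nat)) x) powr p)) \<longlonglongrightarrow> 0"
      by (simp add: g)
  qed simp
  moreover have "continuous_on \<Omega> (\<lambda>x. \<zeta> \<bullet> x)" by (intro continuous_intros)
  ultimately show ?thesis
    unfolding weak_solution_def W1p_def
    using W[of \<zeta>] assms(3,4)
    by (intro conjI exI[of _ "\<lambda>x. \<zeta>"] exI[of _ "\<lambda>x. \<zeta> \<bullet> x"]) auto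
qed

lemma smooth_on_closed_imp_continuous_on:
  fixes h :: "real ^ 'n \<Rightarrow> real"
  assumes "smooth_on_closed S h"
  shows "continuous_on S h"
proof -
  obtain U g where U: "open U" "S \<subseteq> U" "smooth_on U g" "\<forall>x\<in>S. g x = h x"
    using assms unfolding smooth_on_closed_def by blast
  have "continuous_on S g" by (rule continuous_on_subset[OF smooth_on_continuous[OF U(1,3)] U(2)])
  then show ?thesis using continuous_on_cong[OF refl, of S g h] U(4) by blast
qed

text \<open>\<open>dirichlet_solution\<close> is a choice: the linear function shows that there is a
  candidate, uniqueness fixes the chosen values on \<Omega>, and \<open>grad \<Omega>\<close>
  depends on those values only, up to the frontier.\<close>

lemma DN_map_inner:
  fixes \<Omega> :: "(real ^ 'n) set"
  assumes \<Omega>: "compact \<Omega>" "smooth_boundary \<Omega>" and p: "p > 1" and \<zeta>: "norm \<zeta> = 1"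
    and \<gamma>: "smooth_on_closed \<Omega> \<gamma>" "\<forall>x\<in>\<Omega>. \<gamma> x > 0" "\<forall>x\<in>\<Omega>. \<zeta> \<bullet> grad \<Omega> \<gamma> x = 0"
    and x: "x \<in> \<Omega>"
  shows "DN_map p \<Omega> \<gamma> (\<lambda>x. \<zeta> \<bullet> x) x = \<gamma> x * (\<zeta> \<bullet> exterior_normal \<Omega> x)"
proof -
  let ?D = "interior \<Omega>" and ?v = "\<lambda>x. \<zeta> \<bullet> x"
  have cl: "closed \<Omega>" using \<Omega>(1) by (rule compact_imp_closed)
  have D: "open ?D" "bounded ?D" using compact_imp_bounded[OF \<Omega>(1)] interior_subset bounded_subset by auto
  have Dm: "?D \<in> lmeasurable" using D lmeasurable_open by blast
  obtain U g where U: "open U" "\<Omega> \<subseteq> U" "smooth_on U g" "\<forall>x\<in>\<Omega>. g x = \<gamma> x"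
    using \<gamma>(1) unfolding smooth_on_closed_def by blast
  have c\<gamma>: "continuous_on \<Omega> \<gamma>"
    by (rule smooth_on_closed_imp_continuous_on[OF \<gamma>(1)])
  have G: "GDERIV \<gamma> x :> grad U g x" if "x \<in> ?D" for x
  proof (rule GDERIV_transform_open[OF _ D(1) that])
    show "GDERIV g x :> grad U g x"
      using smooth_on_GDERIV[OF U(1,3)] that U(2) interior_subset by blast
    show "g y = \<gamma> y" if "y \<in> ?D" for y using U(4) that interior_subset by blast
  qed
  have z: "grad U g x \<bullet> \<zeta> = 0" if "x \<in> ?D" for x
    using grad_eqI[OF G[OF that] that] \<gamma>(3) that interior_subset by (metis inner_commute subsetD)
  have cg: "continuous_on ?D (grad U g)"
    using continuous_on_subset[OF smooth_on_continuous_grad[OF U(1,3)]] U(2) interior_subset by blast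
  \<comment> \<open>Integration by parts moves the derivative onto \<gamma>, where it is the
    vanishing derivative along \<zeta>.\<close>
  have eq: "integral\<^sup>L (lebesgue_on ?D) (\<lambda>x. \<gamma> x * (\<zeta> \<bullet> grad UNIV \<phi> x)) = 0" if "test_function ?D \<phi>" for \<phi>
  proof -
    have "integral\<^sup>L (lebesgue_on ?D) (\<lambda>x. \<gamma> x * (grad UNIV \<phi> x \<bullet> \<zeta>)) =
        - integral\<^sup>L (lebesgue_on ?D) (\<lambda>x. (grad U g x \<bullet> \<zeta>) * \<phi> x)"
      by (rule integral_by_parts_test[OF D(1) Dm G cg that])
    also have "integral\<^sup>L (lebesgue_on ?D) (\<lambda>x. (grad U g x \<bullet> \<zeta>) * \<phi> x) = integral\<^sup>L (lebesgue_on ?D) (\<lambda>x. 0)"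
      by (rule Bochner_Integration.integral_cong) (use z in auto)
    finally show ?thesis by (simp add: inner_commute)
  qed
  have gv: "grad \<Omega> ?v y = \<zeta>" if "y \<in> \<Omega>" for y
    by (rule grad_inner_smooth_boundary[OF cl \<Omega>(2) that])
  define u where "u = dirichlet_solution p \<Omega> \<gamma> ?v"
  have "\<exists>u. weak_solution p \<Omega> \<gamma> ?v u \<and> (\<exists>b. 0 < b \<and> b < 1 \<and> C1_holder_on b \<Omega> u)"
  proof (intro exI conjI)
    show "weak_solution p \<Omega> \<gamma> ?v ?v"
      by (rule weak_solution_inner[OF compact_imp_bounded[OF \<Omega>(1)] p \<zeta> eq])
    show "0 < (1/2::real)" "(1/2::real) < 1" by auto
    have "?v differentiable_on \<Omega>"
      using GDERIV_inner unfolding differentiable_on_def gderiv_def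
      by (meson differentiableI differentiable_at_withinI)
    then show "C1_holder_on (1/2) \<Omega> ?v"
      unfolding C1_holder_on_def by (auto simp: gv intro!: exI[of _ 0])
  qed
  from someI_ex[OF this] obtain b where u: "weak_solution p \<Omega> \<gamma> ?v u" "0 < b" "C1_holder_on b \<Omega> u"
    unfolding u_def dirichlet_solution_def by blast
  have "u y = \<zeta> \<bullet> y" if "y \<in> \<Omega>" for y
    by (rule affine_solution_unique[OF \<Omega>(1) smooth_boundary_subset_closure_interior[OF cl \<Omega>(2)] p \<zeta>
        c\<gamma> _ eq u(1) refl u(3,2) that]) (use \<gamma>(2) in blast)
  then have "grad \<Omega> u x = \<zeta>" using grad_cong[of \<Omega> u ?v x] x gv by simp
  then show ?thesis using \<zeta> by (simp add: DN_map_def Let_def flip: u_def)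
qed

text \<open>The derivative along the segment vanishes at interior points of \<Omega>. The endpoint
  \<open>y\<close> may lie on the frontier; its value is reached by continuity of the smooth
  extension.\<close>

lemma constant_along_segment:
  fixes \<gamma> :: "real ^ 'n \<Rightarrow> real"
  assumes "closed \<Omega>" "smooth_on_closed \<Omega> \<gamma>" "\<forall>x\<in>\<Omega>. \<zeta> \<bullet> grad \<Omega> \<gamma> x = 0" "y \<in> \<Omega>"
    and seg: "\<And>s. 0 < s \<Longrightarrow> s \<le> 1 \<Longrightarrow> y - (s * h) *\<^sub>R \<zeta> \<in> interior \<Omega>"
  shows "\<gamma> (y - h *\<^sub>R \<zeta>) = \<gamma> y"
proof -
  obtain U g where U: "open U" "\<Omega> \<subseteq> U" "smooth_on U g" "\<forall>x\<in>\<Omega>. g x = \<gamma> x"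
    using assms(2) unfolding smooth_on_closed_def by blast
  let ?l = "\<lambda>s. y - (s * h) *\<^sub>R \<zeta>"
  have l: "?l s \<in> \<Omega>" if "0 \<le> s" "s \<le> 1" for s
    using seg[of s] that assms(4) interior_subset by (cases "s = 0") auto
  have "(\<lambda>s. g (?l s)) 1 = (\<lambda>s. g (?l s)) 0"
  proof (rule DERIV_isconst_end[of 0 1 "\<lambda>s. g (?l s)"])
    show "continuous_on {0..1} (\<lambda>s. g (?l s))"
      by (rule continuous_on_compose2[OF smooth_on_continuous[OF U(1,3)]])
        (use l U(2) in \<open>auto intro!: continuous_intros\<close>)
    fix s :: real assume s: "0 < s" "s < 1"
    have i: "?l s \<in> interior \<Omega>" using seg s by simp
    then have io: "?l s \<in> \<Omega>" using interior_subset by blast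
    have G: "GDERIV g (?l s) :> grad U g (?l s)"
      using smooth_on_GDERIV[OF U(1,3)] io U(2) by blast
    have "GDERIV \<gamma> (?l s) :> grad U g (?l s)"
      by (rule GDERIV_transform_open[OF G open_interior i]) (use U(4) interior_subset in blast)
    then have z: "\<zeta> \<bullet> grad U g (?l s) = 0" using grad_eqI[OF _ i] assms(3) io by metis
    have "((\<lambda>s. ?l s) has_derivative (\<lambda>k. - ((k * h) *\<^sub>R \<zeta>))) (at s)"
      by (auto intro!: derivative_eq_intros)
    from has_derivative_compose[OF this G[unfolded gderiv_def]]
    have "((\<lambda>s. g (?l s)) has_derivative (\<lambda>k. 0)) (at s)" by (simp add: z)
    then show "DERIV (\<lambda>s. g (?l s)) s :> 0" by (simp add: has_field_derivative_def lambda_zero)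
  qed simp
  then have "g (?l 1) = g (?l 0)" .
  moreover have "g (?l 1) = \<gamma> (?l 1)" "g (?l 0) = \<gamma> (?l 0)" using U(4) l[of 1] l[of 0] by auto
  ultimately show ?thesis by simp
qed

theorem corollary1:
  fixes \<Omega> :: "(real ^ 'n) set" and p \<alpha> :: real and \<zeta> :: "real ^ 'n"
    and \<gamma> \<gamma>' :: "real ^ 'n \<Rightarrow> real"
  assumes "CARD('n) \<ge> 3"
    and "0 < \<alpha>" and "\<alpha> \<le> 1"
    and "compact \<Omega>" and "connected \<Omega>" and "interior \<Omega> \<noteq> {}" and "smooth_boundary \<Omega>"
    and "p \<in> {1<..<2} \<union> {2<..}"
    and "norm \<zeta> = 1"
    and "smooth_on_closed \<Omega> \<gamma>" and "\<forall>x\<in>\<Omega>. \<gamma> x > 0"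
    and "smooth_on_closed \<Omega> \<gamma>'" and "\<forall>x\<in>\<Omega>. \<gamma>' x > 0"
    and "\<forall>x\<in>\<Omega>. \<zeta> \<bullet> grad \<Omega> \<gamma> x = 0" and "\<forall>x\<in>\<Omega>. \<zeta> \<bullet> grad \<Omega> \<gamma>' x = 0"
    and "\<forall>f. C1_holder_boundary \<alpha> \<Omega> f \<longrightarrow>
           (\<forall>x\<in>frontier \<Omega>. DN_map p \<Omega> \<gamma> f x = DN_map p \<Omega> \<gamma>' f x)"
  shows "\<forall>x\<in>\<Omega>. \<gamma> x = \<gamma>' x"
proof -
  have p: "p > 1" using assms(8) by auto
  have cl: "closed \<Omega>" using assms(4) by (rule compact_imp_closed)
  have fr: "x \<in> \<Omega>" if "x \<in> frontier \<Omega>" for x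
    using that frontier_subset_closed[OF cl] by blast
  note c = smooth_on_closed_imp_continuous_on
  have affine: "C1_holder_boundary \<alpha> \<Omega> (\<lambda>x. \<zeta> \<bullet> x)"
  proof -
    have "grad UNIV (\<lambda>x. \<zeta> \<bullet> x) y = \<zeta>" for y by (rule grad_eqI[OF GDERIV_inner]) simp
    moreover have "(\<lambda>x. \<zeta> \<bullet> x) differentiable_on UNIV"
      using GDERIV_inner unfolding differentiable_on_def gderiv_def
      by (meson differentiableI differentiable_at_withinI)
    ultimately have "C1_holder_on \<alpha> UNIV (\<lambda>x. \<zeta> \<bullet> x)"
      unfolding C1_holder_on_def by (auto intro!: exI[of _ 0])
    then show ?thesis unfolding C1_holder_boundary_def by (intro exI[of _ UNIV] exI[of _ "\<lambda>x. \<zeta> \<bullet> x"]) auto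
  qed
  have bd: "\<gamma> x = \<gamma>' x" if x: "x \<in> frontier \<Omega>" and "\<zeta> \<bullet> exterior_normal \<Omega> x \<noteq> 0" for x
  proof -
    have "\<gamma> x * (\<zeta> \<bullet> exterior_normal \<Omega> x) = DN_map p \<Omega> \<gamma> (\<lambda>x. \<zeta> \<bullet> x) x"
      by (rule DN_map_inner[OF assms(4,7) p assms(9,10,11,14) fr[OF x], symmetric])
    also have "\<dots> = DN_map p \<Omega> \<gamma>' (\<lambda>x. \<zeta> \<bullet> x) x"
      using assms(16) affine x by blast
    also have "\<dots> = \<gamma>' x * (\<zeta> \<bullet> exterior_normal \<Omega> x)"
      by (rule DN_map_inner[OF assms(4,7) p assms(9,12,13,15) fr[OF x]])
    finally show ?thesis using that(2) by simp
  qed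
  have int: "\<gamma> x0 = \<gamma>' x0" if x0: "x0 \<in> interior \<Omega>" for x0
  proof (rule ccontr)
    assume ne: "\<gamma> x0 \<noteq> \<gamma>' x0"
    \<comment> \<open>Disagreement at \<open>x0\<close> spreads to a ball, which leaves room to move
      to a nearby line that meets the frontier transversally.\<close>
    have "continuous_on (interior \<Omega>) (\<lambda>x. \<gamma> x - \<gamma>' x)"
      using c[OF assms(10)] c[OF assms(12)] interior_subset continuous_on_subset by (blast intro: continuous_on_diff)
    then have "open (interior \<Omega> \<inter> (\<lambda>x. \<gamma> x - \<gamma>' x) -` (- {0}))"
      by (intro continuous_open_preimage) auto
    moreover have "x0 \<in> interior \<Omega> \<inter> (\<lambda>x. \<gamma> x - \<gamma>' x) -` (- {0})" using ne x0 by simp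
    ultimately obtain \<delta> where \<delta>: "\<delta> > 0" "ball x0 \<delta> \<subseteq> interior \<Omega> \<inter> (\<lambda>x. \<gamma> x - \<gamma>' x) -` (- {0})"
      unfolding open_contains_ball by blast
    obtain y h a where y: "y \<in> frontier \<Omega>" "\<And>s. 0 < s \<Longrightarrow> s \<le> 1 \<Longrightarrow> y - (s * h) *\<^sub>R \<zeta> \<in> interior \<Omega>"
      "dist (y - h *\<^sub>R \<zeta>) x0 < \<delta>" "a \<bullet> \<zeta> \<noteq> 0"
      "\<And>e. a \<bullet> e < 0 \<Longrightarrow> \<exists>\<tau>>0. \<forall>t. 0 < t \<and> t < \<tau> \<longrightarrow> y + t *\<^sub>R e \<in> interior \<Omega>"
      using reach_frontier_transversally[OF assms(4) x0 assms(9) \<delta>(1)] by metis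
    obtain U \<rho> where L: "local_defining_function \<Omega> y U \<rho>"
      using assms(7) y(1) by (auto simp: smooth_boundary_def)
    note A = local_defining_function_frontier[OF cl y(1) L]
    \<comment> \<open>Inward directions of the touching ellipsoid enter \<Omega>, so its normal
      \<open>a\<close>, which is not orthogonal to \<zeta>, is parallel to the normal of the
      boundary.\<close>
    have "grad U \<rho> y \<bullet> e \<le> 0" if e: "a \<bullet> e < 0" for e
    proof -
      obtain \<tau> where "\<tau> > 0" "\<forall>t. 0 < t \<and> t < \<tau> \<longrightarrow> y + t *\<^sub>R e \<in> interior \<Omega>"
        using y(5)[OF e] by blast
      then show ?thesis using interior_subset by (intro A(5)[of \<tau>]) auto
    qed
    moreover have "a \<noteq> 0" using y(4) by auto
    ultimately obtain l where l: "grad U \<rho> y = l *\<^sub>R a"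
      using half_space_subset_imp_parallel by blast
    have "\<zeta> \<bullet> exterior_normal \<Omega> y \<noteq> 0"
      using A(2) y(4) unfolding exterior_normal_eq[OF cl y(1) L] l by (simp add: inner_commute)
    then have "\<gamma> y = \<gamma>' y" using bd y(1) by blast
    then have "\<gamma> (y - h *\<^sub>R \<zeta>) = \<gamma>' (y - h *\<^sub>R \<zeta>)"
      using constant_along_segment[OF cl assms(10,14) fr[OF y(1)] y(2)]
        constant_along_segment[OF cl assms(12,15) fr[OF y(1)] y(2)] by simp
    moreover have "y - h *\<^sub>R \<zeta> \<in> ball x0 \<delta>" using y(3) by (simp add: dist_commute)
    ultimately show False using \<delta>(2) by auto
  qed
  show ?thesis
  proof
    fix x assume x: "x \<in> \<Omega>"
    show "\<gamma> x = \<gamma>' x"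
    proof (cases "x \<in> interior \<Omega>")
      case False
      then have f: "x \<in> frontier \<Omega>" using x closure_subset by (auto simp: frontier_def)
      \<comment> \<open>Every frontier point is a limit of interior points, so equality passes to it
        by continuity.\<close>
      have "closure (interior \<Omega>) \<subseteq> \<Omega>" using cl by (simp add: closure_minimal interior_subset)
      then have "continuous_on (closure (interior \<Omega>)) (\<lambda>x. \<gamma> x - \<gamma>' x)"
        using c[OF assms(10)] c[OF assms(12)] continuous_on_subset by (blast intro: continuous_on_diff)
      then have "\<gamma> x - \<gamma>' x = 0"
        using continuous_constant_on_closure[of "interior \<Omega>" "\<lambda>x. \<gamma> x - \<gamma>' x" 0 x] int
          smooth_boundary_subset_closure_interior[OF cl assms(7)] x by auto
      then show ?thesis by simp
    qed (rule int)
  qed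
qed

end
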